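(* Let $x: M^n \to \mathbb{R}^{n+1}$ be a closed orientable self-shrinker (an isometric immersion satisfying $H = -\rho/2$ on $M$) such that $H_{r+1}$ is constant for some $1 \le r \le n-1$. Then $M = \mathbb{S}^n(\sqrt{2n})$.
   Context: $x: M^n \to \mathbb{R}^{n+1}$ is a (smooth) isometric immersion of an orientable $n$-dimensional Riemannian manifold; "closed" means compact with empty boundary. The immersion is not assumed to be an embedding. $N$ is a unit normal vector field globally defined on $M$, and $A$ is the second fundamental form (shape operator) with respect to $N$, with the sign convention $A(X) = -D_X N$, where $D$ is the flat connection of $\mathbb{R}^{n+1}$. For $r = 1,\dots,n$, $S_r$ is the $r$-th elementary symmetric function of the eigenvalues of $A$, $S_0=1$, and the $r$-mean curvature is $H_r = \binom{n}{r}^{-1} S_r$. The support function is $\rho = \langle x, N\rangle: M \to \mathbb{R}$. $H = S_1 = \mathrm{tr}\, A = nH_1$ denotes the non-normalized mean curvature. $M$ is called a self-shrinker if $H = -\frac{\rho}{2}$ on $M$. $\mathbb{S}^n(\sqrt{2n})$ denotes the round sphere of radius $\sqrt{2n}$ in $\mathbb{R}^{n+1}$ centered at the origin; the equality $M = \mathbb{S}^n(\sqrt{2n})$ means that the immersed hypersurface is this sphere.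
   Formalization: The manifold M is assumed nonempty and connected; otherwise two disjoint copies of the sphere, each mapped onto the sphere of radius √(2n), satisfy every hypothesis while M is not that sphere. *)

theory Defs
  imports "HOL-Analysis.Analysis"
begin

section \<open>Smooth maps between Euclidean spaces\<close>

text \<open>Intended for open \<open>S\<close>. \<open>C_k_on k S f\<close>: all iterated directional derivatives of \<open>f\<close> up
  to order \<open>k\<close> exist as Frechet derivatives and are continuous on \<open>S\<close>.\<close>

fun C_k_on :: "nat \<Rightarrow> 'a::euclidean_space set \<Rightarrow> ('a \<Rightarrow> 'b::euclidean_space) \<Rightarrow> bool" where
  "C_k_on 0 S f \<longleftrightarrow> continuous_on S f"
| "C_k_on (Suc k) S f \<longleftrightarrow>
     (\<forall>u\<in>S. f differentiable (at u)) \<and>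
     (\<forall>v. C_k_on k S (\<lambda>u. frechet_derivative f (at u) v))"

definition smooth_on :: "'a::euclidean_space set \<Rightarrow> ('a \<Rightarrow> 'b::euclidean_space) \<Rightarrow> bool" where
  "smooth_on S f \<longleftrightarrow> (\<forall>k. C_k_on k S f)"


section \<open>Closed smooth manifolds\<close>

text \<open>A chart \<open>(U, \<phi>)\<close> of the space \<open>M\<close> is a homeomorphism \<open>\<phi>\<close> from a relatively open subset \<open>U\<close>
  of \<open>M\<close> onto an open subset of the model space \<open>'a\<close>; the manifold has dimension \<open>DIM('a)\<close>
  and no boundary.\<close>

type_synonym ('m, 'a) chart = "'m set \<times> ('m \<Rightarrow> 'a)"

definition is_chart :: "'m::t2_space set \<Rightarrow> ('m, 'a::euclidean_space) chart \<Rightarrow> bool" where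
  "is_chart M = (\<lambda>(U, \<phi>). openin (top_of_set M) U \<and> open (\<phi> ` U) \<and>
                          homeomorphism U (\<phi> ` U) \<phi> (inv_into U \<phi>))"

definition smooth_atlas :: "'m::t2_space set \<Rightarrow> ('m, 'a::euclidean_space) chart set \<Rightarrow> bool" where
  "smooth_atlas M \<A> \<longleftrightarrow>
     (\<forall>c\<in>\<A>. is_chart M c) \<and> (\<Union>(U, \<phi>)\<in>\<A>. U) = M \<and>
     (\<forall>(U, \<phi>)\<in>\<A>. \<forall>(V, \<psi>)\<in>\<A>. smooth_on (\<phi> ` (U \<inter> V)) (\<psi> \<circ> inv_into U \<phi>))"

text \<open>Second countability is automatic for a compact locally Euclidean space.\<close>

definition closed_manifold :: "'m::t2_space set \<Rightarrow> ('m, 'a::euclidean_space) chart set \<Rightarrow> bool" where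
  "closed_manifold M \<A> \<longleftrightarrow> smooth_atlas M \<A> \<and> compact M \<and> M \<noteq> {}"

definition smooth_map ::
  "('m, 'a::euclidean_space) chart set \<Rightarrow> ('m \<Rightarrow> 'b::euclidean_space) \<Rightarrow> bool" where
  "smooth_map \<A> f \<longleftrightarrow> (\<forall>(U, \<phi>)\<in>\<A>. smooth_on (\<phi> ` U) (f \<circ> inv_into U \<phi>))"

text \<open>The tangent space at \<open>p\<close> is identified with the model space \<open>'a\<close> by means of one fixed chart
  around \<open>p\<close>, the same for all maps. Another choice of chart changes the identification by a linear
  isomorphism, so it replaces the shape operator below by a conjugate one and leaves its eigenvalues
  unchanged.\<close>

definition chart_at :: "('m, 'a) chart set \<Rightarrow> 'm \<Rightarrow> ('m, 'a) chart" where
  "chart_at \<A> p = (SOME c. c \<in> \<A> \<and> p \<in> fst c)"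

definition differential ::
  "('m, 'a::euclidean_space) chart set \<Rightarrow> ('m \<Rightarrow> 'b::euclidean_space) \<Rightarrow> 'm \<Rightarrow> 'a \<Rightarrow> 'b" where
  "differential \<A> f p =
     (case chart_at \<A> p of (U, \<phi>) \<Rightarrow> frechet_derivative (f \<circ> inv_into U \<phi>) (at (\<phi> p)))"


section \<open>Immersed hypersurfaces\<close>

text \<open>The Riemannian metric of \<open>M\<close> is the one induced by the immersion \<open>x\<close>, that is
  \<open>g\<^sub>p(v, w) = differential \<A> x p v \<bullet> differential \<A> x p w\<close>; an immersion is isometric for this metric
  and for no other, so the metric is not a separate datum.\<close>

definition immersion ::
  "'m set \<Rightarrow> ('m, 'a::euclidean_space) chart set \<Rightarrow> ('m \<Rightarrow> 'b::euclidean_space) \<Rightarrow> bool" where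
  "immersion M \<A> x \<longleftrightarrow> smooth_map \<A> x \<and> (\<forall>p\<in>M. inj (differential \<A> x p))"

text \<open>For a hypersurface of Euclidean space, a global unit normal field exists if and only if \<open>M\<close> is
  orientable.\<close>

definition unit_normal_field ::
  "'m set \<Rightarrow> ('m, 'a::euclidean_space) chart set \<Rightarrow> ('m \<Rightarrow> 'b::euclidean_space) \<Rightarrow> ('m \<Rightarrow> 'b) \<Rightarrow> bool"
where
  "unit_normal_field M \<A> x N \<longleftrightarrow> smooth_map \<A> N \<and>
     (\<forall>p\<in>M. norm (N p) = 1 \<and> (\<forall>v. differential \<A> x p v \<bullet> N p = 0))"

text \<open>The shape operator \<open>A(X) = - D\<^sub>X N\<close> as an endomorphism of the tangent space. Since
  \<open>D\<^sub>X N\<close> is orthogonal to \<open>N\<close>, it lies in the range of the injective map \<open>differential \<A> x p\<close> in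
  codimension one, so the operator exists and is unique.\<close>

definition shape_operator ::
  "('m, 'a::euclidean_space) chart set \<Rightarrow> ('m \<Rightarrow> 'b::euclidean_space) \<Rightarrow> ('m \<Rightarrow> 'b) \<Rightarrow> 'm \<Rightarrow> 'a \<Rightarrow> 'a"
where
  "shape_operator \<A> x N p =
     (THE A. linear A \<and> (\<forall>v. differential \<A> x p (A v) = - differential \<A> N p v))"

text \<open>The eigenvalues of \<open>A\<close> counted with multiplicity: an eigenvalue \<open>\<kappa>\<close> whose eigenspace has
  dimension \<open>m\<close> is listed as \<open>(\<kappa>, 0), \<dots>, (\<kappa>, m - 1)\<close>. Shape operators are self-adjoint for the
  induced metric, so geometric and algebraic multiplicities agree and there are exactly
  \<open>DIM('a)\<close> entries.\<close>

definition eigenvalues :: "('a::euclidean_space \<Rightarrow> 'a) \<Rightarrow> (real \<times> nat) set" where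
  "eigenvalues A = {(\<kappa>, j). j < dim {v. A v = \<kappa> *\<^sub>R v}}"

definition S_curv ::
  "('m, 'a::euclidean_space) chart set \<Rightarrow> ('m \<Rightarrow> 'b::euclidean_space) \<Rightarrow> ('m \<Rightarrow> 'b) \<Rightarrow> nat \<Rightarrow> 'm \<Rightarrow> real"
where
  "S_curv \<A> x N r p =
     (\<Sum>I | I \<subseteq> eigenvalues (shape_operator \<A> x N p) \<and> card I = r. \<Prod>(\<kappa>, j)\<in>I. \<kappa>)"

definition mean_curv ::
  "('m, 'a::euclidean_space) chart set \<Rightarrow> ('m \<Rightarrow> 'b::euclidean_space) \<Rightarrow> ('m \<Rightarrow> 'b) \<Rightarrow> nat \<Rightarrow> 'm \<Rightarrow> real"
where
  "mean_curv \<A> x N r p = S_curv \<A> x N r p / real (DIM('a) choose r)"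

definition support_function ::
  "('m \<Rightarrow> 'b::euclidean_space) \<Rightarrow> ('m \<Rightarrow> 'b) \<Rightarrow> 'm \<Rightarrow> real" where
  "support_function x N p = x p \<bullet> N p"

text \<open>Here \<open>H = S\<^sub>1\<close> is the non-normalized mean curvature.\<close>

definition self_shrinker ::
  "'m set \<Rightarrow> ('m, 'a::euclidean_space) chart set \<Rightarrow> ('m \<Rightarrow> 'b::euclidean_space) \<Rightarrow> ('m \<Rightarrow> 'b) \<Rightarrow> bool"
where
  "self_shrinker M \<A> x N \<longleftrightarrow> (\<forall>p\<in>M. S_curv \<A> x N 1 p = - support_function x N p / 2)"

end

theory Submission
  imports Defs
begin

text \<open>Let \<open>p\<close> be a point where \<open>|x|\<close> attains its maximum \<open>R\<close>, and let \<open>k = r + 1\<close>, \<open>n = DIM('a)\<close>. There \<open>x\<close> is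
  normal to the hypersurface, so for a suitable orientation every principal curvature \<open>d\<close> is at least
  \<open>1 / R\<close>, and their sum is \<open>R / 2\<close>.
  Write the hypersurface near \<open>p\<close> as the graph of a function \<open>F\<close> over the tangent plane, in coordinates
  diagonalizing the shape operator at \<open>p\<close>. Because \<open>S\<^sub>k\<close> is constant and the principal curvatures stay
  positive near \<open>p\<close>, Garding's inequality says that the linearization of \<open>S\<^sub>k\<close> at \<open>p\<close>, evaluated on the
  shape operator at nearby points, has a minimum at \<open>p\<close>. Comparing the Laplacian of this function at \<open>p\<close>
  with the second derivatives of the self-shrinker equation yields \<open>|A|\<^sup>2 \<le> 1 / 2\<close> at \<open>p\<close>. Together with
  \<open>d \<ge> 1 / R\<close> this forces \<open>R\<^sup>2 = 2 n\<close> and \<open>d = 1 / R\<close> for all \<open>d\<close>.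
  Garding's inequality now gives \<open>H \<ge> n / R = R / 2\<close> near \<open>p\<close>, while \<open>H = |\<rho>| / 2 \<le> |x| / 2 \<le> R / 2\<close>. Hence
  \<open>|x| = R\<close> near \<open>p\<close>, so \<open>{|x| = R}\<close> is open, closed and nonempty, and \<open>x\<close> is a local homeomorphism of the
  compact space \<open>M\<close> to a simply connected sphere, hence a bijection.\<close>

section \<open>Maps of class C^k\<close>

text \<open>Principal curvatures need not be differentiable where they coincide, and the argument
  ends at an umbilic point, so no eigenvalue is ever differentiated. Only the diagonal entries
  \<open>graph_shape F y e \<bullet> e\<close> in a basis fixed near \<open>p\<close> are. The
  passage from eigenvalues to these entries goes through doubly stochastic matrices. Let P k be the
  partial derivatives of the elementary symmetric function at d, and K = \<Sum> P k d_k. The second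
  difference of the Garding inequality in direction v reads K d_v^2 \<le> \<Sum>_k P k F_vvkk - 2 P
  v d_v^3, and that of the shrinker equation \<Sum>_e F_vvee = 2 d_v^3 + d_v / 2. Summing the former
  over v and inserting the latter, the cubic terms cancel as well and K |A|^2 \<le> K / 2 remains.
  The constant 1/2 stems from the right side (y \<bullet> grad F - F) / 2, which multiplies the
  quadratic part of F by 1/2. The value of R results from n / R \<le> R / 2 and 0 \<le> \<Sum> (d -
  1 / R)^2 \<le> n / R^2 - 1/2.\<close>

abbreviation "fderiv f u \<equiv> frechet_derivative f (at u)"

lemma C_k_on_cong:
  assumes "open S" "\<And>u. u \<in> S \<Longrightarrow> f u = g u" "C_k_on k S f"
  shows "C_k_on k S g"
  using assms
proof (induction k arbitrary: f g)
  case 0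
  then show ?case by (simp cong: continuous_on_cong)
next
  case (Suc k)
  have der: "(g has_derivative fderiv f u) (at u)" if "u \<in> S" for u
    using Suc.prems that
    by (metis C_k_on.simps(2) frechet_derivative_works has_derivative_transform_within_open)
  then have eq: "fderiv f u = fderiv g u" if "u \<in> S" for u
    using that frechet_derivative_at by blast
  have "C_k_on k S (\<lambda>u. fderiv g u v)" for v
    using Suc.IH[of "\<lambda>u. fderiv f u v" "\<lambda>u. fderiv g u v"]
      Suc.prems eq by auto
  then show ?case using der by (auto simp: differentiable_def)
qed

lemma C_k_on_subset: "C_k_on k S f \<Longrightarrow> T \<subseteq> S \<Longrightarrow> C_k_on k T f"
  by (induction k arbitrary: f) (auto intro: continuous_on_subset)

lemma C_k_on_Suc_imp: "C_k_on (Suc k) S f \<Longrightarrow> C_k_on k S f"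
proof (induction k arbitrary: f)
  case 0
  then show ?case
    by (auto intro!: continuous_at_imp_continuous_on differentiable_imp_continuous_within)
next
  case (Suc k)
  then show ?case by (metis C_k_on.simps(2))
qed

lemma C_k_on_le: "C_k_on m S f \<Longrightarrow> k \<le> m \<Longrightarrow> C_k_on k S f"
  by (induction m) (auto simp: le_Suc_eq intro: C_k_on_Suc_imp simp del: C_k_on.simps(2))

lemma C_k_on_imp_continuous_on: "C_k_on k S f \<Longrightarrow> continuous_on S f"
  using C_k_on_le[of k S f 0] by simp

text \<open>Derivatives at points of an open set are unique, so an explicit field \<open>f'\<close>
  may stand for \<open>frechet_derivative\<close>. The inductions below supply the product and chain
  rules in this form.\<close>

lemma C_k_on_SucI:
  assumes "open S"
    and "\<And>u. u \<in> S \<Longrightarrow> (f has_derivative f' u) (at u)"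
    and "\<And>v. C_k_on k S (\<lambda>u. f' u v)"
  shows "C_k_on (Suc k) S f"
proof -
  have "fderiv f u = f' u" if "u \<in> S" for u
    using assms(2)[OF that] frechet_derivative_at by metis
  then have "C_k_on k S (\<lambda>u. fderiv f u v)" for v
    using assms(1,3) by (auto intro: C_k_on_cong[of S "\<lambda>u. f' u v"])
  then show ?thesis using assms(2) by (auto simp: differentiable_def)
qed

lemma C_k_on_SucD:
  assumes "C_k_on (Suc k) S f"
  shows "u \<in> S \<Longrightarrow> (f has_derivative fderiv f u) (at u)"
    and "C_k_on k S (\<lambda>u. fderiv f u v)"
  using assms by (auto simp: frechet_derivative_works[symmetric])

lemma C_k_on_const: "open S \<Longrightarrow> C_k_on k S (\<lambda>u. c)"
proof (induction k arbitrary: c)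
  case (Suc k)
  show ?case
    by (rule C_k_on_SucI[where f' = "\<lambda>u v. 0"]) (use Suc in auto)
qed auto

lemma C_k_on_bounded_linear:
  assumes "bounded_linear L" "open S" "C_k_on k S f"
  shows "C_k_on k S (\<lambda>u. L (f u))"
  using assms(3)
proof (induction k arbitrary: f)
  case 0
  then show ?case using bounded_linear.continuous_on[OF assms(1)] by simp
next
  case (Suc k)
  show ?case
  proof (rule C_k_on_SucI[where f' = "\<lambda>u v. L (fderiv f u v)"])
    show "((\<lambda>u. L (f u)) has_derivative (\<lambda>v. L (fderiv f u v))) (at u)"
      if "u \<in> S" for u
      using bounded_linear.has_derivative[OF assms(1) C_k_on_SucD(1)[OF Suc.prems that]] .
    show "C_k_on k S (\<lambda>u. L (fderiv f u v))" for v
      by (rule Suc.IH[OF C_k_on_SucD(2)[OF Suc.prems]])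
  qed (rule assms)
qed

lemma C_k_on_add:
  assumes "open S" "C_k_on k S f" "C_k_on k S g"
  shows "C_k_on k S (\<lambda>u. f u + g u)"
  using assms(2,3)
proof (induction k arbitrary: f g)
  case 0
  then show ?case by (auto intro: continuous_intros)
next
  case (Suc k)
  show ?case
  proof (rule C_k_on_SucI[where
        f' = "\<lambda>u v. fderiv f u v + fderiv g u v"])
    show "((\<lambda>u. f u + g u) has_derivative
        (\<lambda>v. fderiv f u v + fderiv g u v)) (at u)"
      if "u \<in> S" for u
      by (rule has_derivative_add[OF C_k_on_SucD(1)[OF Suc.prems(1) that]
            C_k_on_SucD(1)[OF Suc.prems(2) that]])
    show "C_k_on k S (\<lambda>u. fderiv f u v + fderiv g u v)" for v
      by (rule Suc.IH[OF C_k_on_SucD(2)[OF Suc.prems(1)] C_k_on_SucD(2)[OF Suc.prems(2)]])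
  qed (rule assms)
qed

lemma C_k_on_sum:
  assumes "open S" "\<And>i. i \<in> I \<Longrightarrow> C_k_on k S (f i)"
  shows "C_k_on k S (\<lambda>u. \<Sum>i\<in>I. f i u)"
  using assms(2)
  by (induction I rule: infinite_finite_induct) (auto intro: C_k_on_const C_k_on_add assms(1))

lemma C_k_on_bilinear:
  assumes "bounded_bilinear B" "open S" "C_k_on k S f" "C_k_on k S g"
  shows "C_k_on k S (\<lambda>u. B (f u) (g u))"
  using assms(3,4)
proof (induction k arbitrary: f g)
  case 0
  then show ?case using bounded_bilinear.continuous_on[OF assms(1)] by auto
next
  case (Suc k)
  show ?case
  proof (rule C_k_on_SucI[where f' = "\<lambda>u v. B (f u) (fderiv g u v)
      + B (fderiv f u v) (g u)"])
    show "((\<lambda>u. B (f u) (g u)) has_derivative (\<lambda>v. B (f u) (fderiv g u v)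
      + B (fderiv f u v) (g u))) (at u)" if "u \<in> S" for u
      using C_k_on_SucD(1)[OF Suc.prems(1) that] C_k_on_SucD(1)[OF Suc.prems(2) that]
      by (rule bounded_bilinear.FDERIV[OF assms(1)])
    show "C_k_on k S (\<lambda>u. B (f u) (fderiv g u v)
        + B (fderiv f u v) (g u))" for v
      by (intro C_k_on_add assms(2) Suc.IH C_k_on_SucD(2)[OF Suc.prems(1)]
          C_k_on_SucD(2)[OF Suc.prems(2)] C_k_on_Suc_imp[OF Suc.prems(1)]
          C_k_on_Suc_imp[OF Suc.prems(2)])
  qed (rule assms)
qed

lemma linear_sum_Basis:
  fixes L :: "'a::euclidean_space \<Rightarrow> 'b::real_vector"
  assumes "linear L"
  shows "L v = (\<Sum>b\<in>Basis. (v \<bullet> b) *\<^sub>R L b)"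
  by (metis (no_types, lifting) assms euclidean_representation linear_scale linear_sum sum.cong)

lemma C_k_on_compose:
  fixes f :: "'b::euclidean_space \<Rightarrow> 'c::euclidean_space" and g :: "'a::euclidean_space \<Rightarrow> 'b"
  assumes "open S" "open T" "g ` S \<subseteq> T" "C_k_on k S g" "C_k_on k T f"
  shows "C_k_on k S (f \<circ> g)"
  using assms(4,5)
proof (induction k arbitrary: f)
  case 0
  then show ?case
    using assms(3) unfolding C_k_on.simps by (meson continuous_on_compose continuous_on_subset)
next
  case (Suc k)
  define f' where "f' u = fderiv f u" for u
  define g' where "g' u = fderiv g u" for u
  have f': "(f has_derivative f' u) (at u)" if "u \<in> T" for u
    using C_k_on_SucD(1)[OF Suc.prems(2) that] by (simp add: f'_def)
  have g': "(g has_derivative g' u) (at u)" if "u \<in> S" for u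
    using C_k_on_SucD(1)[OF Suc.prems(1) that] by (simp add: g'_def)
  have Cg: "C_k_on k S g" using C_k_on_Suc_imp[OF Suc.prems(1)] .
  \<comment> \<open>\<open>C_k_on\<close> differentiates in fixed directions only, while the chain
    rule evaluates \<open>f' (g u)\<close> at the varying vector \<open>g' u v\<close>. Expanding
    that vector in \<open>Basis\<close> leaves products of scalars with \<open>f' (g u) b\<close>
    for fixed \<open>b\<close>.\<close>
  show ?case
  proof (rule C_k_on_SucI[where f' = "\<lambda>u v. \<Sum>b\<in>Basis. (g' u v \<bullet> b) *\<^sub>R f' (g u) b"])
    fix u assume u: "u \<in> S"
    then have lin: "linear (f' (g u))"
      using f'[of "g u"] assms(3) has_derivative_linear by blast
    have "(f \<circ> g has_derivative f' (g u) \<circ> g' u) (at u)"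
      using diff_chain_at[OF g'[OF u] f'[of "g u"]] u assms(3) by auto
    then show "(f \<circ> g has_derivative (\<lambda>v. \<Sum>b\<in>Basis. (g' u v \<bullet> b) *\<^sub>R f' (g u) b)) (at u)"
      by (simp only: linear_sum_Basis[OF lin, symmetric] comp_def)
  next
    fix v
    show "C_k_on k S (\<lambda>u. \<Sum>b\<in>Basis. (g' u v \<bullet> b) *\<^sub>R f' (g u) b)"
    proof (intro C_k_on_sum C_k_on_bilinear[OF bounded_bilinear_scaleR] assms(1))
      fix b :: 'b
      show "C_k_on k S (\<lambda>u. g' u v \<bullet> b)"
        unfolding g'_def
        by (rule C_k_on_bounded_linear[OF bounded_linear_inner_left assms(1)
              C_k_on_SucD(2)[OF Suc.prems(1)]])
      have "C_k_on k S ((\<lambda>u. f' u b) \<circ> g)"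
        unfolding f'_def by (rule Suc.IH[OF Cg C_k_on_SucD(2)[OF Suc.prems(2)]])
      then show "C_k_on k S (\<lambda>u. f' (g u) b)" by (simp add: comp_def)
    qed
  qed (rule assms)
qed

section \<open>Smoothness of local inverses\<close>

text \<open>In the product rule the derivative of \<open>c\<close> is multiplied by
  \<open>h u0 = 0\<close>, so continuity of \<open>c\<close> is enough. This makes it possible to
  differentiate inverse operators knowing only that they are continuous.\<close>

lemma has_derivative_scaleR_vanishing:
  fixes h :: "'a::real_normed_vector \<Rightarrow> 'b::real_normed_vector"
  assumes c: "isCont c u0" and h: "(h has_derivative h') (at u0)" and h0: "h u0 = 0"
  shows "((\<lambda>u. c u *\<^sub>R h u) has_derivative (\<lambda>w. c u0 *\<^sub>R h' w)) (at u0)"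
proof -
  have bl: "bounded_linear h'" using h has_derivative_bounded_linear by blast
  then obtain K where K: "\<And>w. norm (h' w) \<le> norm w * K"
    using bounded_linear.bounded by blast
  define q where "q u = norm (h u - h u0 - h' (u - u0)) / norm (u - u0)" for u
  have q: "(q \<longlongrightarrow> 0) (at u0)"
    using h unfolding has_derivative_iff_norm q_def by simp
  have "((\<lambda>u. (c u - c u0) *\<^sub>R h u) has_derivative (\<lambda>w. 0)) (at u0)"
    unfolding has_derivative_iff_norm
  proof
    have "((\<lambda>u. \<bar>c u - c u0\<bar> * (q u + K)) \<longlongrightarrow> \<bar>c u0 - c u0\<bar> * (0 + K)) (at u0)"
      using c q by (intro tendsto_intros) (auto simp: isCont_def)
    then have lim: "((\<lambda>u. \<bar>c u - c u0\<bar> * (q u + K)) \<longlongrightarrow> 0) (at u0)" by simp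
    show "((\<lambda>u. norm ((c u - c u0) *\<^sub>R h u - (c u0 - c u0) *\<^sub>R h u0 - 0) / norm (u - u0)) \<longlongrightarrow> 0) (at u0)"
    proof (rule Lim_null_comparison[OF _ lim])
      show "\<forall>\<^sub>F u in at u0. norm (norm ((c u - c u0) *\<^sub>R h u - (c u0 - c u0) *\<^sub>R h u0 - 0) / norm (u - u0))
          \<le> \<bar>c u - c u0\<bar> * (q u + K)"
        unfolding eventually_at_filter
      proof (intro always_eventually allI impI)
        fix u assume u: "u \<noteq> u0"
        have "norm (h u) \<le> norm (h u - h' (u - u0)) + norm (h' (u - u0))"
          by (metis diff_add_cancel norm_triangle_ineq)
        also have "\<dots> \<le> norm (h u - h' (u - u0)) + norm (u - u0) * K"
          using K by simp
        also have "\<dots> = (q u + K) * norm (u - u0)"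
          using u h0 by (simp add: q_def field_simps)
        finally have "norm (h u) / norm (u - u0) \<le> q u + K"
          using u by (simp add: field_simps)
        then show "norm (norm ((c u - c u0) *\<^sub>R h u - (c u0 - c u0) *\<^sub>R h u0 - 0) / norm (u - u0))
          \<le> \<bar>c u - c u0\<bar> * (q u + K)"
          using mult_left_mono[of "norm (h u) / norm (u - u0)" "q u + K" "\<bar>c u - c u0\<bar>"] by simp
      qed
    qed
  qed simp
  moreover have "((\<lambda>u. c u0 *\<^sub>R h u) has_derivative (\<lambda>w. c u0 *\<^sub>R h' w)) (at u0)"
    by (intro derivative_intros h)
  ultimately have "((\<lambda>u. (c u - c u0) *\<^sub>R h u + c u0 *\<^sub>R h u) has_derivative (\<lambda>w. 0 + c u0 *\<^sub>R h' w)) (at u0)"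
    by (rule has_derivative_add)
  then show ?thesis by (simp add: algebra_simps)
qed

lemma linear_norm_le_Basis:
  fixes L :: "'a::euclidean_space \<Rightarrow> 'b::real_normed_vector"
  assumes "linear L"
  shows "norm (L w) \<le> norm w * (\<Sum>b\<in>Basis. norm (L b))"
proof -
  have "norm (L w) \<le> (\<Sum>b\<in>Basis. norm ((w \<bullet> b) *\<^sub>R L b))"
    unfolding linear_sum_Basis[OF assms, of w] by (rule norm_sum)
  also have "\<dots> \<le> (\<Sum>b\<in>Basis. norm w * norm (L b))"
    by (intro sum_mono) (simp add: Basis_le_norm mult_right_mono)
  finally show ?thesis by (simp add: sum_distrib_left)
qed

text \<open>\<open>L u0\<close> is bounded below by some \<open>c > 0\<close>. Operators within
  \<open>c / 2\<close> of it are bounded below by \<open>c / 2\<close>, so the preimages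
  \<open>m u\<close> of \<open>v\<close> stay bounded. Then
  \<open>L u0 (m u - m u0) = L u0 (m u) - L u (m u)\<close> is small.\<close>

lemma continuous_on_inv_derivative:
  fixes L :: "'c::euclidean_space \<Rightarrow> 'a::euclidean_space \<Rightarrow> 'a"
  assumes "open S" and lin: "\<And>u. u \<in> S \<Longrightarrow> linear (L u)" and bij: "\<And>u. u \<in> S \<Longrightarrow> bij (L u)"
    and cont: "\<And>v. continuous_on S (\<lambda>u. L u v)"
  shows "continuous_on S (\<lambda>u. inv (L u) v)"
proof -
  have "((\<lambda>u. inv (L u) v) \<longlongrightarrow> inv (L u0) v) (at u0)" if u0: "u0 \<in> S" for u0
  proof -
    define m where "m u = inv (L u) v" for u
    have Lm: "L u (m u) = v" if "u \<in> S" for u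
      using bij[OF that] by (simp add: m_def bij_is_surj surj_f_inv_f)
    define s where "s u = (\<Sum>b\<in>Basis. norm (L u b - L u0 b))" for u
    have "((\<lambda>u. L u b) \<longlongrightarrow> L u0 b) (at u0)" for b
      using cont[of b] u0 unfolding continuous_on_eq_continuous_at[OF assms(1)] by (auto simp: isCont_def)
    then have "(s \<longlongrightarrow> (\<Sum>b\<in>Basis. norm (L u0 b - L u0 b))) (at u0)"
      unfolding s_def[abs_def] by (intro tendsto_intros)
    then have s: "(s \<longlongrightarrow> 0) (at u0)" by simp
    obtain c where c: "c > 0" "\<And>w. c * norm w \<le> norm (L u0 w)"
      using linear_inj_bounded_below_pos[OF lin[OF u0]] bij[OF u0] bij_is_inj by (metis mult.commute)
    have diff: "norm (L u w - L u0 w) \<le> norm w * s u" if "u \<in> S" for u w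
      using linear_norm_le_Basis[OF linear_compose_sub[OF lin[OF that] lin[OF u0]]]
      by (simp add: s_def)
    have bound: "norm (m u - m u0) \<le> 2 * norm v / (c * c) * s u" if "u \<in> S" "s u < c / 2" for u
    proof -
      have "c * norm (m u) \<le> norm (L u0 (m u))" by (rule c)
      also have "\<dots> \<le> norm (L u (m u)) + norm (L u (m u) - L u0 (m u))"
        by (metis norm_minus_commute norm_triangle_sub)
      also have "\<dots> \<le> norm v + norm (m u) * s u" using Lm[OF that(1)] diff[OF that(1), of "m u"] by simp
      also have "\<dots> \<le> norm v + norm (m u) * (c / 2)" using that by (intro add_left_mono mult_left_mono) auto
      finally have m: "norm (m u) \<le> 2 * norm v / c" using c by (simp add: field_simps)
      have "L u0 (m u - m u0) = L u0 (m u) - L u (m u)"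
        using Lm[OF that(1)] Lm[OF u0] linear_diff[OF lin[OF u0]] by simp
      then have "c * norm (m u - m u0) \<le> norm (L u (m u) - L u0 (m u))"
        using c(2)[of "m u - m u0"] by (simp add: norm_minus_commute)
      also have "\<dots> \<le> norm (m u) * s u" by (rule diff[OF that(1)])
      also have "\<dots> \<le> 2 * norm v / c * s u"
        using m by (intro mult_right_mono) (auto simp: s_def sum_nonneg)
      finally show ?thesis using c by (simp add: field_simps)
    qed
    have "eventually (\<lambda>u. s u < c / 2) (at u0)"
      by (rule order_tendstoD(2)[OF s]) (use c(1) in simp)
    moreover have "eventually (\<lambda>u. u \<in> S) (at u0)"
      using assms(1) u0 by (meson eventually_at_topological)
    ultimately have "eventually (\<lambda>u. norm (m u - m u0) \<le> 2 * norm v / (c * c) * s u) (at u0)"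
      by eventually_elim (rule bound)
    moreover have "((\<lambda>u. 2 * norm v / (c * c) * s u) \<longlongrightarrow> 2 * norm v / (c * c) * 0) (at u0)"
      by (intro tendsto_intros s)
    ultimately have "((\<lambda>u. m u - m u0) \<longlongrightarrow> 0) (at u0)"
      by (simp add: Lim_null_comparison)
    then show ?thesis unfolding m_def by (simp add: LIM_zero_iff)
  qed
  then show ?thesis
    using assms(1) by (simp add: continuous_on_eq_continuous_at isCont_def)
qed

text \<open>With \<open>m u = inv (L u) v\<close>, the identity
  \<open>m u = m u0 - inv (L u0) (L u (m u) - L u0 (m u))\<close> contains \<open>m u\<close> on the
  right only next to operators that vanish at \<open>u0\<close>. Continuity of \<open>m\<close>
  therefore already yields its derivative.\<close>

lemma has_derivative_inv_derivative:
  fixes L :: "'c::euclidean_space \<Rightarrow> 'a::euclidean_space \<Rightarrow> 'a"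
  assumes "open S" and lin: "\<And>u. u \<in> S \<Longrightarrow> linear (L u)" and bij: "\<And>u. u \<in> S \<Longrightarrow> bij (L u)"
    and der: "\<And>u v. u \<in> S \<Longrightarrow> ((\<lambda>u. L u v) has_derivative L' u v) (at u)"
    and u0: "u0 \<in> S"
  shows "((\<lambda>u. inv (L u) v) has_derivative
    (\<lambda>w. - (\<Sum>b\<in>Basis. (inv (L u0) v \<bullet> b) *\<^sub>R inv (L u0) (L' u0 b w)))) (at u0)"
proof -
  define m where "m u = inv (L u) v" for u
  have Lm: "L u (m u) = v" if "u \<in> S" for u
    using bij[OF that] by (simp add: m_def bij_is_surj surj_f_inv_f)
  have li: "linear (inv (L u0))"
    using lin[OF u0] bij[OF u0] by (auto simp: bij_def intro: inj_linear_imp_inv_linear)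
  have cont: "continuous_on S m"
    unfolding m_def
  proof (rule continuous_on_inv_derivative[OF assms(1) lin bij])
    show "continuous_on S (\<lambda>u. L u v)" for v
      using der has_derivative_continuous by (blast intro: continuous_at_imp_continuous_on)
  qed
  define h where "h b u = inv (L u0) (L u b - L u0 b)" for b u
  have h: "(h b has_derivative (\<lambda>w. inv (L u0) (L' u0 b w))) (at u0)" for b
  proof -
    have "((\<lambda>u. L u b - L u0 b) has_derivative L' u0 b) (at u0)"
      using has_derivative_diff[OF der[OF u0, of b] has_derivative_const[of "L u0 b"]] by simp
    then show ?thesis
      unfolding h_def[abs_def]
      by (rule bounded_linear.has_derivative[OF linear_linear[THEN iffD2, OF li]])
  qed
  have expand: "m u0 - (\<Sum>b\<in>Basis. (m u \<bullet> b) *\<^sub>R h b u) = m u" if u: "u \<in> S" for u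
  proof -
    have "linear (\<lambda>w. inv (L u0) (L u w - L u0 w))"
      using linear_compose[OF linear_compose_sub[OF lin[OF u] lin[OF u0]] li] by (simp add: comp_def)
    from linear_sum_Basis[OF this, of "m u"]
    have "(\<Sum>b\<in>Basis. (m u \<bullet> b) *\<^sub>R h b u) = inv (L u0) (L u (m u) - L u0 (m u))"
      by (simp add: h_def)
    also have "\<dots> = m u0 - m u"
      using Lm[OF u] linear_diff[OF li] bij[OF u0] by (simp add: m_def bij_is_inj)
    finally show ?thesis by simp
  qed
  have "((\<lambda>u. m u0 - (\<Sum>b\<in>Basis. (m u \<bullet> b) *\<^sub>R h b u)) has_derivative
      (\<lambda>w. 0 - (\<Sum>b\<in>Basis. (m u0 \<bullet> b) *\<^sub>R inv (L u0) (L' u0 b w)))) (at u0)"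
  proof (intro has_derivative_diff has_derivative_const has_derivative_sum
      has_derivative_scaleR_vanishing h)
    show "isCont (\<lambda>u. m u \<bullet> b) u0" for b
      using cont u0 assms(1) by (auto simp: continuous_on_eq_continuous_at intro!: continuous_intros)
    show "h b u0 = 0" for b using li by (simp add: h_def linear_0)
  qed
  then have "(m has_derivative
      (\<lambda>w. 0 - (\<Sum>b\<in>Basis. (m u0 \<bullet> b) *\<^sub>R inv (L u0) (L' u0 b w)))) (at u0)"
    by (rule has_derivative_transform_within_open[OF _ assms(1) u0]) (rule expand)
  then show ?thesis by (simp add: m_def[abs_def])
qed

text \<open>The derivative of \<open>inv (L u) v\<close> is a sum of products of entries of
  \<open>inv (L u)\<close> and derivatives of \<open>L\<close>, so each step of the induction uses
  one more derivative of \<open>f\<close>.\<close>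

lemma C_k_on_inv_derivative:
  fixes f :: "'a::euclidean_space \<Rightarrow> 'a"
  assumes S: "open S" and f: "C_k_on (Suc k) S f"
    and bij: "\<And>u. u \<in> S \<Longrightarrow> bij (fderiv f u)"
  shows "C_k_on k S (\<lambda>u. inv (fderiv f u) v)"
  using f
proof (induction k arbitrary: v)
  case 0
  have "continuous_on S (\<lambda>u. inv (fderiv f u) v)"
    using C_k_on_SucD[OF 0] by (intro continuous_on_inv_derivative S bij) (auto intro: has_derivative_linear)
  then show ?case by simp
next
  case (Suc k)
  define L where "L u = fderiv f u" for u
  define L' where "L' u b = fderiv (\<lambda>u. L u b) u" for u b
  have IH: "C_k_on k S (\<lambda>u. inv (L u) v)" for v
    using Suc.IH[OF C_k_on_Suc_imp[OF Suc.prems]] by (simp add: L_def)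
  have lin: "linear (L u)" if "u \<in> S" for u
    using C_k_on_SucD(1)[OF Suc.prems that] has_derivative_linear by (auto simp: L_def)
  have bij': "bij (L u)" if "u \<in> S" for u using bij[OF that] by (simp add: L_def)
  have CL: "C_k_on (Suc k) S (\<lambda>u. L u b)" for b
    using C_k_on_SucD(2)[OF Suc.prems] by (simp add: L_def del: C_k_on.simps)
  have der: "((\<lambda>u. L u b) has_derivative L' u b) (at u)" if "u \<in> S" for u b
    using C_k_on_SucD(1)[OF CL that] by (simp add: L'_def)
  have "C_k_on (Suc k) S (\<lambda>u. inv (L u) v)"
  proof (rule C_k_on_SucI[OF S])
    \<comment> \<open>Expanding \<open>L' u b w\<close> in \<open>Basis\<close> too leaves only
      \<open>inv (L u) a\<close> for fixed \<open>a\<close>, to which the induction hypothesis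
      applies. The sign is written as \<open>(- 1) *\<^sub>R\<close> to be treated as a bounded
      linear map.\<close>
    show "((\<lambda>u. inv (L u) v) has_derivative
      (\<lambda>w. (- 1) *\<^sub>R (\<Sum>b\<in>Basis. \<Sum>a\<in>Basis. ((inv (L u) v \<bullet> b) * (L' u b w \<bullet> a)) *\<^sub>R inv (L u) a))) (at u)"
      if u: "u \<in> S" for u
    proof -
      have "linear (inv (L u))"
        using lin[OF u] bij'[OF u] by (auto simp: bij_def intro: inj_linear_imp_inv_linear)
      then have "(inv (L u) v \<bullet> b) *\<^sub>R inv (L u) (L' u b w)
        = (\<Sum>a\<in>Basis. ((inv (L u) v \<bullet> b) * (L' u b w \<bullet> a)) *\<^sub>R inv (L u) a)" for b w
        by (subst linear_sum_Basis[of _ "L' u b w"]) (auto simp: scaleR_sum_right)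
      then show ?thesis
        using has_derivative_inv_derivative[OF S lin bij' der u, of v] by simp
    qed
    fix w
    have "C_k_on k S (\<lambda>u. L' u b w)" for b
      using C_k_on_SucD(2)[OF CL] by (simp add: L'_def)
    then show "C_k_on k S (\<lambda>u. (- 1) *\<^sub>R (\<Sum>b\<in>Basis. \<Sum>a\<in>Basis.
        ((inv (L u) v \<bullet> b) * (L' u b w \<bullet> a)) *\<^sub>R inv (L u) a))"
      by (intro C_k_on_bounded_linear[OF bounded_linear_scaleR_right S] C_k_on_sum S IH
          C_k_on_bilinear[OF bounded_bilinear_scaleR S] C_k_on_bilinear[OF bounded_bilinear_mult S]
          C_k_on_bounded_linear[OF bounded_linear_inner_left S])
  qed
  then show ?case by (simp add: L_def del: C_k_on.simps)
qed

text \<open>Bootstrapping: the derivative of \<open>g\<close> is the inverse derivative of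
  \<open>f\<close> composed with \<open>g\<close> itself, so \<open>g\<close> of class C^k has
  derivatives of class C^k and is of class C^(k+1).\<close>

lemma C_k_on_inverse:
  fixes f g :: "'a::euclidean_space \<Rightarrow> 'a"
  assumes S: "open S" and T: "open T" and gT: "g ` T \<subseteq> S" and f: "C_k_on k S f"
    and bij: "\<And>u. u \<in> S \<Longrightarrow> bij (fderiv f u)"
    and g: "\<And>y. y \<in> T \<Longrightarrow> (g has_derivative inv (fderiv f (g y))) (at y)"
  shows "C_k_on k T g"
  using f
proof (induction k)
  case 0
  show ?case
    unfolding C_k_on.simps using has_derivative_continuous[OF g]
    by (blast intro: continuous_at_imp_continuous_on)
next
  case (Suc k)
  show ?case
  proof (rule C_k_on_SucI[OF T g])
    fix v
    have "C_k_on k T ((\<lambda>u. inv (fderiv f u) v) \<circ> g)"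
      by (rule C_k_on_compose[OF T S gT Suc.IH[OF C_k_on_Suc_imp[OF Suc.prems]]
            C_k_on_inv_derivative[OF S Suc.prems bij]])
    then show "C_k_on k T (\<lambda>y. inv (fderiv f (g y)) v)" by (simp add: comp_def)
  qed
qed

theorem smooth_local_inverse:
  fixes f :: "'a::euclidean_space \<Rightarrow> 'a"
  assumes S: "open S" and u0: "u0 \<in> S" and f: "smooth_on S f"
    and inj: "inj (fderiv f u0)"
  obtains U V g where "open U" "U \<subseteq> S" "u0 \<in> U" "open V" "f u0 \<in> V" "homeomorphism U V f g"
    "smooth_on V g"
    "\<And>y. y \<in> V \<Longrightarrow> (g has_derivative inv (fderiv f (g y))) (at y)"
    "\<And>y. y \<in> V \<Longrightarrow> bij (fderiv f (g y))"
proof -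
  define L where "L u = fderiv f u" for u
  have C: "C_k_on k S f" for k using f by (simp add: smooth_on_def)
  have der: "(f has_derivative L u) (at u)" if "u \<in> S" for u
    using C_k_on_SucD(1)[OF C that] by (simp add: L_def)
  have bl: "bounded_linear (L u)" if "u \<in> S" for u
    using der[OF that] has_derivative_bounded_linear by blast
  define f' where "f' u = Blinfun (L u)" for u
  have f': "blinfun_apply (f' u) = L u" if "u \<in> S" for u
    using bl[OF that] by (simp add: f'_def bounded_linear_Blinfun_apply)
  \<comment> \<open>In finite dimension, continuity of each \<open>L u i\<close> gives continuity in
    operator norm, the form in which the inverse function theorem takes the derivative.\<close>
  have contf: "continuous_on S f'"
  proof (rule continuous_on_blinfun_componentwise)
    fix i :: 'a
    have "continuous_on S (\<lambda>u. L u i)"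
      using C_k_on_SucD(2)[OF C[of 1, unfolded One_nat_def], of i] by (simp add: L_def)
    then show "continuous_on S (\<lambda>u. blinfun_apply (f' u) i)"
      by (simp add: f' cong: continuous_on_cong)
  qed
  have inj0: "inj (L u0)" using inj by (simp add: L_def)
  obtain L1 where L1: "linear L1" "L1 \<circ> L u0 = id"
    using linear_injective_left_inverse[OF bounded_linear.linear[OF bl[OF u0]] inj0] by blast
  have invf: "Blinfun L1 o\<^sub>L f' u0 = id_blinfun"
    using L1 f'[OF u0]
    by (intro blinfun_eqI) (simp add: bounded_linear_Blinfun_apply linear_linear pointfree_idE)
  obtain U V g g' where *: "open U" "U \<subseteq> S" "u0 \<in> U" "open V" "f u0 \<in> V" "homeomorphism U V f g"
    "\<And>y. y \<in> V \<Longrightarrow> (g has_derivative (g' y)) (at y)"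
    "\<And>y. y \<in> V \<Longrightarrow> g' y = inv (blinfun_apply (f' (g y)))"
    "\<And>y. y \<in> V \<Longrightarrow> bij (blinfun_apply (f' (g y)))"
  proof (rule inverse_function_theorem[OF S _ contf u0 invf])
    show "(f has_derivative blinfun_apply (f' x)) (at x)" if "x \<in> S" for x
      using der[OF that] f'[OF that] by simp
  qed blast
  have gV: "g ` V = U" using *(6) by (simp add: homeomorphism_def)
  have f'g: "blinfun_apply (f' (g y)) = L (g y)" if "y \<in> V" for y
    using f' gV *(2) that by blast
  have bij: "bij (L u)" if "u \<in> U" for u using *(9) f'g gV that by auto
  have gder: "(g has_derivative inv (L (g y))) (at y)" if "y \<in> V" for y
    using *(7,8) f'g that by auto
  have "C_k_on k V g" for k
    by (rule C_k_on_inverse[OF *(1) *(4) _ C_k_on_subset[OF C *(2)]])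
      (use gV bij gder in \<open>auto simp: L_def\<close>)
  then show ?thesis
    using that[OF *(1-6)] gder bij gV by (auto simp: smooth_on_def L_def)
qed

section \<open>Second order differences\<close>

lemma DERIV_along_line:
  fixes f :: "'a::real_normed_vector \<Rightarrow> real"
  assumes "(f has_derivative f') (at (u + t *\<^sub>R v))"
  shows "((\<lambda>s. f (u + s *\<^sub>R v)) has_real_derivative f' v) (at t)"
proof -
  have "((\<lambda>s. u + s *\<^sub>R v) has_derivative (\<lambda>s. s *\<^sub>R v)) (at t)"
    by (auto intro!: derivative_eq_intros)
  from has_derivative_compose[OF this assms]
  have "((\<lambda>s. f (u + s *\<^sub>R v)) has_derivative (\<lambda>s. f' (s *\<^sub>R v))) (at t)" by simp
  moreover have "f' (s *\<^sub>R v) = f' v * s" for s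
    using has_derivative_linear[OF assms] by (simp add: linear_scale mult.commute)
  ultimately show ?thesis by (simp add: has_field_derivative_def mult_commute_abs)
qed

text \<open>One application of l'Hopital's rule leads to
  \<open>(f1 (u + t *\<^sub>R v) - f1 (u - t *\<^sub>R v)) / (2 * t)\<close>, where
  \<open>f1\<close> is the derivative in direction \<open>v\<close>. This converges because
  \<open>f1\<close> is differentiable at \<open>u\<close>.\<close>

lemma symmetric_second_difference:
  fixes f :: "'a::euclidean_space \<Rightarrow> real"
  assumes S: "open S" "u \<in> S" and f: "C_k_on 2 S f"
  shows "((\<lambda>t. (f (u + t *\<^sub>R v) + f (u - t *\<^sub>R v) - 2 * f u) / t\<^sup>2) \<longlongrightarrow>
    fderiv (\<lambda>u. fderiv f u v) u v) (at_right 0)"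
proof -
  define f1 where "f1 u = fderiv f u v" for u
  define f2 where "f2 = fderiv f1 u v"
  have C: "C_k_on (Suc (Suc 0)) S f" using f by (simp add: numeral_2_eq_2)
  have der: "(f has_derivative fderiv f w) (at w)" if "w \<in> S" for w
    using C_k_on_SucD(1)[OF C that] .
  have der1: "(f1 has_derivative fderiv f1 u) (at u)"
    using C_k_on_SucD(1)[OF C_k_on_SucD(2)[OF C] S(2), of v] by (simp add: f1_def[abs_def])
  obtain e where e: "e > 0" "ball u e \<subseteq> S" using S openE by blast
  \<comment> \<open>The summand 1 covers \<open>v = 0\<close>.\<close>
  define d where "d = e / (norm v + 1)"
  have d: "d > 0" using e by (simp add: d_def add_nonneg_pos)
  have inS: "u + t *\<^sub>R v \<in> S" if "\<bar>t\<bar> < d" for t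
  proof -
    have "\<bar>t\<bar> * norm v \<le> \<bar>t\<bar> * (norm v + 1)" by (intro mult_left_mono) auto
    also have "\<dots> < d * (norm v + 1)"
      using that by (intro mult_strict_right_mono) (auto simp: add_nonneg_pos)
    also have "\<dots> = e"
      using norm_ge_zero[of v] by (simp add: d_def add_nonneg_eq_0_iff)
    finally show ?thesis using e by (auto simp: dist_norm subset_iff)
  qed
  define g where "g t = f (u + t *\<^sub>R v) + f (u + t *\<^sub>R (- v)) - 2 * f u" for t
  have g: "(g has_real_derivative f1 (u + t *\<^sub>R v) - f1 (u + (- t) *\<^sub>R v)) (at t)" if "\<bar>t\<bar> < d" for t
  proof -
    have lin: "fderiv f w (- v) = - f1 w" if "w \<in> S" for w
      using has_derivative_linear[OF der[OF that]] by (simp add: f1_def linear_neg)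
    have m: "u + t *\<^sub>R (- v) \<in> S" using inS[of "- t"] that by simp
    have "(g has_real_derivative fderiv f (u + t *\<^sub>R v) v
        + fderiv f (u + t *\<^sub>R (- v)) (- v) - 0) (at t)"
      unfolding g_def[abs_def]
      by (intro DERIV_diff DERIV_add DERIV_const DERIV_along_line der inS that m)
    then show ?thesis using lin[OF m] by (simp add: f1_def)
  qed
  have q: "((\<lambda>t. (f1 (u + t *\<^sub>R w) - f1 u) / t) \<longlongrightarrow> fderiv f1 u w) (at_right 0)" for w
  proof -
    have "((\<lambda>s. f1 (u + s *\<^sub>R w)) has_real_derivative fderiv f1 u w) (at 0)"
      by (rule DERIV_along_line) (use der1 in simp)
    then show ?thesis
      by (simp add: has_field_derivative_iff filterlim_at_split)
  qed
  have "fderiv f1 u (- v) = - f2"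
    using has_derivative_linear[OF der1] by (simp add: f2_def linear_neg)
  then have "((\<lambda>t. ((f1 (u + t *\<^sub>R v) - f1 u) / t - (f1 (u + t *\<^sub>R (- v)) - f1 u) / t) / 2)
      \<longlongrightarrow> (f2 - (- f2)) / 2) (at_right 0)"
    using q[of v] q[of "- v"] by (intro tendsto_intros) (auto simp: f2_def)
  then have lim: "((\<lambda>t. (f1 (u + t *\<^sub>R v) - f1 (u + (- t) *\<^sub>R v)) / (2 * t)) \<longlongrightarrow> f2) (at_right 0)"
    by (simp add: diff_divide_distrib[symmetric] mult.commute)
  have "((\<lambda>t. g t / t\<^sup>2) \<longlongrightarrow> f2) (at_right 0)"
  proof (rule lhopital_right_0[where f' = "\<lambda>t. f1 (u + t *\<^sub>R v) - f1 (u + (- t) *\<^sub>R v)" and g' = "\<lambda>t. 2 * t"])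
    have "isCont g 0" using g[of 0] d DERIV_isCont by force
    then show "(g \<longlongrightarrow> 0) (at_right 0)"
      by (auto simp: isCont_def g_def filterlim_at_split)
    show "((\<lambda>t. t\<^sup>2) \<longlongrightarrow> (0::real)) (at_right 0)"
      by (auto intro!: tendsto_eq_intros)
    show "\<forall>\<^sub>F t in at_right 0. (t::real)\<^sup>2 \<noteq> 0" "\<forall>\<^sub>F t in at_right 0. 2 * t \<noteq> (0::real)"
      using eventually_at_right_less[of "0::real"] by (auto elim: eventually_mono)
    have "\<forall>\<^sub>F t in at_right 0. t \<in> {0<..<d}"
      using d by (intro eventually_at_right_real) auto
    then show "\<forall>\<^sub>F t in at_right 0. (g has_real_derivative f1 (u + t *\<^sub>R v) - f1 (u + (- t) *\<^sub>R v)) (at t)"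
      by eventually_elim (rule g, auto)
    show "\<forall>\<^sub>F t in at_right 0. ((\<lambda>t. t\<^sup>2) has_real_derivative 2 * t) (at (t::real))"
      by (intro always_eventually) (auto intro!: derivative_eq_intros)
  qed (rule lim)
  then show ?thesis by (simp add: g_def f2_def f1_def[abs_def])
qed

lemma C_2_symmetric:
  fixes f :: "'a::euclidean_space \<Rightarrow> real"
  assumes S: "open S" "u \<in> S" and f: "C_k_on 2 S f"
  shows "fderiv (\<lambda>u. fderiv f u v) u w
    = fderiv (\<lambda>u. fderiv f u w) u v"
proof -
  define f1 where "f1 v u = fderiv f u v" for u v
  define f2 where "f2 v w u = fderiv (f1 v) u w" for u v w
  have C: "C_k_on (Suc (Suc 0)) S f" using f by (simp add: numeral_2_eq_2)
  have der: "(f has_derivative fderiv f p) (at p)" if "p \<in> S" for p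
    using C_k_on_SucD(1)[OF C that] .
  have C1: "C_k_on (Suc 0) S (f1 v)" for v
    using C_k_on_SucD(2)[OF C, of v] by (simp add: f1_def[abs_def])
  have der1: "(f1 v has_derivative fderiv (f1 v) p) (at p)" if "p \<in> S" for p v
    using C_k_on_SucD(1)[OF C1 that] .
  have cont2: "continuous_on S (f2 v w)" for v w
    using C_k_on_SucD(2)[OF C1, of v w] by (simp add: f2_def[abs_def])
  obtain e where e: "e > 0" "ball u e \<subseteq> S" using S openE by blast
  define d where "d = e / (norm v + norm w + 1)"
  have d: "d > 0" using e by (simp add: d_def add_nonneg_pos)
  have small: "norm (s *\<^sub>R v + t *\<^sub>R w) < e" if "\<bar>s\<bar> < d" "\<bar>t\<bar> < d" for s t
  proof -
    have "norm (s *\<^sub>R v + t *\<^sub>R w) \<le> \<bar>s\<bar> * norm v + \<bar>t\<bar> * norm w"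
      by (metis norm_scaleR norm_triangle_ineq)
    also have "\<dots> \<le> d * norm v + d * norm w"
      using that by (intro add_mono mult_right_mono) auto
    also have "\<dots> < d * (norm v + norm w + 1)" using d by (simp add: algebra_simps)
    also have "\<dots> = e"
      using norm_ge_zero[of v] norm_ge_zero[of w] by (simp add: d_def add_nonneg_eq_0_iff)
    finally show ?thesis .
  qed
  have inS: "u + s *\<^sub>R v + t *\<^sub>R w \<in> S" if "\<bar>s\<bar> < d" "\<bar>t\<bar> < d" for s t
    using small[OF that] e by (auto simp: subset_iff dist_norm add.assoc norm_minus_commute)
  \<comment> \<open>The mixed second difference is \<open>h\<^sup>2\<close> times a value of the mixed derivative, in either order.\<close>
  have key: "\<exists>s t. 0 < s \<and> s < h \<and> 0 < t \<and> t < h \<and>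
      f (u + h *\<^sub>R v + h *\<^sub>R w) - f (u + h *\<^sub>R v) - f (u + h *\<^sub>R w) + f u
        = h * h * f2 v w (u + s *\<^sub>R v + t *\<^sub>R w)"
    if h: "0 < h" "h < d"
      and inS: "\<And>s t. \<bar>s\<bar> < d \<Longrightarrow> \<bar>t\<bar> < d \<Longrightarrow> u + s *\<^sub>R v + t *\<^sub>R w \<in> S" for h v w
  proof -
    define k where "k s = f (u + h *\<^sub>R w + s *\<^sub>R v) - f (u + s *\<^sub>R v)" for s
    have k: "(k has_real_derivative f1 v (u + h *\<^sub>R w + s *\<^sub>R v) - f1 v (u + s *\<^sub>R v)) (at s)"
      if "\<bar>s\<bar> < d" for s
      unfolding k_def[abs_def] f1_def
      by (intro DERIV_diff DERIV_along_line der)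
        (use inS[of s h] inS[of s 0] h that in \<open>auto simp: algebra_simps\<close>)
    obtain s where s: "0 < s" "s < h"
      "k h - k 0 = (h - 0) * (f1 v (u + h *\<^sub>R w + s *\<^sub>R v) - f1 v (u + s *\<^sub>R v))"
      using MVT2[of 0 h k "\<lambda>s. f1 v (u + h *\<^sub>R w + s *\<^sub>R v) - f1 v (u + s *\<^sub>R v)"] k h by auto
    define l where "l t = f1 v (u + s *\<^sub>R v + t *\<^sub>R w)" for t
    have l: "(l has_real_derivative f2 v w (u + s *\<^sub>R v + t *\<^sub>R w)) (at t)" if "\<bar>t\<bar> < d" for t
      unfolding l_def[abs_def] f2_def
      by (intro DERIV_along_line der1) (use inS[of s t] h s that in auto)
    obtain t where t: "0 < t" "t < h" "l h - l 0 = (h - 0) * f2 v w (u + s *\<^sub>R v + t *\<^sub>R w)"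
      using MVT2[of 0 h l "\<lambda>t. f2 v w (u + s *\<^sub>R v + t *\<^sub>R w)"] l h by auto
    have "k h - k 0 = h * (l h - l 0)" using s(3) by (simp add: l_def algebra_simps)
    then show ?thesis
      using s t by (intro exI[of _ s] exI[of _ t]) (simp add: k_def algebra_simps)
  qed
  \<comment> \<open>The domain condition is a premise, so that the limit can be used a second time
    with \<open>v\<close> and \<open>w\<close> exchanged; \<open>d\<close> is symmetric in the two
    vectors.\<close>
  have lim: "((\<lambda>h. (f (u + h *\<^sub>R v + h *\<^sub>R w) - f (u + h *\<^sub>R v) - f (u + h *\<^sub>R w) + f u) / (h * h))
      \<longlongrightarrow> f2 v w u) (at_right 0)"
    if inS: "\<And>s t. \<bar>s\<bar> < d \<Longrightarrow> \<bar>t\<bar> < d \<Longrightarrow> u + s *\<^sub>R v + t *\<^sub>R w \<in> S" for v w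
  proof (rule tendstoI)
    fix r :: real assume r: "r > 0"
    have "isCont (f2 v w) u" using cont2 S by (simp add: continuous_on_eq_continuous_at)
    then obtain q where q: "q > 0" "\<And>p. dist p u < q \<Longrightarrow> dist (f2 v w p) (f2 v w u) < r"
      using r unfolding continuous_at_eps_delta by (auto simp: dist_commute)
    define d' where "d' = min d (q / (norm v + norm w + 1))"
    have d': "d' > 0" using d q by (simp add: d'_def add_nonneg_pos)
    have "\<forall>\<^sub>F h in at_right 0. h \<in> {0<..<d'}"
      using d' by (intro eventually_at_right_real) auto
    then show "\<forall>\<^sub>F h in at_right 0. dist ((f (u + h *\<^sub>R v + h *\<^sub>R w) - f (u + h *\<^sub>R v)
        - f (u + h *\<^sub>R w) + f u) / (h * h)) (f2 v w u) < r"
    proof eventually_elim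
      case (elim h)
      then have h: "0 < h" "h < d" by (auto simp: d'_def)
      obtain s t where st: "0 < s" "s < h" "0 < t" "t < h"
        "f (u + h *\<^sub>R v + h *\<^sub>R w) - f (u + h *\<^sub>R v) - f (u + h *\<^sub>R w) + f u
        = h * h * f2 v w (u + s *\<^sub>R v + t *\<^sub>R w)"
        using key[OF h inS] by blast
      have "norm (s *\<^sub>R v + t *\<^sub>R w) \<le> s * norm v + t * norm w"
        using st by (metis abs_of_pos norm_scaleR norm_triangle_ineq)
      also have "\<dots> \<le> h * norm v + h * norm w"
        using st by (intro add_mono mult_right_mono) auto
      also have "\<dots> < h * (norm v + norm w + 1)" using h by (simp add: algebra_simps)
      also have "\<dots> \<le> q / (norm v + norm w + 1) * (norm v + norm w + 1)"
        using elim by (intro mult_right_mono) (auto simp: d'_def)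
      also have "\<dots> = q"
        using norm_ge_zero[of v] norm_ge_zero[of w] by (simp add: add_nonneg_eq_0_iff)
      finally have "dist (u + s *\<^sub>R v + t *\<^sub>R w) u < q" by (simp add: dist_norm add.assoc)
      then show ?case using q st h by simp
    qed
  qed
  have inS': "u + s *\<^sub>R w + t *\<^sub>R v \<in> S" if "\<bar>s\<bar> < d" "\<bar>t\<bar> < d" for s t
    using inS[OF that(2,1)] by (simp add: algebra_simps)
  have "((\<lambda>h. (f (u + h *\<^sub>R v + h *\<^sub>R w) - f (u + h *\<^sub>R v) - f (u + h *\<^sub>R w) + f u) / (h * h))
      \<longlongrightarrow> f2 w v u) (at_right 0)"
    using lim[OF inS'] by (simp add: algebra_simps)
  with lim[OF inS] have "f2 v w u = f2 w v u"
    using tendsto_unique trivial_limit_at_right_real by blast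
  then show ?thesis by (simp add: f1_def[abs_def] f2_def)
qed

section \<open>Garding's inequality for elementary symmetric functions\<close>

text \<open>The index set is arbitrary, so equal values count with multiplicity. It is instantiated
  with bases of eigenvectors and with the pairs in \<open>eigenvalues\<close>, valued by
  \<open>fst\<close>.\<close>

definition esym :: "nat \<Rightarrow> 'i set \<Rightarrow> ('i \<Rightarrow> real) \<Rightarrow> real" where
  "esym k A x = (\<Sum>I | I \<subseteq> A \<and> card I = k. \<Prod>i\<in>I. x i)"

lemma esym_0 [simp]: "finite A \<Longrightarrow> esym 0 A x = 1"
proof -
  assume "finite A"
  then have "{I. I \<subseteq> A \<and> card I = 0} = {{}}" by (auto dest: finite_subset)
  then show ?thesis by (simp add: esym_def)
qed

lemma esym_cong: "(\<And>i. i \<in> A \<Longrightarrow> x i = y i) \<Longrightarrow> esym k A x = esym k A y"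
  unfolding esym_def by (intro sum.cong prod.cong) auto

lemma esym_bij_betw:
  assumes b: "bij_betw b A B" and "\<And>i. i \<in> A \<Longrightarrow> y (b i) = x i"
  shows "esym k A x = esym k B y"
  unfolding esym_def
proof (rule sum.reindex_bij_witness[where i = "\<lambda>J. inv_into A b ` J" and j = "\<lambda>I. b ` I"])
  have inj: "inj_on b A" and im: "b ` A = B" using b by (auto simp: bij_betw_def)
  fix I assume I: "I \<in> {I. I \<subseteq> A \<and> card I = k}"
  then have inj': "inj_on b I" using inj inj_on_subset by blast
  show "inv_into A b ` b ` I = I" using I inj by (simp add: inv_into_image_cancel)
  show "b ` I \<in> {I. I \<subseteq> B \<and> card I = k}" using I inj' im card_image by fastforce
  show "(\<Prod>j\<in>b ` I. y j) = (\<Prod>i\<in>I. x i)"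
    using I inj' assms(2) by (auto simp: prod.reindex intro!: prod.cong)
next
  have inj: "inj_on b A" and im: "b ` A = B" using b by (auto simp: bij_betw_def)
  fix J assume J: "J \<in> {I. I \<subseteq> B \<and> card I = k}"
  show "b ` inv_into A b ` J = J" using J im by (simp add: image_inv_into_cancel)
  have "inj_on (inv_into A b) J" using J im by (auto intro: inj_on_inv_into)
  then show "inv_into A b ` J \<in> {I. I \<subseteq> A \<and> card I = k}"
    using J im by (auto simp: card_image inv_into_into)
qed

lemma esym_scale: "esym k A (\<lambda>i. c * x i) = c ^ k * esym k A x"
  unfolding esym_def sum_distrib_left by (intro sum.cong) (auto simp: prod.distrib)

lemma esym_insert:
  assumes "finite A" "a \<notin> A"
  shows "esym (Suc k) (insert a A) x = esym (Suc k) A x + x a * esym k A x"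
proof -
  let ?S = "\<lambda>k. {I. I \<subseteq> A \<and> card I = k}"
  have fin: "finite (?S k)" for k using assms(1) by (auto intro: finite_subset[of _ "Pow A"])
  have eq: "{I. I \<subseteq> insert a A \<and> card I = Suc k} = ?S (Suc k) \<union> insert a ` ?S k"
  proof (intro equalityI subsetI)
    fix I assume I: "I \<in> {I. I \<subseteq> insert a A \<and> card I = Suc k}"
    show "I \<in> ?S (Suc k) \<union> insert a ` ?S k"
    proof (cases "a \<in> I")
      case True
      then have "I = insert a (I - {a})" "I - {a} \<in> ?S k"
        using I assms(1) by (auto simp: finite_subset)
      then show ?thesis by blast
    qed (use I in auto)
  next
    have "card (insert a J) = Suc k" if "J \<in> ?S k" for J
      using that assms finite_subset[of J A] by (subst card_insert_disjoint) auto
    then show "I \<in> {I. I \<subseteq> insert a A \<and> card I = Suc k}"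
      if "I \<in> ?S (Suc k) \<union> insert a ` ?S k" for I
      using that by auto
  qed
  have inj: "inj_on (insert a) (?S k)" using assms(2) by (auto simp: inj_on_def insert_eq_iff)
  have disj: "?S (Suc k) \<inter> insert a ` ?S k = {}" using assms(2) by auto
  have "(\<Sum>I\<in>insert a ` ?S k. \<Prod>i\<in>I. x i) = (\<Sum>I\<in>?S k. \<Prod>i\<in>insert a I. x i)"
    using sum.reindex[OF inj] by simp
  also have "\<dots> = (\<Sum>I\<in>?S k. x a * (\<Prod>i\<in>I. x i))"
    using assms by (intro sum.cong prod.insert) (auto dest: finite_subset)
  also have "\<dots> = x a * (\<Sum>I\<in>?S k. \<Prod>i\<in>I. x i)"
    by (rule sum_distrib_left[symmetric])
  finally show ?thesis
    unfolding esym_def eq by (subst sum.union_disjoint[OF fin finite_imageI[OF fin] disj]) simp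
qed

lemma esym_remove:
  assumes "finite A" "a \<in> A"
  shows "esym (Suc k) A x = esym (Suc k) (A - {a}) x + x a * esym k (A - {a}) x"
  using esym_insert[of "A - {a}" a k x] assms by (simp add: insert_absorb)

lemma esym_1: "finite A \<Longrightarrow> esym (Suc 0) A x = (\<Sum>i\<in>A. x i)"
proof (induction rule: finite_induct)
  case empty
  show ?case by (simp add: esym_def)
next
  case (insert a A)
  then show ?case by (simp add: esym_insert)
qed

lemma esym_pos:
  assumes "finite A" "k \<le> card A" "\<And>i. i \<in> A \<Longrightarrow> x i > 0"
  shows "esym k A x > 0"
  unfolding esym_def
proof (rule sum_pos)
  show "finite {I. I \<subseteq> A \<and> card I = k}"
    using assms(1) by (auto intro: finite_subset[of _ "Pow A"])
  show "{I. I \<subseteq> A \<and> card I = k} \<noteq> {}"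
    using obtain_subset_with_card_n[OF assms(2)] by auto
qed (use assms in \<open>auto intro!: prod_pos\<close>)

text \<open>The derivative at \<open>x\<close> in direction \<open>y\<close>: the polynomial is
  affine in each variable, and deleting the index \<open>i\<close> gives the partial derivative. For
  \<open>k = 0\<close> the truncated \<open>k - 1\<close> would give the sum of \<open>y\<close>
  instead of 0, hence the hypotheses \<open>k \<ge> 1\<close> below.\<close>

definition esym_deriv :: "nat \<Rightarrow> 'i set \<Rightarrow> ('i \<Rightarrow> real) \<Rightarrow> ('i \<Rightarrow> real) \<Rightarrow> real" where
  "esym_deriv k A x y = (\<Sum>i\<in>A. esym (k - 1) (A - {i}) x * y i)"

text \<open>This is \<open>esym_insert\<close> differentiated. The degree starts at 2, since in
  degree 1 the factor of \<open>x a\<close> is the constant \<open>esym 0\<close>, whose derivative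
  is not \<open>esym_deriv 0\<close>.\<close>

lemma esym_deriv_insert:
  assumes "finite A" "a \<notin> A"
  shows "esym_deriv (Suc (Suc k)) (insert a A) x y
    = esym_deriv (Suc (Suc k)) A x y + y a * esym (Suc k) A x + x a * esym_deriv (Suc k) A x y"
proof -
  have "esym (Suc k) (insert a A - {i}) x = esym (Suc k) (A - {i}) x + x a * esym k (A - {i}) x"
    if "i \<in> A" for i
  proof -
    have "insert a A - {i} = insert a (A - {i})" using that assms(2) by auto
    then show ?thesis using esym_insert[of "A - {i}" a k x] assms by simp
  qed
  then have "(\<Sum>i\<in>A. esym (Suc k) (insert a A - {i}) x * y i)
      = (\<Sum>i\<in>A. esym (Suc k) (A - {i}) x * y i + x a * (esym k (A - {i}) x * y i))"
    by (intro sum.cong) (auto simp: algebra_simps)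
  then show ?thesis
    using assms by (simp add: esym_deriv_def sum.distrib sum_distrib_left)
qed

lemma esym_has_derivative:
  assumes "finite A" "k \<ge> 1"
  shows "((\<lambda>t. esym k A (\<lambda>i. x i + t * y i)) has_real_derivative esym_deriv k A x y) (at 0)"
  using assms
proof (induction arbitrary: k rule: finite_induct)
  case empty
  then have "esym k {} z = 0" for z :: "'a \<Rightarrow> real"
    by (auto simp: esym_def intro!: sum.neutral)
  then show ?case by (simp add: esym_deriv_def)
next
  case (insert a A)
  show ?case
  proof (cases "k = 1")
    case True
    have "esym_deriv k (insert a A) x y = sum y (insert a A)"
      using True insert.hyps by (simp add: esym_deriv_def)
    moreover have "((\<lambda>t. \<Sum>i\<in>insert a A. x i + t * y i) has_real_derivative
        (\<Sum>i\<in>insert a A. y i)) (at 0)"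
      by (intro DERIV_sum) (auto intro!: derivative_eq_intros)
    ultimately show ?thesis using True insert.hyps by (simp add: esym_1 del: sum.insert)
  next
    case False
    then obtain j where k: "k = Suc (Suc j)" using insert.prems by (cases k; cases "k - 1") auto
    have "((\<lambda>t. esym (Suc (Suc j)) A (\<lambda>i. x i + t * y i)
        + (x a + t * y a) * esym (Suc j) A (\<lambda>i. x i + t * y i)) has_real_derivative
        esym_deriv (Suc (Suc j)) A x y
          + (y a * esym (Suc j) A (\<lambda>i. x i + 0 * y i)
             + esym_deriv (Suc j) A x y * (x a + 0 * y a))) (at 0)"
      by (intro DERIV_add DERIV_mult insert.IH) (auto intro!: derivative_eq_intros)
    then show ?thesis
      using insert.hyps by (simp add: k esym_insert esym_deriv_insert algebra_simps)
  qed
qed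

text \<open>Euler's identity for a homogeneous polynomial, by differentiating
  \<open>esym_scale\<close> along the ray \<open>x + t * x\<close> at \<open>t = 0\<close>.\<close>

lemma esym_euler:
  assumes "finite A"
  shows "(\<Sum>i\<in>A. x i * esym k (A - {i}) x) = real (Suc k) * esym (Suc k) A x"
proof -
  have "esym (Suc k) A (\<lambda>i. x i + t * x i) = (1 + t) ^ Suc k * esym (Suc k) A x" for t
    using esym_scale[of "Suc k" A "1 + t" x] by (simp add: algebra_simps)
  then have "((\<lambda>t. (1 + t) ^ Suc k * esym (Suc k) A x) has_real_derivative esym_deriv (Suc k) A x x) (at 0)"
    using esym_has_derivative[OF assms, of "Suc k" x x] by (simp del: power_Suc)
  moreover have "((\<lambda>t. (1 + t) ^ Suc k * esym (Suc k) A x) has_real_derivative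
      real (Suc k) * esym (Suc k) A x) (at 0)"
    by (auto intro!: derivative_eq_intros simp del: power_Suc)
  ultimately have "esym_deriv (Suc k) A x x = real (Suc k) * esym (Suc k) A x"
    by (rule DERIV_unique)
  then show ?thesis by (simp add: esym_deriv_def mult.commute)
qed

text \<open>The Marcus--Lopes inequality. The quotient \<open>F\<^sub>k = esym (Suc k) / esym k\<close> satisfies
  \<open>(k + 1) F\<^sub>k(A) = (\<Sum>i. h (x i) (F\<^sub>k\<^sub>-\<^sub>1(A - {i})))\<close> with \<open>h a b = a b / (a + b)\<close>, and \<open>h\<close> is
  increasing and superadditive on positive numbers.\<close>

lemma parallel_sum_superadditive:
  fixes a b c d e :: real
  assumes "a > 0" "b > 0" "c > 0" "d > 0" "b + d \<le> e"
  shows "a * b / (a + b) + c * d / (c + d) \<le> (a + c) * e / (a + c + e)"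
proof -
  have "a * b / (a + b) + c * d / (c + d) \<le> (a + c) * (b + d) / (a + c + (b + d))"
  proof -
    have "(a + c) * (b + d) / (a + c + (b + d)) - (a * b / (a + b) + c * d / (c + d))
      = (a * d - b * c)\<^sup>2 / ((a + b) * (c + d) * (a + c + (b + d)))"
      using assms by (simp add: divide_simps) (simp add: algebra_simps power2_eq_square)
    also have "\<dots> \<ge> 0" using assms by (intro divide_nonneg_pos zero_le_power2 mult_pos_pos) auto
    finally show ?thesis by simp
  qed
  also have "\<dots> \<le> (a + c) * e / (a + c + e)"
  proof -
    have le: "a * b + a * d + c * b + c * d \<le> a * e + c * e"
      using mult_left_mono[of "b + d" e "a + c"] assms by (simp add: algebra_simps)
    show ?thesis
      using assms by (simp add: divide_simps) (use le in \<open>simp add: algebra_simps\<close>)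
  qed
  finally show ?thesis .
qed

lemma esym_quotient_superadditive:
  assumes "finite A" "Suc k \<le> card A" "\<And>i. i \<in> A \<Longrightarrow> x i > 0" "\<And>i. i \<in> A \<Longrightarrow> y i > 0"
  shows "esym (Suc k) A x / esym k A x + esym (Suc k) A y / esym k A y
    \<le> esym (Suc k) A (\<lambda>i. x i + y i) / esym k A (\<lambda>i. x i + y i)"
  using assms
proof (induction k arbitrary: A)
  case 0
  then show ?case by (simp add: esym_1 sum.distrib)
next
  case (Suc k)
  define F where "F z i = esym (Suc k) (A - {i}) z / esym k (A - {i}) z" for z i
  have cardA: "card (A - {i}) \<ge> Suc k" if "i \<in> A" for i using that Suc.prems by simp
  \<comment> \<open>By \<open>esym_remove\<close>, \<open>z i + F z i\<close> is the quotient of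
    \<open>esym (Suc k) A z\<close> by \<open>esym k (A - {i}) z\<close>. Each summand therefore has
    the common denominator \<open>esym (Suc k) A z\<close>, and Euler's identity adds up the
    numerators.\<close>
  have repr: "real (Suc (Suc k)) * (esym (Suc (Suc k)) A z / esym (Suc k) A z)
      = (\<Sum>i\<in>A. z i * F z i / (z i + F z i))"
    if z: "\<And>i. i \<in> A \<Longrightarrow> z i > 0" for z
  proof -
    have "z i * F z i / (z i + F z i) = z i * esym (Suc k) (A - {i}) z / esym (Suc k) A z"
      if "i \<in> A" for i
    proof -
      have "esym k (A - {i}) z > 0" "esym (Suc k) (A - {i}) z > 0"
        using that cardA[OF that] Suc.prems(1) z by (auto intro!: esym_pos)
      then show ?thesis
        using z[OF that] esym_remove[OF Suc.prems(1) that, of k z]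
        by (simp add: F_def divide_simps add_pos_pos)
    qed
    then show ?thesis
      using esym_euler[OF Suc.prems(1), of z "Suc k"] by (simp add: sum_divide_distrib[symmetric])
  qed
  have "(\<Sum>i\<in>A. x i * F x i / (x i + F x i)) + (\<Sum>i\<in>A. y i * F y i / (y i + F y i))
    \<le> (\<Sum>i\<in>A. (x i + y i) * F (\<lambda>i. x i + y i) i / (x i + y i + F (\<lambda>i. x i + y i) i))"
    unfolding sum.distrib[symmetric]
  proof (rule sum_mono)
    fix i assume i: "i \<in> A"
    have "F x i + F y i \<le> F (\<lambda>i. x i + y i) i"
      unfolding F_def using Suc.prems i cardA[OF i] by (intro Suc.IH) auto
    moreover have "F x i > 0" "F y i > 0"
      unfolding F_def using Suc.prems i cardA[OF i] by (auto intro!: divide_pos_pos esym_pos)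
    ultimately show "x i * F x i / (x i + F x i) + y i * F y i / (y i + F y i)
      \<le> (x i + y i) * F (\<lambda>i. x i + y i) i / (x i + y i + F (\<lambda>i. x i + y i) i)"
      using Suc.prems i by (intro parallel_sum_superadditive) auto
  qed
  then have "real (Suc (Suc k)) * (esym (Suc (Suc k)) A x / esym (Suc k) A x)
      + real (Suc (Suc k)) * (esym (Suc (Suc k)) A y / esym (Suc k) A y)
    \<le> real (Suc (Suc k)) * (esym (Suc (Suc k)) A (\<lambda>i. x i + y i) / esym (Suc k) A (\<lambda>i. x i + y i))"
    using Suc.prems by (subst (1 2 3) repr) (auto intro: add_pos_pos)
  then show ?case
    unfolding distrib_left[symmetric] by (subst (asm) mult_le_cancel_left_pos) auto
qed

lemma esym_eq_prod_quotients:
  assumes "finite A" "k \<le> card A" "\<And>i. i \<in> A \<Longrightarrow> x i > 0"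
  shows "esym k A x = (\<Prod>j<k. esym (Suc j) A x / esym j A x)"
  using assms(2)
proof (induction k)
  case (Suc k)
  then have "esym k A x > 0" using assms by (intro esym_pos) auto
  moreover have IH: "(\<Prod>j<k. esym (Suc j) A x / esym j A x) = esym k A x"
    by (rule Suc.IH[symmetric]) (use Suc.prems in simp)
  ultimately show ?case unfolding prod.lessThan_Suc IH by simp
qed (use assms in simp)

text \<open>Differentiating \<open>esym k A (x + t y) \<ge> (\<Prod>j<k. F\<^sub>j(x) + t F\<^sub>j(y))\<close> at \<open>t = 0\<close>, where both sides agree,
  gives \<open>esym_deriv k A x y \<ge> esym k A x * (\<Sum>j<k. F\<^sub>j(y) / F\<^sub>j(x))\<close>. The quotients have product \<open>1\<close>, so
  their sum is at least \<open>k\<close>.\<close>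

theorem esym_garding:
  assumes A: "finite A" "k \<le> card A" "k \<ge> 1"
    and x: "\<And>i. i \<in> A \<Longrightarrow> x i > 0" and y: "\<And>i. i \<in> A \<Longrightarrow> y i > 0"
    and eq: "esym k A x = esym k A y"
  shows "esym_deriv k A x x \<le> esym_deriv k A x y"
proof -
  define F where "F z j = esym (Suc j) A z / esym j A z" for z j
  have Fpos: "F z j > 0" if "j < k" "\<And>i. i \<in> A \<Longrightarrow> z i > 0" for z j
    unfolding F_def using that A by (auto intro!: divide_pos_pos esym_pos)
  have Fx: "F x j > 0" and Fy: "F y j > 0" if "j < k" for j
    using Fpos[of j x] Fpos[of j y] that x y by auto
  have prodF: "esym k A z = (\<Prod>j<k. F z j)" if "\<And>i. i \<in> A \<Longrightarrow> z i > 0" for z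
    unfolding F_def using A(1,2) that by (rule esym_eq_prod_quotients)
  have px: "esym k A x = (\<Prod>j<k. F x j)" and py: "esym k A y = (\<Prod>j<k. F y j)"
    using prodF[of x] prodF[of y] x y by auto
  have ex: "esym k A x > 0" using A(1,2) x by (rule esym_pos)
  define s where "s = (\<Sum>j<k. F y j / F x j)"
  define g where "g t = esym k A (\<lambda>i. x i + t * y i) - (\<Prod>j<k. F x j + t * F y j)" for t
  have g0: "g 0 = 0" using px by (simp add: g_def)
  have gpos: "g t \<ge> 0" if "t > 0" for t
  proof -
    have ty: "t * y i > 0" if "i \<in> A" for i using y[OF that] \<open>t > 0\<close> by simp
    have Fty: "F (\<lambda>i. t * y i) j = t * F y j" if "j < k" for j
      using esym_pos[OF A(1), of j y] y A that \<open>t > 0\<close> by (simp add: F_def esym_scale)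
    have "(\<Prod>j<k. F x j + t * F y j) \<le> (\<Prod>j<k. F (\<lambda>i. x i + t * y i) j)"
    proof (rule prod_mono)
      fix j assume "j \<in> {..<k}"
      then have j: "j < k" by simp
      have "F x j + F (\<lambda>i. t * y i) j \<le> F (\<lambda>i. x i + t * y i) j"
        unfolding F_def using A j x ty by (intro esym_quotient_superadditive) auto
      then show "0 \<le> F x j + t * F y j \<and> F x j + t * F y j \<le> F (\<lambda>i. x i + t * y i) j"
        using Fty[OF j] Fx[OF j] Fy[OF j] \<open>t > 0\<close> by (simp add: add_nonneg_nonneg less_imp_le)
    qed
    also have "\<dots> = esym k A (\<lambda>i. x i + t * y i)"
      using x ty by (intro prodF[symmetric]) (simp add: add_pos_pos)
    finally show ?thesis by (simp add: g_def)
  qed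
  have "((\<lambda>t. \<Prod>j<k. F x j + t * F y j) has_real_derivative
      (\<Sum>j<k. F y j * (\<Prod>i\<in>{..<k} - {j}. F x i + 0 * F y i))) (at 0)"
    by (intro has_field_derivative_prod) (auto intro!: derivative_eq_intros)
  also have "(\<Sum>j<k. F y j * (\<Prod>i\<in>{..<k} - {j}. F x i + 0 * F y i)) = esym k A x * s"
    unfolding s_def sum_distrib_left px
  proof (rule sum.cong)
    fix j assume j: "j \<in> {..<k}"
    then have "F x j \<noteq> 0" using Fx[of j] by auto
    then show "F y j * (\<Prod>i\<in>{..<k} - {j}. F x i + 0 * F y i)
        = (\<Prod>j<k. F x j) * (F y j / F x j)"
      using prod.remove[OF _ j, of "F x"] by simp
  qed simp
  finally have "(g has_real_derivative esym_deriv k A x y - esym k A x * s) (at 0)"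
    unfolding g_def[abs_def] by (intro DERIV_diff esym_has_derivative A)
  then have "0 \<le> esym_deriv k A x y - esym k A x * s"
  proof (rule_tac ccontr)
    assume "\<not> 0 \<le> esym_deriv k A x y - esym k A x * s"
    then obtain d where "d > 0" "\<And>h. h > 0 \<Longrightarrow> h < d \<Longrightarrow> g (0 + h) < g 0"
      using DERIV_neg_dec_right[OF \<open>(g has_real_derivative _) (at 0)\<close>] by auto
    then have "g (d / 2) < 0" using g0 by force
    then show False using gpos[of "d / 2"] \<open>d > 0\<close> by simp
  qed
  moreover have "s \<ge> real k"
  proof -
    have pos: "F y j / F x j > 0" if "j < k" for j using Fx[OF that] Fy[OF that] by simp
    have "(\<Prod>j<k. F y j / F x j) = esym k A y / esym k A x"
      by (simp only: prod_dividef px py)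
    also have "\<dots> = 1" using eq ex by simp
    finally have "(\<Prod>j<k. F y j / F x j) = 1" .
    \<comment> \<open>The arithmetic-geometric mean inequality, through
      \<open>ln t \<le> t - 1\<close>.\<close>
    then have "0 = (\<Sum>j<k. ln (F y j / F x j))"
      using ln_prod[of "{..<k}" "\<lambda>j. F y j / F x j"] pos by force
    also have "\<dots> \<le> (\<Sum>j<k. F y j / F x j - 1)"
      using pos by (intro sum_mono ln_le_minus_one) simp
    finally show ?thesis by (simp add: s_def sum_subtractf)
  qed
  then have "esym k A x * real k \<le> esym k A x * s"
    using ex by (intro mult_left_mono) auto
  ultimately have "esym k A x * real k \<le> esym_deriv k A x y" by linarith
  moreover have "esym_deriv k A x x = real k * esym k A x"
    using esym_euler[OF A(1), of x "k - 1"] A(3) by (simp add: esym_deriv_def mult.commute)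
  ultimately show ?thesis by (simp add: mult.commute)
qed

section \<open>Symmetric operators\<close>

text \<open>A greedy rearrangement in place of Birkhoff's theorem: the smallest \<open>f\<close> is
  paired with the largest \<open>g\<close>. Shifting weight until the entry at
  \<open>(i0, j0)\<close> is 1 cannot increase the sum, since
  \<open>(f i - f i0) * (g j0 - g j) \<ge> 0\<close>, and the rest is again doubly
  stochastic.\<close>

lemma doubly_stochastic_permutation:
  fixes T :: "'i \<Rightarrow> 'j \<Rightarrow> real"
  assumes "finite A" "finite B" "card A = card B"
    and "\<And>i j. i \<in> A \<Longrightarrow> j \<in> B \<Longrightarrow> 0 \<le> T i j"
    and "\<And>i. i \<in> A \<Longrightarrow> (\<Sum>j\<in>B. T i j) = 1" and "\<And>j. j \<in> B \<Longrightarrow> (\<Sum>i\<in>A. T i j) = 1"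
  shows "\<exists>p. bij_betw p A B \<and> (\<Sum>i\<in>A. f i * g (p i)) \<le> (\<Sum>i\<in>A. f i * (\<Sum>j\<in>B. T i j * g j))"
  using assms
proof (induction "card A" arbitrary: A B T)
  case 0
  then show ?case by (auto simp: bij_betw_def)
next
  case (Suc n)
  have fin: "finite A" "finite B" and ne: "A \<noteq> {}" "B \<noteq> {}" using Suc.prems Suc.hyps(2) by auto
  obtain i0 where i0: "i0 \<in> A" "\<And>i. i \<in> A \<Longrightarrow> f i0 \<le> f i"
    using arg_min_if_finite[OF fin(1) ne(1), of f] by (metis not_less)
  obtain j0 where j0: "j0 \<in> B" "\<And>j. j \<in> B \<Longrightarrow> g j \<le> g j0"
    using arg_min_if_finite[OF fin(2) ne(2), of "\<lambda>j. - g j"] by (metis not_less neg_less_iff_less)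
  define A' where "A' = A - {i0}"
  define B' where "B' = B - {j0}"
  have A: "A = insert i0 A'" "i0 \<notin> A'" "finite A'" and B: "B = insert j0 B'" "j0 \<notin> B'" "finite B'"
    using i0 j0 fin by (auto simp: A'_def B'_def)
  define s where "s = 1 - T i0 j0"
  have rows: "(\<Sum>j\<in>B'. T i j) = 1 - T i j0" if "i \<in> A" for i
    using Suc.prems(5)[OF that] B by simp
  have cols: "(\<Sum>i\<in>A'. T i j) = 1 - T i0 j" if "j \<in> B" for j
    using Suc.prems(6)[OF that] A by simp
  have a: "(\<Sum>i\<in>A'. T i j0) = s" and b: "(\<Sum>j\<in>B'. T i0 j) = s"
    using rows[OF i0(1)] cols[OF j0(1)] by (auto simp: s_def)
  have nonneg: "0 \<le> T i j" if "i \<in> A" "j \<in> B" for i j using Suc.prems(4) that by blast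
  have s: "s \<ge> 0" unfolding a[symmetric] using nonneg A B by (intro sum_nonneg) auto
  have s0: "T i j0 = 0" if "s = 0" "i \<in> A'" for i
    using a that nonneg A B sum_nonneg_eq_0_iff[of A' "\<lambda>i. T i j0"] by auto
  have s0': "T i0 j = 0" if "s = 0" "j \<in> B'" for j
    using b that nonneg A B sum_nonneg_eq_0_iff[of B' "T i0"] by auto
  \<comment> \<open>The other entries of row \<open>i0\<close> and column \<open>j0\<close>, of
    total mass \<open>s\<close> each, are redistributed as a rank-one matrix that restores the
    remaining row and column sums. For \<open>s = 0\<close> these entries vanish, and the quotient,
    being 0 by convention, is the right correction.\<close>
  define T' where "T' i j = T i j + T i j0 * T i0 j / s" for i j
  have "\<exists>p. bij_betw p A' B' \<and> (\<Sum>i\<in>A'. f i * g (p i)) \<le> (\<Sum>i\<in>A'. f i * (\<Sum>j\<in>B'. T' i j * g j))"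
  proof (rule Suc.hyps(1))
    show "n = card A'" "card A' = card B'" "finite A'" "finite B'"
      using Suc.hyps(2) Suc.prems(3) A B by auto
    show "0 \<le> T' i j" if "i \<in> A'" "j \<in> B'" for i j
      using that nonneg A B s by (simp add: T'_def)
    show "(\<Sum>j\<in>B'. T' i j) = 1" if i: "i \<in> A'" for i
    proof -
      have "(\<Sum>j\<in>B'. T' i j) = 1 - T i j0 + T i j0 * s / s"
        using rows[of i] i A
        by (simp add: T'_def sum.distrib b[symmetric] sum_distrib_left sum_divide_distrib)
      then show ?thesis using s0[of i] i by (cases "s = 0") auto
    qed
    show "(\<Sum>i\<in>A'. T' i j) = 1" if j: "j \<in> B'" for j
    proof -
      have "(\<Sum>i\<in>A'. T' i j) = 1 - T i0 j + s * T i0 j / s"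
        using cols[of j] j B
        by (simp add: T'_def sum.distrib a[symmetric] sum_distrib_right sum_divide_distrib)
      then show ?thesis using s0'[of j] j by (cases "s = 0") auto
    qed
  qed
  then obtain p where p: "bij_betw p A' B'"
    "(\<Sum>i\<in>A'. f i * g (p i)) \<le> (\<Sum>i\<in>A'. f i * (\<Sum>j\<in>B'. T' i j * g j))" by blast
  define P where "P = (\<Sum>i\<in>A'. f i * T i j0)"
  define Q where "Q = (\<Sum>j\<in>B'. T i0 j * g j)"
  define C where "C = (\<Sum>i\<in>A'. f i * (\<Sum>j\<in>B'. T i j * g j))"
  have "(\<Sum>i\<in>A'. f i * (\<Sum>j\<in>B'. T' i j * g j)) = C + P * Q / s"
  proof -
    have "(\<Sum>j\<in>B'. T' i j * g j) = (\<Sum>j\<in>B'. T i j * g j) + T i j0 * Q / s" for i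
      by (simp add: T'_def Q_def distrib_right sum.distrib sum_distrib_left sum_divide_distrib mult.assoc)
    then show ?thesis
      by (simp add: C_def P_def distrib_left sum.distrib sum_distrib_right sum_divide_distrib mult.assoc)
  qed
  moreover have "(\<Sum>i\<in>A. f i * (\<Sum>j\<in>B. T i j * g j))
      = f i0 * (1 - s) * g j0 + f i0 * Q + P * g j0 + C"
    using A B by (simp add: s_def Q_def P_def C_def sum.distrib distrib_left sum_distrib_right mult.assoc)
  moreover have "f i0 * g j0 + P * Q / s \<le> f i0 * (1 - s) * g j0 + f i0 * Q + P * g j0"
  proof (cases "s = 0")
    case True
    then have "P = 0" "Q = 0"
      using s0 s0' by (auto simp: P_def Q_def intro!: sum.neutral)
    then show ?thesis using True by simp
  next
    case False
    then have s1: "s > 0" using s by simp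
    have "f i0 * s \<le> P"
      unfolding P_def a[symmetric] sum_distrib_left
      using nonneg A B i0(2) by (intro sum_mono mult_right_mono) auto
    moreover have "Q \<le> s * g j0"
      unfolding Q_def b[symmetric] sum_distrib_right
      using nonneg A B j0(2) by (intro sum_mono mult_left_mono) auto
    ultimately have "0 \<le> (P - f i0 * s) * (s * g j0 - Q) / s" using s1 by simp
    also have "\<dots> = f i0 * (1 - s) * g j0 + f i0 * Q + P * g j0 - (f i0 * g j0 + P * Q / s)"
      using s1 by (simp add: field_simps)
    finally show ?thesis by simp
  qed
  moreover define q where "q = p(i0 := j0)"
  moreover have "(\<Sum>i\<in>A. f i * g (q i)) = f i0 * g j0 + (\<Sum>i\<in>A'. f i * g (p i))"
    using A by (simp add: q_def) (intro sum.cong, auto)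
  ultimately have "(\<Sum>i\<in>A. f i * g (q i)) \<le> (\<Sum>i\<in>A. f i * (\<Sum>j\<in>B. T i j * g j))"
    using p(2) by linarith
  moreover have "bij_betw q A B"
    using p(1) A B unfolding q_def bij_betw_def by (auto simp: inj_on_def image_iff)
  ultimately show ?case by blast
qed

section \<open>Orthonormal bases and the spectral theorem\<close>

definition onb :: "'a::euclidean_space set \<Rightarrow> bool" where
  "onb E \<longleftrightarrow> pairwise orthogonal E \<and> (\<forall>e\<in>E. norm e = 1) \<and> span E = UNIV"

lemma onb_independent: "onb E \<Longrightarrow> independent E"
  unfolding onb_def by (intro pairwise_orthogonal_independent) auto

lemma onb_finite: "onb E \<Longrightarrow> finite E"
  using onb_independent independent_imp_finite by blast

lemma onb_card:
  fixes E :: "'a::euclidean_space set"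
  shows "onb E \<Longrightarrow> card E = DIM('a)"
  using onb_independent[of E] by (metis dim_UNIV dim_eq_card_independent dim_span onb_def)

lemma onb_inner: "onb E \<Longrightarrow> e \<in> E \<Longrightarrow> f \<in> E \<Longrightarrow> e \<bullet> f = (if e = f then 1 else 0)"
  by (auto simp: onb_def pairwise_def orthogonal_def norm_eq_1)

lemma onb_expand: "onb E \<Longrightarrow> (\<Sum>e\<in>E. (v \<bullet> e) *\<^sub>R e) = v"
  using onb_finite[of E] by (intro orthonormal_basis_expand) (auto simp: onb_def)

lemma onb_inner_sum:
  assumes "onb E" shows "v \<bullet> w = (\<Sum>e\<in>E. (v \<bullet> e) * (w \<bullet> e))"
proof -
  have "v \<bullet> w = v \<bullet> (\<Sum>e\<in>E. (w \<bullet> e) *\<^sub>R e)" using onb_expand[OF assms] by simp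
  then show ?thesis by (simp add: inner_sum_right mult.commute)
qed

lemma linear_perturbation_zero:
  fixes a b :: real
  assumes "\<And>t. 0 \<le> 2 * t * a + t\<^sup>2 * b" "b \<ge> 0"
  shows "a = 0"
proof (rule ccontr)
  assume "a \<noteq> 0"
  \<comment> \<open>The minimum of the quadratic polynomial lies at \<open>- a / b\<close>; adding 1
    covers \<open>b = 0\<close> and still gives a negative value.\<close>
  have "2 * (- a / (b + 1)) * a + (- a / (b + 1))\<^sup>2 * b = - (a\<^sup>2 * (b + 2)) / (b + 1)\<^sup>2"
    using assms(2) by (simp add: divide_simps power2_eq_square) (simp add: algebra_simps)
  also have "\<dots> < 0" using \<open>a \<noteq> 0\<close> assms(2) by (simp add: divide_neg_pos)
  finally show False using assms(1)[of "- a / (b + 1)"] by simp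
qed

text \<open>The form \<open>B v \<bullet> v\<close> attains its maximum over the unit sphere of
  \<open>S\<close> at an eigenvector, whose orthogonal complement in \<open>S\<close> is invariant
  again. Working with invariant subspaces keeps the induction on dimension inside one type.\<close>

lemma symmetric_eigenbasis_subspace:
  fixes B :: "'a::euclidean_space \<Rightarrow> 'a"
  assumes lin: "linear B" and sym: "\<And>v w. B v \<bullet> w = v \<bullet> B w"
    and "subspace S" "B ` S \<subseteq> S"
  shows "\<exists>G. pairwise orthogonal G \<and> (\<forall>g\<in>G. norm g = 1 \<and> (\<exists>l. B g = l *\<^sub>R g)) \<and> span G = S"
  using assms(3,4)
proof (induction "dim S" arbitrary: S rule: less_induct)
  case less
  show ?case
  proof (cases "S = {0}")
    case True
    then show ?thesis by (intro exI[of _ "{}"]) auto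
  next
    case False
    then obtain v0 where v0: "v0 \<in> S" "v0 \<noteq> 0" using subspace_0[OF less.prems(1)] by auto
    let ?K = "S \<inter> sphere 0 1"
    have "compact ?K" using closed_subspace[OF less.prems(1)] by (simp add: closed_Int_compact)
    moreover have "(1 / norm v0) *\<^sub>R v0 \<in> ?K"
      using v0 less.prems(1) by (simp add: subspace_scale)
    moreover have "continuous_on ?K (\<lambda>v. B v \<bullet> v)"
      by (intro continuous_intros linear_continuous_on linear_linear[THEN iffD2, OF lin])
    ultimately obtain g where g: "g \<in> ?K" "\<And>v. v \<in> ?K \<Longrightarrow> B v \<bullet> v \<le> B g \<bullet> g"
      using continuous_attains_sup[of ?K "\<lambda>v. B v \<bullet> v"] by blast
    define l where "l = B g \<bullet> g"
    have gS: "g \<in> S" and ng: "norm g = 1" and gg: "g \<bullet> g = 1" using g(1) by (auto simp: norm_eq_1)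
    define Q where "Q v = l * (v \<bullet> v) - B v \<bullet> v" for v
    have Q: "Q v \<ge> 0" if "v \<in> S" for v
    proof (cases "v = 0")
      case False
      define u where "u = (1 / norm v) *\<^sub>R v"
      have "u \<in> ?K" using that False less.prems(1) by (simp add: u_def subspace_scale)
      then have "B u \<bullet> u \<le> l" using g(2) by (simp add: l_def)
      moreover have "v = norm v *\<^sub>R u" using False by (simp add: u_def)
      then have "B v \<bullet> v = (norm v)\<^sup>2 * (B u \<bullet> u)"
        by (metis inner_scaleR_left inner_scaleR_right lin linear_scale mult.assoc power2_eq_square)
      moreover have "(norm v)\<^sup>2 * (B u \<bullet> u) \<le> (norm v)\<^sup>2 * l"
        using calculation(1) by (rule mult_left_mono) simp
      ultimately show ?thesis
        by (simp add: Q_def power2_norm_eq_inner mult.commute)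
    qed (use lin in \<open>simp add: Q_def linear_0\<close>)
    \<comment> \<open>\<open>Q\<close> is nonnegative on \<open>S\<close> and vanishes at
      \<open>g\<close>, so its linear term along \<open>g + t *\<^sub>R w\<close> is zero.\<close>
    have crit: "(l *\<^sub>R g - B g) \<bullet> w = 0" if w: "w \<in> S" for w
    proof (rule linear_perturbation_zero)
      fix t
      have "g + t *\<^sub>R w \<in> S" using gS w less.prems(1) by (simp add: subspace_add subspace_scale)
      then have "0 \<le> Q (g + t *\<^sub>R w)" by (rule Q)
      also have "\<dots> = 2 * t * ((l *\<^sub>R g - B g) \<bullet> w) + t\<^sup>2 * Q w"
        using gg sym[of w g]
        by (simp add: Q_def linear_add[OF lin] linear_scale[OF lin] inner_add_left inner_add_right
            inner_diff_left l_def power2_eq_square algebra_simps inner_commute)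
      finally show "0 \<le> 2 * t * ((l *\<^sub>R g - B g) \<bullet> w) + t\<^sup>2 * Q w" .
    qed (rule Q[OF w])
    have "l *\<^sub>R g - B g \<in> S"
      using gS less.prems by (intro subspace_diff subspace_scale) auto
    from crit[OF this] have eig: "B g = l *\<^sub>R g" by simp
    define S' where "S' = {v \<in> S. v \<bullet> g = 0}"
    have sub: "subspace S'"
      using less.prems(1) unfolding S'_def subspace_def by (auto simp: inner_add_left)
    have "B ` S' \<subseteq> S'"
      using less.prems(2) sym eig by (auto simp: S'_def)
    moreover have "dim S' < dim S"
    proof -
      have "g \<notin> S'" using gg by (simp add: S'_def)
      moreover have "S' \<subseteq> S" by (auto simp: S'_def)
      ultimately have "S' \<subset> S" using gS by blast
      then show ?thesis
        using less.prems(1) sub by (intro dim_psubset) (simp add: span_eq_iff[THEN iffD2])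
    qed
    ultimately obtain G where G: "pairwise orthogonal G"
      "\<And>h. h \<in> G \<Longrightarrow> norm h = 1 \<and> (\<exists>l. B h = l *\<^sub>R h)" "span G = S'"
      using less.hyps sub by blast
    have GS': "G \<subseteq> S'" using G(3) span_superset by blast
    have "pairwise orthogonal (insert g G)"
      using G(1) GS' by (auto simp: pairwise_insert orthogonal_def S'_def inner_commute)
    moreover have "span (insert g G) = S"
    proof
      show "span (insert g G) \<subseteq> S"
        using GS' gS less.prems(1) by (intro span_minimal) (auto simp: S'_def)
      show "S \<subseteq> span (insert g G)"
      proof
        fix v assume "v \<in> S"
        then have "v - (v \<bullet> g) *\<^sub>R g \<in> S'"
          using gS gg less.prems(1) by (simp add: S'_def subspace_diff subspace_scale inner_diff_left)
        then show "v \<in> span (insert g G)"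
          using G(3) span_breakdown_eq by blast
      qed
    qed
    ultimately show ?thesis using G(2) ng eig by (intro exI[of _ "insert g G"]) blast
  qed
qed

theorem symmetric_eigenbasis:
  fixes B :: "'a::euclidean_space \<Rightarrow> 'a"
  assumes "linear B" "\<And>v w. B v \<bullet> w = v \<bullet> B w"
  obtains G l where "onb G" "\<And>g. g \<in> G \<Longrightarrow> B g = l g *\<^sub>R g"
proof -
  obtain G where G: "pairwise orthogonal G" "\<forall>g\<in>G. norm g = 1 \<and> (\<exists>l. B g = l *\<^sub>R g)" "span G = UNIV"
    using symmetric_eigenbasis_subspace[OF assms, of UNIV] by auto
  then obtain l where "\<forall>g\<in>G. B g = l g *\<^sub>R g" by metis
  then show thesis using G by (intro that[of G l]) (auto simp: onb_def)
qed

text \<open>\<open>L\<close> carries eigenspaces of \<open>B\<close> onto those of \<open>A\<close>.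
  The shape operator is self-adjoint for the induced metric; conjugation compares it with an
  operator symmetric for the inner product of the model space.\<close>

lemma eigenvalues_conjugate:
  fixes A B :: "'a::euclidean_space \<Rightarrow> 'a"
  assumes L: "linear L" "bij L" and "\<And>v. A (L v) = L (B v)"
  shows "eigenvalues A = eigenvalues B"
proof -
  have "dim {v. A v = k *\<^sub>R v} = dim {v. B v = k *\<^sub>R v}" for k
  proof -
    have "{v. A v = k *\<^sub>R v} = L ` {v. B v = k *\<^sub>R v}"
    proof (intro equalityI subsetI)
      fix v assume v: "v \<in> {v. A v = k *\<^sub>R v}"
      obtain w where w: "v = L w" using L(2) by (metis bij_pointE)
      then have "L (B w) = L (k *\<^sub>R w)" using v assms(3) by (simp add: linear_scale[OF L(1)])
      then have "B w = k *\<^sub>R w" using L(2) by (simp add: bij_is_inj inj_eq)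
      then show "v \<in> L ` {v. B v = k *\<^sub>R v}" using w by blast
    qed (auto simp: assms(3) linear_scale[OF L(1)])
    moreover have "inj_on L (span {v. B v = k *\<^sub>R v})" using L(2) by (meson bij_is_inj inj_on_subset subset_UNIV)
    ultimately show ?thesis using dim_image_eq[OF L(1)] by simp
  qed
  then show ?thesis by (simp add: eigenvalues_def)
qed

text \<open>The eigenspace of \<open>k\<close> is spanned by the \<open>g\<close> with
  \<open>l g = k\<close>, so its dimension counts them. Numbering them within each eigenspace
  produces the second components in \<open>eigenvalues\<close>.\<close>

lemma eigenvalues_bij_betw:
  fixes B :: "'a::euclidean_space \<Rightarrow> 'a"
  assumes lin: "linear B" and G: "onb G" and eig: "\<And>g. g \<in> G \<Longrightarrow> B g = l g *\<^sub>R g"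
  obtains b where "bij_betw b G (eigenvalues B)" "\<And>g. g \<in> G \<Longrightarrow> fst (b g) = l g"
proof -
  define Gk where "Gk k = {g \<in> G. l g = k}" for k
  have fin: "finite (Gk k)" for k using onb_finite[OF G] by (simp add: Gk_def)
  have dim: "dim {v. B v = k *\<^sub>R v} = card (Gk k)" for k
  proof -
    have "{v. B v = k *\<^sub>R v} = span (Gk k)"
    proof (intro equalityI subsetI)
      fix v assume "v \<in> {v. B v = k *\<^sub>R v}"
      then have Bv: "B v = k *\<^sub>R v" by simp
      have "B v = (\<Sum>g\<in>G. (v \<bullet> g) *\<^sub>R (l g *\<^sub>R g))"
        using eig by (subst onb_expand[OF G, of v, symmetric])
          (simp add: linear_sum[OF lin] linear_scale[OF lin])
      then have "B v \<bullet> g = l g * (v \<bullet> g)" if "g \<in> G" for g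
        using that onb_finite[OF G] onb_inner[OF G]
        by (simp add: inner_sum_left if_distrib[of "(*) _"] sum.delta' cong: if_cong)
      then have "v \<bullet> g = 0" if "g \<in> G - Gk k" for g
        using that Bv by (auto simp: Gk_def)
      then have "(\<Sum>g\<in>G. (v \<bullet> g) *\<^sub>R g) = (\<Sum>g\<in>Gk k. (v \<bullet> g) *\<^sub>R g)"
        using onb_finite[OF G] by (intro sum.mono_neutral_right) (auto simp: Gk_def)
      then have "v = (\<Sum>g\<in>Gk k. (v \<bullet> g) *\<^sub>R g)" using onb_expand[OF G] by simp
      also have "\<dots> \<in> span (Gk k)" by (intro span_sum span_scale span_base)
      finally show "v \<in> span (Gk k)" .
    next
      fix v assume v: "v \<in> span (Gk k)"
      have "subspace {v. B v = k *\<^sub>R v}"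
        unfolding subspace_def by (auto simp: linear_add[OF lin] linear_scale[OF lin] linear_0[OF lin] algebra_simps)
      moreover have "Gk k \<subseteq> {v. B v = k *\<^sub>R v}" using eig by (auto simp: Gk_def)
      ultimately show "v \<in> {v. B v = k *\<^sub>R v}" using span_minimal v by blast
    qed
    moreover have "independent (Gk k)"
      by (rule independent_mono[OF onb_independent[OF G]]) (auto simp: Gk_def)
    ultimately show ?thesis by (simp add: dim_eq_card_independent)
  qed
  have "\<forall>k. \<exists>h. bij_betw h (Gk k) {0..<card (Gk k)}"
    using ex_bij_betw_finite_nat[OF fin] by blast
  then obtain h where h: "\<And>k. bij_betw (h k) (Gk k) {0..<card (Gk k)}" by metis
  define b where "b g = (l g, h (l g) g)" for g
  have "bij_betw b G (eigenvalues B)"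
    unfolding bij_betw_def
  proof
    show "inj_on b G"
    proof (rule inj_onI)
      fix g g' assume "g \<in> G" "g' \<in> G" "b g = b g'"
      then have "g \<in> Gk (l g)" "g' \<in> Gk (l g)" "h (l g) g = h (l g) g'" by (auto simp: b_def Gk_def)
      then show "g = g'" using h[of "l g"] by (auto simp: bij_betw_def inj_on_def)
    qed
    show "b ` G = eigenvalues B"
    proof (intro equalityI subsetI)
      fix z assume "z \<in> b ` G"
      then obtain g where "g \<in> Gk (l g)" "z = b g" by (auto simp: Gk_def)
      then show "z \<in> eigenvalues B"
        using h[of "l g"] by (auto simp: eigenvalues_def b_def dim bij_betw_def)
    next
      fix z assume "z \<in> eigenvalues B"
      then obtain k j where z: "z = (k, j)" "j < card (Gk k)" by (auto simp: eigenvalues_def dim)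
      then have "j \<in> h k ` Gk k" using h[of k] by (auto simp: bij_betw_def)
      then show "z \<in> b ` G" using z by (auto simp: b_def Gk_def)
    qed
  qed
  then show thesis by (rule that) (simp add: b_def)
qed

text \<open>For a unit vector \<open>e\<close> the entry \<open>B e \<bullet> e\<close> is an
  average of the eigenvalues with weights \<open>(e \<bullet> g)\<^sup>2\<close>; summing over
  \<open>e\<close> makes every weight 1 by Parseval's identity.\<close>

lemma onb_trace:
  fixes B :: "'a::euclidean_space \<Rightarrow> 'a"
  assumes lin: "linear B" and E: "onb E" and G: "onb G"
    and eig: "\<And>g. g \<in> G \<Longrightarrow> B g = l g *\<^sub>R g"
  shows "B e \<bullet> e = (\<Sum>g\<in>G. (e \<bullet> g)\<^sup>2 * l g)"
    and "(\<Sum>e\<in>E. B e \<bullet> e) = (\<Sum>g\<in>G. l g)"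
proof -
  have *: "B e \<bullet> e = (\<Sum>g\<in>G. (e \<bullet> g)\<^sup>2 * l g)" for e
  proof -
    have "B e = (\<Sum>g\<in>G. (e \<bullet> g) *\<^sub>R (l g *\<^sub>R g))"
      using eig by (subst onb_expand[OF G, of e, symmetric])
        (simp add: linear_sum[OF lin] linear_scale[OF lin])
    then show ?thesis
      by (simp add: inner_sum_left inner_sum_right power2_eq_square mult_ac inner_commute)
  qed
  then show "B e \<bullet> e = (\<Sum>g\<in>G. (e \<bullet> g)\<^sup>2 * l g)" .
  have "(\<Sum>e\<in>E. B e \<bullet> e) = (\<Sum>g\<in>G. (\<Sum>e\<in>E. (e \<bullet> g)\<^sup>2) * l g)"
    unfolding * sum_distrib_right by (rule sum.swap)
  also have "\<dots> = (\<Sum>g\<in>G. l g)"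
  proof (rule sum.cong)
    fix g assume "g \<in> G"
    then have "g \<bullet> g = 1" using onb_inner[OF G] by simp
    then show "(\<Sum>e\<in>E. (e \<bullet> g)\<^sup>2) * l g = l g"
      using onb_inner_sum[OF E, of g g] by (simp add: power2_eq_square inner_commute)
  qed simp
  finally show "(\<Sum>e\<in>E. B e \<bullet> e) = (\<Sum>g\<in>G. l g)" .
qed

text \<open>The matrix \<open>(e \<bullet> g)\<^sup>2\<close> is doubly stochastic, so the diagonal
  entries of \<open>B\<close>, weighted by the partial derivatives at \<open>d\<close>, sum to at
  least what some arrangement of the eigenvalues gives. \<open>esym_garding\<close> applies to that
  arrangement, because \<open>esym\<close> ignores the order. Thus \<open>E\<close> need not consist
  of eigenvectors of \<open>B\<close>.\<close>

theorem esym_garding_symmetric: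
  fixes B :: "'a::euclidean_space \<Rightarrow> 'a"
  assumes lin: "linear B" and E: "onb E" and G: "onb G"
    and eig: "\<And>g. g \<in> G \<Longrightarrow> B g = l g *\<^sub>R g" and l: "\<And>g. g \<in> G \<Longrightarrow> l g > 0"
    and d: "\<And>e. e \<in> E \<Longrightarrow> d e > 0" and k: "1 \<le> k" "k \<le> DIM('a)"
    and eq: "esym k G l = esym k E d"
  shows "esym_deriv k E d d \<le> esym_deriv k E d (\<lambda>e. B e \<bullet> e)"
proof -
  define f where "f e = esym (k - 1) (E - {e}) d" for e
  have sumG: "(\<Sum>g\<in>G. (e \<bullet> g)\<^sup>2) = 1" if "e \<in> E" for e
    using onb_inner_sum[OF G, of e e] onb_inner[OF E that that] by (simp add: power2_eq_square)
  have sumE: "(\<Sum>e\<in>E. (e \<bullet> g)\<^sup>2) = 1" if "g \<in> G" for g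
    using onb_inner_sum[OF E, of g g] onb_inner[OF G that that]
    by (simp add: power2_eq_square inner_commute)
  obtain p where p: "bij_betw p E G"
    "(\<Sum>e\<in>E. f e * l (p e)) \<le> (\<Sum>e\<in>E. f e * (\<Sum>g\<in>G. (e \<bullet> g)\<^sup>2 * l g))"
    using doubly_stochastic_permutation[of E G "\<lambda>e g. (e \<bullet> g)\<^sup>2" f l]
      onb_finite[OF E] onb_finite[OF G] onb_card[OF E] onb_card[OF G] sumG sumE by auto
  have "esym k E d = esym k E (\<lambda>e. l (p e))"
    using esym_bij_betw[OF p(1), of l "\<lambda>e. l (p e)" k] eq by simp
  then have "esym_deriv k E d d \<le> esym_deriv k E d (\<lambda>e. l (p e))"
    using onb_finite[OF E] onb_card[OF E] k d l p(1)
    by (intro esym_garding) (auto simp: bij_betw_def)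
  also have "\<dots> \<le> esym_deriv k E d (\<lambda>e. B e \<bullet> e)"
  proof -
    have "B e \<bullet> e = (\<Sum>g\<in>G. (e \<bullet> g)\<^sup>2 * l g)" for e
      using onb_trace(1)[OF lin E G] eig by blast
    then show ?thesis using p(2) by (simp add: esym_deriv_def f_def)
  qed
  finally show ?thesis .
qed

section \<open>The second variation of the shrinker equation of a graph\<close>

definition pd :: "'a::euclidean_space \<Rightarrow> ('a \<Rightarrow> real) \<Rightarrow> 'a \<Rightarrow> real" where
  "pd v f u = fderiv f u v"

lemma C_k_on_pd: "C_k_on (Suc k) S f \<Longrightarrow> C_k_on k S (pd v f)"
  unfolding pd_def[abs_def] by (rule C_k_on_SucD(2))

lemma pd_commute: "open S \<Longrightarrow> u \<in> S \<Longrightarrow> C_k_on 2 S f \<Longrightarrow> pd w (pd v f) u = pd v (pd w f) u"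
  using C_2_symmetric[of S u f v w] by (simp add: pd_def[abs_def])

lemma pd_cong:
  assumes "open S" "u \<in> S" "\<And>y. y \<in> S \<Longrightarrow> f y = g y" "C_k_on 1 S f"
  shows "pd v f u = pd v g u"
proof -
  have "(f has_derivative fderiv f u) (at u)"
    using assms(2,4) by (simp add: frechet_derivative_works[symmetric])
  then have "(g has_derivative fderiv f u) (at u)"
    by (rule has_derivative_transform_within_open) (use assms in auto)
  then show ?thesis unfolding pd_def using frechet_derivative_at by metis
qed

text \<open>The slopes along \<open>v\<close> and \<open>- v\<close> of a function vanishing at 0:
  this is what a factor of a product contributes to the second difference of the product.\<close>

definition slope0 :: "'a::real_vector \<Rightarrow> ('a \<Rightarrow> real) \<Rightarrow> real \<Rightarrow> bool" where
  "slope0 v f a \<longleftrightarrow> f 0 = 0 \<and> ((\<lambda>t. f (t *\<^sub>R v) / t) \<longlongrightarrow> a) (at_right 0)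
    \<and> ((\<lambda>t. f (- (t *\<^sub>R v)) / t) \<longlongrightarrow> - a) (at_right 0)"

text \<open>Limits of symmetric second differences stand in for second derivatives. They are linear,
  respect inequalities with contact at 0, and see a continuous cofactor only through its value at 0,
  so \<open>W\<close> and \<open>\<alpha>\<close> are never differentiated.\<close>

definition diff2 :: "'a::real_vector \<Rightarrow> ('a \<Rightarrow> real) \<Rightarrow> real \<Rightarrow> bool" where
  "diff2 v f a \<longleftrightarrow> ((\<lambda>t. (f (t *\<^sub>R v) + f (- (t *\<^sub>R v)) - 2 * f 0) / t\<^sup>2) \<longlongrightarrow> a) (at_right 0)"

lemma diff2_add: "diff2 v f a \<Longrightarrow> diff2 v g b \<Longrightarrow> diff2 v (\<lambda>y. f y + g y) (a + b)"
  unfolding diff2_def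
  by (drule (1) tendsto_add) (simp add: add_divide_distrib[symmetric] algebra_simps)

lemma diff2_cmult: "diff2 v f a \<Longrightarrow> diff2 v (\<lambda>y. c * f y) (c * a)"
  unfolding diff2_def
  by (drule tendsto_mult_left[of _ _ _ c]) (simp add: algebra_simps)

lemma diff2_diff: "diff2 v f a \<Longrightarrow> diff2 v g b \<Longrightarrow> diff2 v (\<lambda>y. f y - g y) (a - b)"
  using diff2_add[of v f a "\<lambda>y. (- 1) * g y" "(- 1) * b"] diff2_cmult[of v g b "- 1"] by simp

lemma diff2_const: "diff2 v (\<lambda>y. c) 0"
  by (simp add: diff2_def)

lemma diff2_sum:
  assumes "\<And>i. i \<in> I \<Longrightarrow> diff2 v (f i) (a i)"
  shows "diff2 v (\<lambda>y. \<Sum>i\<in>I. f i y) (\<Sum>i\<in>I. a i)"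
  using assms by (induction I rule: infinite_finite_induct) (auto intro: diff2_add diff2_const)

lemma diff2_C2:
  assumes "open S" "0 \<in> S" "C_k_on 2 S f"
  shows "diff2 v f (pd v (pd v f) 0)"
  using symmetric_second_difference[OF assms, of v] by (simp add: diff2_def pd_def[abs_def])

lemma slope0_C1:
  assumes S: "0 \<in> S" and f: "C_k_on (Suc k) S f" and "f 0 = 0"
  shows "slope0 v f (pd v f 0)"
proof -
  have der: "(f has_derivative fderiv f 0) (at 0)"
    by (rule C_k_on_SucD(1)[OF f S])
  have q: "((\<lambda>t. f (t *\<^sub>R w) / t) \<longlongrightarrow> fderiv f 0 w) (at_right 0)" for w
  proof -
    have "((\<lambda>s. f (0 + s *\<^sub>R w)) has_real_derivative fderiv f 0 w) (at 0)"
      by (rule DERIV_along_line) (use der in simp)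
    then show ?thesis
      using assms(3) by (simp add: has_field_derivative_iff filterlim_at_split)
  qed
  show ?thesis
    using q[of v] q[of "- v"] assms(3) has_derivative_linear[OF der]
    by (simp add: slope0_def pd_def linear_neg)
qed

lemma slope0_inner: "slope0 v (\<lambda>y. y \<bullet> e) (v \<bullet> e)"
proof -
  have "\<forall>\<^sub>F t::real in at_right 0. v \<bullet> e = t * (v \<bullet> e) / t"
    and "\<forall>\<^sub>F t::real in at_right 0. - (v \<bullet> e) = - (t * (v \<bullet> e)) / t"
    using eventually_at_right_less[of "0::real"] by (eventually_elim, simp)+
  then show ?thesis
    unfolding slope0_def by (auto intro: Lim_transform_eventually[OF tendsto_const])
qed

text \<open>Of the divisor \<open>t\<^sup>2\<close>, each of \<open>f\<close> and \<open>g\<close>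
  absorbs one \<open>t\<close>, and \<open>c\<close> tends to \<open>c 0\<close>. The opposite signs
  of the slopes along \<open>v\<close> and \<open>- v\<close> cancel in the product, whence the
  factor 2.\<close>

lemma diff2_product:
  fixes v :: "'a::real_normed_vector"
  assumes f: "slope0 v f a" and g: "slope0 v g b" and c: "isCont c 0"
  shows "diff2 v (\<lambda>y. f y * g y * c y) (2 * a * b * c 0)"
proof -
  have "((\<lambda>t. t *\<^sub>R v) \<longlongrightarrow> 0 *\<^sub>R v) (at_right 0)" by (intro tendsto_intros)
  then have tv: "((\<lambda>t. t *\<^sub>R v) \<longlongrightarrow> 0) (at_right 0)" by simp
  then have "((\<lambda>t. - (t *\<^sub>R v)) \<longlongrightarrow> - 0) (at_right 0)" by (rule tendsto_minus)
  then have mv: "((\<lambda>t. - (t *\<^sub>R v)) \<longlongrightarrow> 0) (at_right 0)" by simp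
  have cp: "((\<lambda>t. c (t *\<^sub>R v)) \<longlongrightarrow> c 0) (at_right 0)"
    and cm: "((\<lambda>t. c (- (t *\<^sub>R v))) \<longlongrightarrow> c 0) (at_right 0)"
    using isCont_tendsto_compose[OF c tv] isCont_tendsto_compose[OF c mv] by auto
  have "((\<lambda>t. f (t *\<^sub>R v) / t * (g (t *\<^sub>R v) / t) * c (t *\<^sub>R v)
      + f (- (t *\<^sub>R v)) / t * (g (- (t *\<^sub>R v)) / t) * c (- (t *\<^sub>R v)))
      \<longlongrightarrow> a * b * c 0 + (- a) * (- b) * c 0) (at_right 0)"
    using f g by (intro tendsto_intros cp cm) (auto simp: slope0_def)
  then show ?thesis
    using f g by (simp add: diff2_def slope0_def add_divide_distrib power2_eq_square mult.assoc)
qed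

lemma diff2_le:
  fixes v :: "'a::real_normed_vector"
  assumes S: "open S" "0 \<in> S" and le: "\<And>y. y \<in> S \<Longrightarrow> f y \<le> g y" and eq: "f 0 = g 0"
    and f: "diff2 v f a" and g: "diff2 v g b"
  shows "a \<le> b"
proof -
  have "((\<lambda>t. t *\<^sub>R v) \<longlongrightarrow> 0 *\<^sub>R v) (at_right 0)" by (intro tendsto_intros)
  then have tv: "((\<lambda>t. t *\<^sub>R v) \<longlongrightarrow> 0) (at_right 0)" by simp
  then have "((\<lambda>t. - (t *\<^sub>R v)) \<longlongrightarrow> - 0) (at_right 0)" by (rule tendsto_minus)
  then have mv: "((\<lambda>t. - (t *\<^sub>R v)) \<longlongrightarrow> 0) (at_right 0)" by simp
  have "\<forall>\<^sub>F t in at_right 0. t *\<^sub>R v \<in> S" "\<forall>\<^sub>F t in at_right 0. - (t *\<^sub>R v) \<in> S"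
    using topological_tendstoD[OF tv S] topological_tendstoD[OF mv S] by auto
  then have "\<forall>\<^sub>F t in at_right 0. (f (t *\<^sub>R v) + f (- (t *\<^sub>R v)) - 2 * f 0) / t\<^sup>2
      \<le> (g (t *\<^sub>R v) + g (- (t *\<^sub>R v)) - 2 * g 0) / t\<^sup>2"
    by eventually_elim (use le eq in \<open>auto intro!: divide_right_mono add_mono\<close>)
  then show ?thesis
    using f g unfolding diff2_def by (intro tendsto_le[OF trivial_limit_at_right_real g[unfolded diff2_def] f[unfolded diff2_def]])
qed

text \<open>Taking symmetric second differences at \<open>0\<close> of the shrinker equation of the graph in the
  directions \<open>e \<in> E\<close>, weighted by \<open>P\<close>, and of the inequality in all directions of \<open>E\<close>, the
  fourth order terms cancel because partial derivatives commute.\<close>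

theorem graph_second_variation:
  fixes F :: "'a::euclidean_space \<Rightarrow> real" and P d :: "'a \<Rightarrow> real"
  assumes E: "onb E" and V: "open V" "0 \<in> V" and F: "C_k_on 4 V F"
    and F1: "\<And>e. e \<in> E \<Longrightarrow> pd e F 0 = 0"
    and F2: "\<And>e f. e \<in> E \<Longrightarrow> f \<in> E \<Longrightarrow> pd f (pd e F) 0 = (if e = f then d e else 0)"
    and W: "\<And>y. W y = sqrt (1 + (\<Sum>e\<in>E. (pd e F y)\<^sup>2))"
    and shrinker: "\<And>y. y \<in> V \<Longrightarrow> (\<Sum>e\<in>E. pd e (pd e F) y)
        - (\<Sum>e\<in>E. \<Sum>f\<in>E. pd e F y * pd f F y * pd f (pd e F) y) / (W y)\<^sup>2
        = ((\<Sum>e\<in>E. (y \<bullet> e) * pd e F y) - F y) / 2"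
    and \<alpha>: "\<And>y. \<alpha> y = 1 / (W y * (W y + 1))"
    and ineq: "\<And>y. y \<in> V \<Longrightarrow> K * W y \<le> (\<Sum>k\<in>E. P k * (pd k (pd k F) y
        - 2 * \<alpha> y * pd k F y * (\<Sum>j\<in>E. pd j F y * pd k (pd j F) y)
        + (\<alpha> y)\<^sup>2 * (pd k F y)\<^sup>2 * (\<Sum>i\<in>E. \<Sum>j\<in>E. pd i F y * pd j F y * pd j (pd i F) y)))"
    and K: "K = (\<Sum>k\<in>E. P k * d k)" "K > 0"
  shows "(\<Sum>k\<in>E. (d k)\<^sup>2) \<le> 1 / 2"
proof -
  have C4: "C_k_on (Suc (Suc (Suc (Suc 0)))) V F" using F by (simp add: eval_nat_numeral)
  note C3 = C_k_on_pd[OF C4] and C2 = C_k_on_pd[OF C_k_on_pd[OF C4]]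
  have fin: "finite E" using onb_finite[OF E] .
  have cont1: "isCont (pd e F) 0" and cont2: "isCont (pd f (pd e F)) 0" for e f
    using C_k_on_imp_continuous_on[OF C3, of e] C_k_on_imp_continuous_on[OF C2, of f e] V
    by (auto simp: continuous_on_eq_continuous_at)
  have Wpos: "W y \<ge> 1" for y unfolding W by (simp add: sum_nonneg)
  have W0: "W 0 = 1" using F1 by (simp add: W)
  have contW: "isCont W 0"
    unfolding W[abs_def] by (intro continuous_intros cont1)
  have cont\<alpha>: "isCont \<alpha> 0"
    unfolding \<alpha>[abs_def] by (intro continuous_intros contW) (simp add: W0)
  have \<alpha>0: "\<alpha> 0 = 1 / 2" by (simp add: \<alpha> W0)
  have FDp: "slope0 v (pd e F) (if e = v then d v else 0)" if "v \<in> E" "e \<in> E" for v e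
    using slope0_C1[OF V(2) C3 F1[OF that(2)], of v] F2[OF that(2,1)] by (auto split: if_splits)
  have SDp: "diff2 v (pd f (pd e F)) (pd v (pd v (pd f (pd e F))) 0)" for v e f
    using diff2_C2[OF V, of "pd f (pd e F)" v] C2[of f e] by (simp add: numeral_2_eq_2)
  \<comment> \<open>Four transpositions of adjacent derivatives; \<open>sw1\<close> performs one
    beneath a further derivative, and \<open>pd_cong\<close> carries it beneath yet another.\<close>
  have comm: "pd v (pd v (pd e (pd e F))) 0 = pd e (pd e (pd v (pd v F))) 0" for v e
  proof -
    have sw: "pd b (pd a G) y = pd a (pd b G) y" if "C_k_on (Suc (Suc k)) V G" "y \<in> V" for G a b y k
      using pd_commute[OF V(1) that(2), of G b a] C_k_on_le[OF that(1), of 2] by simp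
    have sw1: "pd c (pd b (pd a G)) y = pd c (pd a (pd b G)) y"
      if "C_k_on (Suc (Suc (Suc k))) V G" "y \<in> V" for G a b c y k
      by (rule pd_cong[OF V(1) that(2)]) (use sw[OF that(1)] C_k_on_le[OF C_k_on_pd[OF C_k_on_pd[OF that(1)]], of 1] in auto)
    have "pd v (pd v (pd e (pd e F))) 0 = pd v (pd e (pd v (pd e F))) 0"
      by (rule sw1[OF C3 V(2)])
    also have "\<dots> = pd e (pd v (pd v (pd e F))) 0"
      by (rule sw[OF C2 V(2)])
    also have "\<dots> = pd e (pd v (pd e (pd v F))) 0"
    proof (rule pd_cong[OF V])
      show "C_k_on 1 V (pd v (pd v (pd e F)))" using C_k_on_pd[OF C2] by simp
      show "pd v (pd v (pd e F)) y = pd v (pd e (pd v F)) y" if "y \<in> V" for y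
        by (rule sw1[OF C4 that])
    qed
    also have "\<dots> = pd e (pd e (pd v (pd v F))) 0"
      by (rule sw1[OF C3 V(2)])
    finally show ?thesis .
  qed
  \<comment> \<open>Second difference of the shrinker equation in direction \<open>v\<close>. In the
    double sum only \<open>e = f = v\<close> survives and gives \<open>2 * d v ^ 3\<close>. On the
    right, half of \<open>y \<bullet> grad F\<close> gives \<open>d v\<close>, and
    \<open>F / 2\<close> takes away \<open>d v / 2\<close>.\<close>
  have step1: "(\<Sum>e\<in>E. pd v (pd v (pd e (pd e F))) 0) = 2 * d v ^ 3 + d v / 2" if v: "v \<in> E" for v
  proof -
    let ?s = "\<lambda>e. if e = v then d v else 0"
    define G where "G y = (\<Sum>e\<in>E. pd e (pd e F) y)
        - (\<Sum>e\<in>E. \<Sum>f\<in>E. pd e F y * pd f F y * (pd f (pd e F) y / (W y)\<^sup>2))" for y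
    define H where "H y = (\<Sum>e\<in>E. (y \<bullet> e) * pd e F y * (1 / 2)) - 1 / 2 * F y" for y
    have "diff2 v G ((\<Sum>e\<in>E. pd v (pd v (pd e (pd e F))) 0)
        - (\<Sum>e\<in>E. \<Sum>f\<in>E. 2 * ?s e * ?s f
            * (pd f (pd e F) 0 / (W 0)\<^sup>2)))"
      unfolding G_def[abs_def]
      by (intro diff2_diff diff2_sum SDp diff2_product FDp v continuous_intros cont2 contW) (auto simp: W0)
    also have "(\<Sum>e\<in>E. \<Sum>f\<in>E. 2 * ?s e * ?s f
            * (pd f (pd e F) 0 / (W 0)\<^sup>2)) = 2 * d v ^ 3"
      using v fin F2[OF v v]
      by (simp add: W0 if_distrib[of "\<lambda>x. x * _"] if_distrib[of "\<lambda>x. _ * x"] power3_eq_cube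
          cong: if_cong)
    finally have G: "diff2 v G ((\<Sum>e\<in>E. pd v (pd v (pd e (pd e F))) 0) - 2 * d v ^ 3)" .
    have SDF: "diff2 v F (d v)"
      using diff2_C2[OF V C_k_on_le[OF C4], of v] F2[OF v v] by simp
    have "diff2 v H ((\<Sum>e\<in>E. 2 * (v \<bullet> e) * ?s e * (1 / 2)) - 1 / 2 * d v)"
      unfolding H_def[abs_def]
      by (intro diff2_diff diff2_sum diff2_cmult SDF diff2_product FDp slope0_inner v continuous_const)
    also have "(\<Sum>e\<in>E. 2 * (v \<bullet> e) * ?s e * (1 / 2)) = d v"
      using v fin onb_inner[OF E v v]
      by (simp add: if_distrib[of "\<lambda>x. _ * x"] sum_divide_distrib[symmetric] cong: if_cong)
    finally have H: "diff2 v H (d v - 1 / 2 * d v)" .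
    have GH: "G y = H y" if "y \<in> V" for y
      using shrinker[OF that]
      by (simp add: G_def H_def sum_divide_distrib diff_divide_distrib)
    show ?thesis
      using diff2_le[OF V _ _ G H] diff2_le[OF V _ _ H G] GH V(2) by simp
  qed
  \<comment> \<open>As \<open>\<alpha> 0 = 1 / 2\<close>, the term with one factor
    \<open>\<alpha>\<close> gives \<open>2 * d v ^ 3\<close> for \<open>k = v\<close> and nothing
    otherwise. The term with \<open>\<alpha>\<close> squared has four factors vanishing at 0 and
    contributes nothing. The second difference of \<open>W\<close> is
    \<open>(d v)\<^sup>2\<close>.\<close>
  have step2: "K * (d v)\<^sup>2 \<le> (\<Sum>k\<in>E. P k * pd v (pd v (pd k (pd k F))) 0) - 2 * (P v * d v ^ 3)"
    if v: "v \<in> E" for v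
  proof -
    let ?s = "\<lambda>e. if e = v then d v else 0"
    define G where "G y = (\<Sum>k\<in>E. P k * (pd k (pd k F) y
        - (\<Sum>j\<in>E. pd k F y * pd j F y * (2 * \<alpha> y * pd k (pd j F) y))
        + (\<Sum>i\<in>E. \<Sum>j\<in>E. pd i F y * pd j F y * ((\<alpha> y)\<^sup>2 * (pd k F y)\<^sup>2 * pd j (pd i F) y))))" for y
    \<comment> \<open>The identity W = 1 + |grad F|^2 / (W + 1) brings the square root into a form
      accepted by \<open>diff2_product\<close>.\<close>
    define H where "H y = K * (1 + (\<Sum>e\<in>E. pd e F y * pd e F y * (1 / (W y + 1))))" for y
    have HW: "H y = K * W y" for y
    proof -
      have "(\<Sum>e\<in>E. pd e F y * pd e F y * (1 / (W y + 1))) = (\<Sum>e\<in>E. (pd e F y)\<^sup>2) / (W y + 1)"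
        by (simp add: sum_divide_distrib power2_eq_square)
      also have "(\<Sum>e\<in>E. (pd e F y)\<^sup>2) = (W y)\<^sup>2 - 1"
        by (simp add: W sum_nonneg)
      also have "((W y)\<^sup>2 - 1) / (W y + 1) = W y - 1"
        using Wpos[of y] by (simp add: field_simps power2_eq_square)
      finally show ?thesis by (simp add: H_def)
    qed
    have "diff2 v H (K * (0 + (\<Sum>e\<in>E. 2 * ?s e * ?s e
        * (1 / (W 0 + 1)))))"
      unfolding H_def[abs_def]
      by (intro diff2_cmult diff2_add diff2_const diff2_sum diff2_product FDp v continuous_intros contW)
        (auto simp: W0)
    also have "(\<Sum>e\<in>E. 2 * ?s e * ?s e
        * (1 / (W 0 + 1))) = (d v)\<^sup>2"
      using v fin by (simp add: W0 if_distrib[of "\<lambda>x. x * _"] if_distrib[of "\<lambda>x. _ * x"] power2_eq_square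
          sum_divide_distrib[symmetric] cong: if_cong)
    finally have H: "diff2 v H (K * (d v)\<^sup>2)" by simp
    define T where "T k = pd v (pd v (pd k (pd k F))) 0
        - (\<Sum>j\<in>E. 2 * ?s k * ?s j * (2 * \<alpha> 0 * pd k (pd j F) 0))
        + (\<Sum>i\<in>E. \<Sum>j\<in>E. 2 * ?s i * ?s j * ((\<alpha> 0)\<^sup>2 * (pd k F 0)\<^sup>2 * pd j (pd i F) 0))" for k
    have "diff2 v G (\<Sum>k\<in>E. P k * T k)"
      unfolding G_def[abs_def] T_def
      by (intro diff2_cmult diff2_add diff2_diff SDp diff2_sum diff2_product FDp v continuous_intros
          cont\<alpha> cont1 cont2)
    also have "(\<Sum>k\<in>E. P k * T k)
      = (\<Sum>k\<in>E. P k * pd v (pd v (pd k (pd k F))) 0 - (if k = v then 2 * (P v * d v ^ 3) else 0))"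
    proof (rule sum.cong)
      fix k assume k: "k \<in> E"
      have "(\<Sum>j\<in>E. 2 * ?s k * ?s j * (2 * \<alpha> 0 * pd k (pd j F) 0))
          = (if k = v then 2 * d v ^ 3 else 0)"
        using v fin F2[OF v v] by (simp add: \<alpha>0 if_distrib[of "\<lambda>x. x * _"] if_distrib[of "\<lambda>x. _ * x"]
            power3_eq_cube cong: if_cong)
      then show "P k * T k
        = P k * pd v (pd v (pd k (pd k F))) 0 - (if k = v then 2 * (P v * d v ^ 3) else 0)"
        using F1[OF k] by (simp add: T_def algebra_simps)
    qed simp
    also have "\<dots> = (\<Sum>k\<in>E. P k * pd v (pd v (pd k (pd k F))) 0) - 2 * (P v * d v ^ 3)"
      using v fin by (simp add: sum_subtractf)
    finally have G: "diff2 v G ((\<Sum>k\<in>E. P k * pd v (pd v (pd k (pd k F))) 0) - 2 * (P v * d v ^ 3))" .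
    have HG: "H y \<le> G y" if "y \<in> V" for y
      using ineq[OF that]
      by (simp add: HW G_def sum_distrib_left mult_ac power2_eq_square)
    have "G 0 = H 0"
      using F1 F2 by (simp add: HW W0 G_def K(1))
    then show ?thesis
      using diff2_le[OF V HG _ H G] by simp
  qed
  have "K * (\<Sum>v\<in>E. (d v)\<^sup>2)
      \<le> (\<Sum>v\<in>E. (\<Sum>k\<in>E. P k * pd v (pd v (pd k (pd k F))) 0) - 2 * (P v * d v ^ 3))"
    unfolding sum_distrib_left by (intro sum_mono step2)
  also have "\<dots> = (\<Sum>k\<in>E. P k * (\<Sum>v\<in>E. pd k (pd k (pd v (pd v F))) 0)) - 2 * (\<Sum>v\<in>E. P v * d v ^ 3)"
    unfolding sum_subtractf sum_distrib_left
    by (subst sum.swap) (simp add: comm)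
  also have "\<dots> = (\<Sum>k\<in>E. P k * (2 * d k ^ 3 + d k / 2)) - 2 * (\<Sum>v\<in>E. P v * d v ^ 3)"
    by (simp add: step1)
  also have "\<dots> = K / 2"
    by (simp add: K(1) distrib_left sum.distrib sum_distrib_left sum_divide_distrib mult_ac)
  finally show ?thesis using K(2) by (simp add: field_simps)
qed

section \<open>The shape operator of a graph\<close>

definition gradient :: "('a::euclidean_space \<Rightarrow> real) \<Rightarrow> 'a \<Rightarrow> 'a" where
  "gradient F y = (\<Sum>b\<in>Basis. pd b F y *\<^sub>R b)"

definition hessian :: "('a::euclidean_space \<Rightarrow> real) \<Rightarrow> 'a \<Rightarrow> 'a \<Rightarrow> 'a" where
  "hessian F y = fderiv (gradient F) y"

context
  fixes F :: "'a::euclidean_space \<Rightarrow> real" and V :: "'a set"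
  assumes V: "open V" and F: "C_k_on 2 V F"
begin

lemma C2_Suc: "C_k_on (Suc (Suc 0)) V F"
  using F by (simp add: numeral_2_eq_2)

lemma gradient_inner: "y \<in> V \<Longrightarrow> gradient F y \<bullet> v = pd v F y"
proof -
  assume "y \<in> V"
  then have "linear (fderiv F y)"
    using C_k_on_SucD(1)[OF C2_Suc] has_derivative_linear by blast
  then have "pd v F y = (\<Sum>b\<in>Basis. (v \<bullet> b) * pd b F y)"
    unfolding pd_def by (subst linear_sum_Basis) auto
  then show ?thesis
    by (simp add: gradient_def inner_sum_left inner_sum_right mult.commute inner_commute)
qed

lemma C_k_on_gradient: "C_k_on 1 V (gradient F)"
proof -
  have "C_k_on (Suc 0) V (gradient F)"
    unfolding gradient_def[abs_def]
    by (intro C_k_on_sum V C_k_on_bounded_linear[OF bounded_linear_scaleR_left V]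
        C_k_on_pd C2_Suc)
  then show ?thesis by simp
qed

lemma gradient_has_derivative: "y \<in> V \<Longrightarrow> (gradient F has_derivative hessian F y) (at y)"
  unfolding hessian_def by (rule C_k_on_SucD(1)[OF C_k_on_gradient[unfolded One_nat_def]])

lemma linear_hessian: "y \<in> V \<Longrightarrow> linear (hessian F y)"
  using gradient_has_derivative has_derivative_linear by blast

lemma hessian_inner: "y \<in> V \<Longrightarrow> hessian F y v \<bullet> w = pd v (pd w F) y"
proof -
  assume y: "y \<in> V"
  have "((\<lambda>u. gradient F u \<bullet> w) has_derivative (\<lambda>v. hessian F y v \<bullet> w)) (at y)"
    by (intro bounded_linear.has_derivative[OF bounded_linear_inner_left] gradient_has_derivative y)
  then have "(pd w F has_derivative (\<lambda>v. hessian F y v \<bullet> w)) (at y)"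
    by (rule has_derivative_transform_within_open[OF _ V y]) (rule gradient_inner)
  from frechet_derivative_at[OF this] show ?thesis by (metis pd_def)
qed

lemma hessian_symmetric: "y \<in> V \<Longrightarrow> hessian F y v \<bullet> w = v \<bullet> hessian F y w"
  using hessian_inner[of y v w] hessian_inner[of y w v] pd_commute[OF V _ F, of y v w]
  by (simp add: inner_commute)

end

text \<open>The length of the normal vector \<open>\<nu> - \<iota> (gradient F y)\<close> of the
  graph, equal to its volume density.\<close>

definition area :: "('a::euclidean_space \<Rightarrow> real) \<Rightarrow> 'a \<Rightarrow> real" where
  "area F y = sqrt (1 + gradient F y \<bullet> gradient F y)"

text \<open>The inverse square root of the metric \<open>I + q q\<^sup>T\<close>, \<open>q = gradient F y\<close>, of the graph of \<open>F\<close>.\<close>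

definition graph_frame :: "('a::euclidean_space \<Rightarrow> real) \<Rightarrow> 'a \<Rightarrow> 'a \<Rightarrow> 'a" where
  "graph_frame F y v =
    v - (1 / (area F y * (area F y + 1)) * (gradient F y \<bullet> v)) *\<^sub>R gradient F y"

text \<open>The shape operator of the graph in the orthonormal tangent frame given by \<open>graph_frame\<close>.\<close>

definition graph_shape :: "('a::euclidean_space \<Rightarrow> real) \<Rightarrow> 'a \<Rightarrow> 'a \<Rightarrow> 'a" where
  "graph_shape F y v = (1 / area F y) *\<^sub>R graph_frame F y (hessian F y (graph_frame F y v))"

lemma area_ge_1: "area F y \<ge> 1" by (simp add: area_def)

lemma area_squared: "(area F y)\<^sup>2 = 1 + gradient F y \<bullet> gradient F y"
  by (simp add: area_def)

lemma linear_graph_frame: "linear (graph_frame F y)"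
proof -
  obtain a where "graph_frame F y = (\<lambda>v. v - (a * (gradient F y \<bullet> v)) *\<^sub>R gradient F y)"
    unfolding graph_frame_def[abs_def] by blast
  then show ?thesis by (intro linearI) (simp_all add: inner_add_right algebra_simps)
qed

lemma graph_frame_symmetric: "graph_frame F y v \<bullet> w = v \<bullet> graph_frame F y w"
  by (simp add: graph_frame_def inner_diff_left inner_diff_right inner_commute)

text \<open>The squared length of the gradient is \<open>(area F y - 1) * (area F y + 1)\<close>, so
  along the gradient the frame has the factor \<open>1 - (area F y - 1) / area F y\<close>.
  Orthogonally to the gradient it is the identity.\<close>

lemma graph_frame_gradient:
  "graph_frame F y (gradient F y) = (1 / area F y) *\<^sub>R gradient F y"
proof -
  have "gradient F y \<bullet> gradient F y = (area F y - 1) * (area F y + 1)"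
    using area_squared[of F y] by (simp add: algebra_simps power2_eq_square)
  then have "1 - 1 / (area F y * (area F y + 1)) * (gradient F y \<bullet> gradient F y) = 1 / area F y"
    using area_ge_1[of F y] by (simp add: divide_simps)
  then show ?thesis
    by (simp add: graph_frame_def scaleR_left_diff_distrib[symmetric, of 1, simplified])
qed

text \<open>This justifies the name of inverse square root: the right side is the inverse of the
  metric I + q q^T by the Sherman-Morrison formula, as
  \<open>(area F y)\<^sup>2 = 1 + q \<bullet> q\<close>.\<close>

lemma graph_frame_twice:
  "graph_frame F y (graph_frame F y v) = v - ((gradient F y \<bullet> v) / (area F y)\<^sup>2) *\<^sub>R gradient F y"
proof -
  define a where "a = 1 / (area F y * (area F y + 1))"
  have W: "area F y > 0" using area_ge_1[of F y] by simp
  have *: "a + a * (1 / area F y) = 1 / (area F y)\<^sup>2"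
    using W by (simp add: a_def divide_simps power2_eq_square)
  have "graph_frame F y (graph_frame F y v)
      = graph_frame F y v - (a * (gradient F y \<bullet> v)) *\<^sub>R graph_frame F y (gradient F y)"
    by (subst (2) graph_frame_def)
      (simp add: linear_diff[OF linear_graph_frame] linear_scale[OF linear_graph_frame] a_def)
  also have "\<dots> = v - ((a + a * (1 / area F y)) * (gradient F y \<bullet> v)) *\<^sub>R gradient F y"
    unfolding graph_frame_gradient by (simp add: graph_frame_def a_def algebra_simps)
  finally show ?thesis unfolding * by simp
qed

lemma bij_graph_frame: "bij (graph_frame F y)"
proof -
  have "v = 0" if "graph_frame F y v = 0" for v
  proof -
    have "v = ((gradient F y \<bullet> v) / (area F y)\<^sup>2) *\<^sub>R gradient F y"
      using graph_frame_twice[of F y v] by (simp add: that linear_0[OF linear_graph_frame])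
    moreover have "(gradient F y \<bullet> v) / area F y = 0"
      using graph_frame_symmetric[of F y v "gradient F y"] that graph_frame_gradient[of F y]
      by (simp add: inner_commute)
    then have "gradient F y \<bullet> v = 0" using area_ge_1[of F y] by simp
    ultimately show "v = 0" by simp
  qed
  then have "inj (graph_frame F y)" by (simp add: linear_injective_0[OF linear_graph_frame])
  then show ?thesis using linear_injective_imp_surjective[OF linear_graph_frame] by (simp add: bij_def)
qed

context
  fixes F :: "'a::euclidean_space \<Rightarrow> real" and V :: "'a set" and y :: 'a
  assumes V: "open V" and F: "C_k_on 2 V F" and y: "y \<in> V"
begin

lemma linear_graph_shape: "linear (graph_shape F y)"
proof -
  have "linear (\<lambda>v. graph_frame F y (hessian F y (graph_frame F y v)))"
    using linear_compose[OF linear_compose[OF linear_graph_frame linear_hessian[OF V F y]] linear_graph_frame]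
    by (simp add: comp_def)
  then show ?thesis unfolding graph_shape_def[abs_def] by (rule linear_compose_scale_right)
qed

lemma graph_shape_inner:
  "graph_shape F y v \<bullet> w = (1 / area F y) * (hessian F y (graph_frame F y v) \<bullet> graph_frame F y w)"
  by (simp add: graph_shape_def graph_frame_symmetric)

lemma graph_shape_symmetric: "graph_shape F y v \<bullet> w = v \<bullet> graph_shape F y w"
  using hessian_symmetric[OF V F y, of "graph_frame F y v" "graph_frame F y w"]
  unfolding inner_commute[of v] graph_shape_inner by (simp add: inner_commute)

lemma hessian_gradient_inner:
  assumes E: "onb E"
  shows "gradient F y \<bullet> hessian F y v = (\<Sum>j\<in>E. pd j F y * pd v (pd j F) y)"
    and "gradient F y \<bullet> hessian F y (gradient F y)
      = (\<Sum>i\<in>E. \<Sum>j\<in>E. pd i F y * pd j F y * pd j (pd i F) y)"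
proof -
  have *: "gradient F y \<bullet> hessian F y v = (\<Sum>j\<in>E. pd j F y * pd v (pd j F) y)" for v
    unfolding onb_inner_sum[OF E, of "gradient F y" "hessian F y v"]
    by (simp add: gradient_inner[OF V F y] hessian_inner[OF V F y])
  then show "gradient F y \<bullet> hessian F y v = (\<Sum>j\<in>E. pd j F y * pd v (pd j F) y)" .
  have "gradient F y \<bullet> hessian F y (gradient F y)
      = (\<Sum>j\<in>E. pd j F y * (gradient F y \<bullet> hessian F y j))"
    unfolding onb_inner_sum[OF E, of "gradient F y" "hessian F y (gradient F y)"]
    by (simp add: gradient_inner[OF V F y] hessian_symmetric[OF V F y, of "gradient F y"])
  also have "\<dots> = (\<Sum>j\<in>E. \<Sum>i\<in>E. pd i F y * pd j F y * pd j (pd i F) y)"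
    by (simp add: * sum_distrib_left mult_ac)
  also have "\<dots> = (\<Sum>i\<in>E. \<Sum>j\<in>E. pd i F y * pd j F y * pd j (pd i F) y)" by (rule sum.swap)
  finally show "gradient F y \<bullet> hessian F y (gradient F y)
      = (\<Sum>i\<in>E. \<Sum>j\<in>E. pd i F y * pd j F y * pd j (pd i F) y)" .
qed

text \<open>The factor \<open>area F y\<close> clears the denominator. After expansion by
  \<open>hessian_gradient_inner\<close>, the right side is the summand of the inequality assumed in
  \<open>graph_second_variation\<close>.\<close>

lemma graph_shape_diagonal:
  defines "a \<equiv> 1 / (area F y * (area F y + 1))"
  shows "area F y * (graph_shape F y e \<bullet> e) = hessian F y e \<bullet> e
    - 2 * a * (gradient F y \<bullet> e) * (gradient F y \<bullet> hessian F y e)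
    + a\<^sup>2 * (gradient F y \<bullet> e)\<^sup>2 * (gradient F y \<bullet> hessian F y (gradient F y))"
proof -
  have W: "area F y > 0" using area_ge_1[of F y] by simp
  have K: "graph_frame F y e = e - (a * (gradient F y \<bullet> e)) *\<^sub>R gradient F y"
    by (simp add: graph_frame_def a_def)
  have "area F y * (graph_shape F y e \<bullet> e) = hessian F y (graph_frame F y e) \<bullet> graph_frame F y e"
    unfolding graph_shape_inner using W by simp
  also have "\<dots> = hessian F y e \<bullet> e
    - 2 * a * (gradient F y \<bullet> e) * (gradient F y \<bullet> hessian F y e)
    + a\<^sup>2 * (gradient F y \<bullet> e)\<^sup>2 * (gradient F y \<bullet> hessian F y (gradient F y))"
    using hessian_symmetric[OF V F y, of "gradient F y" e]
    by (simp add: K linear_diff[OF linear_hessian[OF V F y]]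
        linear_scale[OF linear_hessian[OF V F y]] inner_diff_left inner_diff_right
        power2_eq_square algebra_simps inner_commute)
  finally show ?thesis .
qed

text \<open>The trace depends on the frame only through its square, so
  \<open>2 * a - a\<^sup>2 * ((area F y)\<^sup>2 - 1)\<close> collapses to
  \<open>1 / (area F y)\<^sup>2\<close>. The result is the classical mean curvature operator of a
  graph.\<close>

lemma graph_shape_trace:
  assumes E: "onb E"
  shows "area F y * (\<Sum>e\<in>E. graph_shape F y e \<bullet> e) = (\<Sum>e\<in>E. pd e (pd e F) y)
    - (\<Sum>e\<in>E. \<Sum>f\<in>E. pd e F y * pd f F y * pd f (pd e F) y) / (area F y)\<^sup>2"
proof -
  define a where "a = 1 / (area F y * (area F y + 1))"
  define X where "X = gradient F y \<bullet> hessian F y (gradient F y)"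
  have W: "area F y \<ge> 1" by (rule area_ge_1)
  have t1: "(\<Sum>e\<in>E. (gradient F y \<bullet> e) * (gradient F y \<bullet> hessian F y e)) = X"
    unfolding X_def onb_inner_sum[OF E, of "gradient F y" "hessian F y (gradient F y)"]
    by (simp add: hessian_symmetric[OF V F y, of "gradient F y"])
  have t2: "(\<Sum>e\<in>E. (gradient F y \<bullet> e)\<^sup>2) = (area F y)\<^sup>2 - 1"
    unfolding area_squared onb_inner_sum[OF E, of "gradient F y" "gradient F y"]
    by (simp add: power2_eq_square)
  have t3: "area F y * (\<Sum>e\<in>E. graph_shape F y e \<bullet> e) = (\<Sum>e\<in>E. hessian F y e \<bullet> e)
      - 2 * a * (\<Sum>e\<in>E. (gradient F y \<bullet> e) * (gradient F y \<bullet> hessian F y e))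
      + a\<^sup>2 * (\<Sum>e\<in>E. (gradient F y \<bullet> e)\<^sup>2) * X"
    unfolding sum_distrib_left graph_shape_diagonal a_def[symmetric] X_def[symmetric]
    by (simp add: sum.distrib sum_subtractf sum_distrib_left sum_distrib_right mult.assoc)
  have "area F y * (\<Sum>e\<in>E. graph_shape F y e \<bullet> e) = (\<Sum>e\<in>E. hessian F y e \<bullet> e)
      - (2 * a - a\<^sup>2 * ((area F y)\<^sup>2 - 1)) * X"
    using t3 unfolding t1 t2 by (simp add: algebra_simps)
  also have "2 * a - a\<^sup>2 * ((area F y)\<^sup>2 - 1) = 1 / (area F y)\<^sup>2"
  proof -
    have "(area F y)\<^sup>2 - 1 = (area F y - 1) * (area F y + 1)"
      by (simp add: algebra_simps power2_eq_square)
    then show ?thesis using W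
      by (simp add: a_def power_divide power_mult_distrib divide_simps)
        (simp add: algebra_simps power2_eq_square)
  qed
  finally show ?thesis
    by (simp add: X_def hessian_gradient_inner(2)[OF E] hessian_inner[OF V F y])
qed

text \<open>\<open>A\<close> is the classical formula, inverse metric times Hessian over area, for
  the shape operator in the coordinates \<open>y\<close>, up to the sign \<open>\<epsilon>\<close>.
  The second claim conjugates it by \<open>graph_frame\<close> to the symmetric
  \<open>graph_shape\<close>. The third is the Weingarten equation, since
  \<open>\<iota> w + (gradient F y \<bullet> w) *\<^sub>R \<nu>\<close> is the differential of the
  graph at \<open>w\<close>.\<close>

lemma graph_normal_derivative:
  fixes \<iota> :: "'a \<Rightarrow> 'b::euclidean_space"
  assumes \<iota>: "linear \<iota>"
    and n: "\<And>u. u \<in> V \<Longrightarrow> n u = (\<epsilon> / area F u) *\<^sub>R (\<nu> - \<iota> (gradient F u))"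
  defines "A \<equiv> \<lambda>v. (\<epsilon> / area F y) *\<^sub>R graph_frame F y (graph_frame F y (hessian F y v))"
  shows "linear A" and "\<And>v. A (graph_frame F y v) = graph_frame F y (\<epsilon> *\<^sub>R graph_shape F y v)"
    and "\<And>v. \<iota> (A v) + (gradient F y \<bullet> A v) *\<^sub>R \<nu> = - fderiv n y v"
proof -
  let ?q = "gradient F" and ?W = "area F" and ?H = "hessian F y"
  have W: "?W y > 0" using area_ge_1[of F y] by simp
  have "linear (\<lambda>v. graph_frame F y (graph_frame F y (?H v)))"
    using linear_compose[OF linear_compose[OF linear_hessian[OF V F y] linear_graph_frame] linear_graph_frame]
    by (simp add: comp_def)
  then show "linear A" unfolding A_def by (rule linear_compose_scale_right)
  show "A (graph_frame F y v) = graph_frame F y (\<epsilon> *\<^sub>R graph_shape F y v)" for v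
    by (simp add: A_def graph_shape_def linear_scale[OF linear_graph_frame])
  have q: "(?q has_derivative ?H) (at y)" by (rule gradient_has_derivative[OF V F y])
  have dW: "(?W has_derivative (\<lambda>v. (?q y \<bullet> ?H v) / ?W y)) (at y)"
  proof -
    have "((\<lambda>u. 1 + ?q u \<bullet> ?q u) has_derivative (\<lambda>v. 0 + (?q y \<bullet> ?H v + ?H v \<bullet> ?q y))) (at y)"
      by (intro has_derivative_add has_derivative_const has_derivative_inner q)
    moreover have "1 + ?q y \<bullet> ?q y > 0" by (simp add: add_pos_nonneg)
    ultimately have "((\<lambda>u. sqrt (1 + ?q u \<bullet> ?q u)) has_derivative
        (\<lambda>v. (0 + (?q y \<bullet> ?H v + ?H v \<bullet> ?q y)) * (inverse (sqrt (1 + ?q y \<bullet> ?q y)) / 2))) (at y)"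
      by (intro has_derivative_real_sqrt) (auto simp: mult_ac)
    then show ?thesis
      by (simp add: area_def[abs_def] inner_commute field_simps)
  qed
  have "((\<lambda>u. (\<epsilon> / ?W u) *\<^sub>R (\<nu> - \<iota> (?q u))) has_derivative
    (\<lambda>v. (\<epsilon> / ?W y) *\<^sub>R (0 - \<iota> (?H v)) + (- (\<epsilon> * ((?q y \<bullet> ?H v) / ?W y)) / (?W y * ?W y)) *\<^sub>R (\<nu> - \<iota> (?q y)))) (at y)"
  proof (intro has_derivative_scaleR has_derivative_diff has_derivative_const
      bounded_linear.has_derivative[OF linear_linear[THEN iffD2, OF \<iota>]] q)
    show "((\<lambda>u. \<epsilon> / ?W u) has_derivative (\<lambda>v. - (\<epsilon> * ((?q y \<bullet> ?H v) / ?W y)) / (?W y * ?W y))) (at y)"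
      using has_derivative_divide[OF has_derivative_const dW, of \<epsilon>] W
      by (simp add: field_simps)
  qed
  then have "(n has_derivative
    (\<lambda>v. (\<epsilon> / ?W y) *\<^sub>R (0 - \<iota> (?H v)) + (- (\<epsilon> * ((?q y \<bullet> ?H v) / ?W y)) / (?W y * ?W y)) *\<^sub>R (\<nu> - \<iota> (?q y)))) (at y)"
    by (rule has_derivative_transform_within_open[OF _ V y]) (simp add: n)
  from frechet_derivative_at[OF this]
  have dn: "fderiv n y v = (\<epsilon> / ?W y) *\<^sub>R (0 - \<iota> (?H v))
      + (- (\<epsilon> * ((?q y \<bullet> ?H v) / ?W y)) / (?W y * ?W y)) *\<^sub>R (\<nu> - \<iota> (?q y))" for v
    by (metis (no_types, lifting))
  show "\<iota> (A v) + (?q y \<bullet> A v) *\<^sub>R \<nu> = - fderiv n y v" for v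
  proof -
    define c where "c = ?q y \<bullet> ?H v"
    have Av: "A v = (\<epsilon> / ?W y) *\<^sub>R ?H v - (\<epsilon> * c / (?W y) ^ 3) *\<^sub>R ?q y"
      by (simp add: A_def graph_frame_twice c_def scaleR_right_diff_distrib power2_eq_square power3_eq_cube)
    have "?q y \<bullet> A v = \<epsilon> / ?W y * c - \<epsilon> * c / (?W y) ^ 3 * ((?W y)\<^sup>2 - 1)"
      by (simp add: Av inner_diff_right c_def area_squared)
    also have "\<dots> = \<epsilon> * c / (?W y) ^ 3"
      using W by (simp add: field_simps power2_eq_square power3_eq_cube)
    finally have qA: "?q y \<bullet> A v = \<epsilon> * c / (?W y) ^ 3" .
    have "\<iota> (A v) = (\<epsilon> / ?W y) *\<^sub>R \<iota> (?H v) - (\<epsilon> * c / (?W y) ^ 3) *\<^sub>R \<iota> (?q y)"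
      by (simp add: Av linear_diff[OF \<iota>] linear_scale[OF \<iota>])
    then show ?thesis
      unfolding dn qA c_def[symmetric]
      by (simp add: power3_eq_cube scaleR_right_diff_distrib mult.assoc)
  qed
qed

end

section \<open>Local graph representation of a hypersurface\<close>

lemma smooth_on_C: "smooth_on S f \<Longrightarrow> C_k_on k S f"
  by (simp add: smooth_on_def)

lemma smooth_on_has_derivative:
  "smooth_on S f \<Longrightarrow> u \<in> S \<Longrightarrow> (f has_derivative fderiv f u) (at u)"
  by (rule C_k_on_SucD(1)[OF smooth_on_C])

lemma frechet_derivative_compose:
  assumes "smooth_on S g" "u \<in> S" "smooth_on T f" "g u \<in> T"
  shows "((f \<circ> g) has_derivative fderiv f (g u) \<circ> fderiv g u) (at u)"
  by (intro diff_chain_at smooth_on_has_derivative[OF assms(1,2)] smooth_on_has_derivative[OF assms(3,4)])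

lemma chart_props:
  assumes "smooth_atlas M \<A>" "(U, \<phi>) \<in> \<A>"
  shows "U \<subseteq> M" "openin (top_of_set M) U" "open (\<phi> ` U)"
    "homeomorphism U (\<phi> ` U) \<phi> (inv_into U \<phi>)"
  using assms by (auto simp: smooth_atlas_def is_chart_def openin_imp_subset dest: bspec)

lemma open_chart_image:
  assumes "smooth_atlas M \<A>" "(U, \<phi>) \<in> \<A>" "openin (top_of_set M) W"
  shows "open (\<phi> ` (U \<inter> W))"
proof -
  note c = chart_props[OF assms(1,2)]
  have "openin (top_of_set U) (U \<inter> W)"
    using assms(3) c(1) by (metis inf.commute openin_subtopology_Int_subset subset_refl inf_absorb2
        openin_Int_open openin_open inf_assoc)
  then have "openin (top_of_set (\<phi> ` U)) (\<phi> ` (U \<inter> W))"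
    using homeomorphism_imp_open_map[OF c(4)] by blast
  then show ?thesis using c(3) openin_open_trans by blast
qed

lemma chart_at_props:
  assumes "smooth_atlas M \<A>" "q \<in> M" "chart_at \<A> q = (U, \<phi>)"
  shows "(U, \<phi>) \<in> \<A>" "q \<in> U"
proof -
  have "\<exists>c. c \<in> \<A> \<and> q \<in> fst c" using assms(1,2) by (fastforce simp: smooth_atlas_def)
  from someI_ex[OF this] show "(U, \<phi>) \<in> \<A>" "q \<in> U"
    using assms(3) by (auto simp: chart_at_def)
qed

text \<open>\<open>T\<close> is the derivative at \<open>\<phi> q\<close> of the transition map to
  the chart chosen by \<open>chart_at\<close>. It does not depend on \<open>f\<close>, so one
  \<open>T\<close> relates the differentials of both \<open>x\<close> and \<open>N\<close>.\<close>

lemma differential_chart: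
  fixes \<A> :: "('m::t2_space, 'a::euclidean_space) chart set"
  assumes M: "smooth_atlas M \<A>" and c: "(U, \<phi>) \<in> \<A>" and q: "q \<in> U"
  obtains T :: "'a \<Rightarrow> 'a" where "linear T" "bij T"
    "\<And>f :: 'm \<Rightarrow> 'b::euclidean_space. smooth_map \<A> f \<Longrightarrow>
      (\<lambda>v. differential \<A> f q (T v)) = fderiv (f \<circ> inv_into U \<phi>) (\<phi> q)"
proof -
  obtain U' \<phi>' where c': "chart_at \<A> q = (U', \<phi>')" by force
  have qM: "q \<in> M" using chart_props(1)[OF M c] q by blast
  note c'A = chart_at_props[OF M qM c']
  note p = chart_props[OF M c] and p' = chart_props[OF M c'A(1)]
  define \<tau> where "\<tau> = \<phi>' \<circ> inv_into U \<phi>"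
  define \<sigma> where "\<sigma> = \<phi> \<circ> inv_into U' \<phi>'"
  let ?S = "\<phi> ` (U \<inter> U')" and ?S' = "\<phi>' ` (U' \<inter> U)"
  have \<tau>: "smooth_on ?S \<tau>" and \<sigma>: "smooth_on ?S' \<sigma>"
    using M c c'A(1) unfolding smooth_atlas_def \<tau>_def \<sigma>_def by blast+
  have inv: "inv_into U \<phi> (\<phi> x) = x" if "x \<in> U" for x
    using p(4) that by (simp add: homeomorphism_def)
  have inv': "inv_into U' \<phi>' (\<phi>' x) = x" if "x \<in> U'" for x
    using p'(4) that by (simp add: homeomorphism_def)
  have u: "\<phi> q \<in> ?S" "\<phi>' q \<in> ?S'" using q c'A(2) by auto
  have \<tau>q: "\<tau> (\<phi> q) = \<phi>' q" and \<sigma>q: "\<sigma> (\<phi>' q) = \<phi> q"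
    using inv[OF q] inv'[OF c'A(2)] by (auto simp: \<tau>_def \<sigma>_def)
  have op: "open ?S" "open ?S'"
    using open_chart_image[OF M c p'(2)] open_chart_image[OF M c'A(1) p(2)] by auto
  define T where "T = fderiv \<tau> (\<phi> q)"
  define T' where "T' = fderiv \<sigma> (\<phi>' q)"
  have lin: "linear T"
    using smooth_on_has_derivative[OF \<tau> u(1)] has_derivative_linear by (auto simp: T_def)
  have "(\<sigma> \<circ> \<tau> has_derivative T' \<circ> T) (at (\<phi> q))"
    using frechet_derivative_compose[OF \<tau> u(1) \<sigma>] \<tau>q u(2) by (simp add: T_def T'_def)
  then have "((\<lambda>x. x) has_derivative T' \<circ> T) (at (\<phi> q))"
    by (rule has_derivative_transform_within_open[OF _ op(1) u(1)])
      (auto simp: \<tau>_def \<sigma>_def inv inv')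
  then have TT: "T' \<circ> T = id"
    using has_derivative_unique[OF has_derivative_ident] by (metis eq_id_iff)
  have "(\<tau> \<circ> \<sigma> has_derivative T \<circ> T') (at (\<phi>' q))"
    using frechet_derivative_compose[OF \<sigma> u(2) \<tau>] \<sigma>q u(1) by (simp add: T_def T'_def)
  then have "((\<lambda>x. x) has_derivative T \<circ> T') (at (\<phi>' q))"
    by (rule has_derivative_transform_within_open[OF _ op(2) u(2)])
      (auto simp: \<tau>_def \<sigma>_def inv inv')
  then have TT': "T \<circ> T' = id"
    using has_derivative_unique[OF has_derivative_ident] by (metis eq_id_iff)
  show thesis
  proof (rule that[OF lin o_bij[OF TT TT']])
    fix f :: "'m \<Rightarrow> 'b" assume f: "smooth_map \<A> f"
    have f': "smooth_on (\<phi>' ` U') (f \<circ> inv_into U' \<phi>')"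
      using f c'A(1) by (auto simp: smooth_map_def)
    have "((f \<circ> inv_into U' \<phi>') \<circ> \<tau> has_derivative
        fderiv (f \<circ> inv_into U' \<phi>') (\<tau> (\<phi> q)) \<circ> T) (at (\<phi> q))"
      unfolding T_def by (rule frechet_derivative_compose[OF \<tau> u(1) f']) (use \<tau>q c'A(2) in simp)
    then have "(f \<circ> inv_into U \<phi> has_derivative
        fderiv (f \<circ> inv_into U' \<phi>') (\<phi>' q) \<circ> T) (at (\<phi> q))"
      unfolding \<tau>q
      by (rule has_derivative_transform_within_open[OF _ op(1) u(1)])
        (auto simp: \<tau>_def inv inv')
    from frechet_derivative_at[OF this]
    show "(\<lambda>v. differential \<A> f q (T v)) = fderiv (f \<circ> inv_into U \<phi>) (\<phi> q)"
      by (simp add: differential_def c' comp_def)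
  qed
qed

text \<open>\<open>\<iota>\<close> identifies the model space with the hyperplane orthogonal to
  \<open>\<nu>\<close>; its adjoint \<open>J\<close> is the orthogonal projection, read in the model
  space.\<close>

lemma hyperplane_isometry:
  fixes \<nu> :: "'b::euclidean_space"
  assumes "DIM('b) = DIM('a) + 1" "norm \<nu> = 1"
  obtains \<iota> :: "'a::euclidean_space \<Rightarrow> 'b" and J :: "'b \<Rightarrow> 'a" where "linear \<iota>" "linear J"
    "\<And>v w. \<iota> v \<bullet> \<iota> w = v \<bullet> w" "\<And>v. \<iota> v \<bullet> \<nu> = 0" "\<And>v. J (\<iota> v) = v" "J \<nu> = 0"
    "\<And>z. z = \<iota> (J z) + (z \<bullet> \<nu>) *\<^sub>R \<nu>" "\<And>z v. z \<bullet> \<iota> v = J z \<bullet> v"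
proof -
  have \<nu>: "\<nu> \<noteq> 0" "\<nu> \<bullet> \<nu> = 1" using assms(2) by (auto simp: norm_eq_1)
  have "dim (UNIV :: 'a set) = dim {z. \<nu> \<bullet> z = 0}"
    using dim_hyperplane[OF \<nu>(1)] assms(1) by simp
  then obtain \<iota> :: "'a \<Rightarrow> 'b" and g where g: "linear \<iota>" "\<iota> ` UNIV = {z. \<nu> \<bullet> z = 0}"
    "\<And>v. norm (\<iota> v) = norm v"
    using isometries_subspaces[OF subspace_UNIV subspace_hyperplane[of \<nu>]] by (metis UNIV_I)
  have inner: "\<iota> v \<bullet> \<iota> w = v \<bullet> w" for v w
    using g(3)[of "v + w"] g(3)[of v] g(3)[of w]
    by (simp add: dot_norm linear_add[OF g(1), symmetric])
  have orth: "\<iota> v \<bullet> \<nu> = 0" for v using g(2) by (auto simp: inner_commute)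
  define J where "J z = (\<Sum>b\<in>Basis. (z \<bullet> \<iota> b) *\<^sub>R b)" for z
  have J: "z \<bullet> \<iota> v = J z \<bullet> v" for z v
  proof -
    have "z \<bullet> \<iota> v = (\<Sum>b\<in>Basis. (v \<bullet> b) * (z \<bullet> \<iota> b))"
      by (subst linear_sum_Basis[OF g(1)]) (simp add: inner_sum_right)
    then show ?thesis by (simp add: J_def inner_sum_left mult.commute inner_commute[of v])
  qed
  have linJ: "linear J"
    by (rule linearI) (simp_all add: J_def inner_add_left scaleR_left_distrib sum.distrib scaleR_sum_right)
  have J\<iota>: "J (\<iota> v) = v" for v
    by (rule vector_eq_rdot[THEN iffD1]) (simp add: J[symmetric] inner)
  have J\<nu>: "J \<nu> = 0"
    by (rule vector_eq_rdot[THEN iffD1]) (simp add: J[symmetric] orth inner_commute[of \<nu>])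
  have decomp: "z = \<iota> (J z) + (z \<bullet> \<nu>) *\<^sub>R \<nu>" for z
  proof -
    have "z - (z \<bullet> \<nu>) *\<^sub>R \<nu> \<in> {z. \<nu> \<bullet> z = 0}"
      using \<nu>(2) by (simp add: inner_diff_right inner_commute)
    then obtain v where v: "z - (z \<bullet> \<nu>) *\<^sub>R \<nu> = \<iota> v" using g(2) by blast
    then have "J z = v"
      using J\<iota>[of v] by (metis J\<nu> diff_add_cancel linJ linear_add linear_scale scaleR_zero_right add_0_right)
    then show ?thesis using v by (simp add: algebra_simps)
  qed
  show thesis by (rule that[OF g(1) linJ inner orth J\<iota> J\<nu> decomp J])
qed

text \<open>The projection of \<open>x\<close> to the tangent plane at \<open>p\<close>, read in a
  chart, is a local diffeomorphism: the differential at \<open>p\<close> is injective with values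
  orthogonal to \<open>\<nu>\<close>. The map \<open>\<psi>\<close> inverts this projection. The
  last conclusion ties the new parameter to \<open>differential\<close>, with one \<open>T\<close>
  for all maps.\<close>

theorem local_graph:
  fixes M :: "'m::t2_space set" and \<A> :: "('m, 'a::euclidean_space) chart set"
    and x :: "'m \<Rightarrow> 'b::euclidean_space"
  assumes dim: "DIM('b) = DIM('a) + 1" and M: "smooth_atlas M \<A>"
    and imm: "immersion M \<A> x" and p: "p \<in> M"
    and \<nu>: "norm \<nu> = 1" "\<And>v. differential \<A> x p v \<bullet> \<nu> = 0"
  obtains \<iota> :: "'a \<Rightarrow> 'b" and J :: "'b \<Rightarrow> 'a" and e :: real and \<psi> :: "'a \<Rightarrow> 'm"
  where "linear \<iota>" "linear J"
    "\<And>v w. \<iota> v \<bullet> \<iota> w = v \<bullet> w" "\<And>v. \<iota> v \<bullet> \<nu> = 0" "\<And>v. J (\<iota> v) = v" "J \<nu> = 0"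
    "\<And>z. z = \<iota> (J z) + (z \<bullet> \<nu>) *\<^sub>R \<nu>" "\<And>z v. z \<bullet> \<iota> v = J z \<bullet> v"
    "e > 0" "\<psi> 0 = p" "\<psi> ` ball 0 e \<subseteq> M" "continuous_on (ball 0 e) \<psi>"
    "\<And>W. open W \<Longrightarrow> W \<subseteq> ball 0 e \<Longrightarrow> openin (top_of_set M) (\<psi> ` W)"
    "\<And>y. y \<in> ball 0 e \<Longrightarrow> J (x (\<psi> y) - x p) = y"
    "\<And>f :: 'm \<Rightarrow> 'b. smooth_map \<A> f \<Longrightarrow> smooth_on (ball 0 e) (f \<circ> \<psi>)"
    "\<And>y. y \<in> ball 0 e \<Longrightarrow> \<exists>T. linear T \<and> bij T \<and> (\<forall>f :: 'm \<Rightarrow> 'b. smooth_map \<A> f \<longrightarrow>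
      (\<lambda>v. differential \<A> f (\<psi> y) (T v)) = fderiv (f \<circ> \<psi>) y)"
proof -
  obtain U \<phi> where c: "(U, \<phi>) \<in> \<A>" and pU: "p \<in> U"
    using M p unfolding smooth_atlas_def by blast
  note ch = chart_props[OF M c]
  have x: "smooth_map \<A> x" and inj: "inj (differential \<A> x p)"
    using imm p by (auto simp: immersion_def)
  obtain \<iota> :: "'a \<Rightarrow> 'b" and J :: "'b \<Rightarrow> 'a" where I: "linear \<iota>" "linear J"
    "\<And>v w. \<iota> v \<bullet> \<iota> w = v \<bullet> w" "\<And>v. \<iota> v \<bullet> \<nu> = 0" "\<And>v. J (\<iota> v) = v" "J \<nu> = 0"
    "\<And>z. z = \<iota> (J z) + (z \<bullet> \<nu>) *\<^sub>R \<nu>" "\<And>z v. z \<bullet> \<iota> v = J z \<bullet> v"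
    using hyperplane_isometry[OF dim \<nu>(1)] by blast
  have blJ: "bounded_linear J" using I(2) linear_linear by blast
  define \<Omega> where "\<Omega> = \<phi> ` U"
  have op: "open \<Omega>" and u0: "\<phi> p \<in> \<Omega>" using ch(3) pU by (auto simp: \<Omega>_def)
  have smooth: "smooth_on \<Omega> (f \<circ> inv_into U \<phi>)" if "smooth_map \<A> f" for f :: "'m \<Rightarrow> 'b"
    using that c by (auto simp: smooth_map_def \<Omega>_def)
  define X where "X = x \<circ> inv_into U \<phi>"
  have X: "smooth_on \<Omega> X" using smooth[OF x] by (simp add: X_def)
  have invp: "inv_into U \<phi> (\<phi> p) = p" using ch(4) pU by (simp add: homeomorphism_def)
  define Y where "Y u = J (X u + (- x p))" for u
  have Y: "smooth_on \<Omega> Y"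
    unfolding smooth_on_def Y_def
    by (intro allI C_k_on_bounded_linear[OF blJ op] C_k_on_add C_k_on_const op smooth_on_C X)
  have dY: "(Y has_derivative (\<lambda>v. J (fderiv X u v))) (at u)" if "u \<in> \<Omega>" for u
  proof -
    have "((\<lambda>u. X u + (- x p)) has_derivative (\<lambda>v. fderiv X u v + 0)) (at u)"
      by (intro has_derivative_add has_derivative_const smooth_on_has_derivative[OF X that])
    from bounded_linear.has_derivative[OF blJ this] show ?thesis by (simp add: Y_def[abs_def])
  qed
  obtain T0 where T0: "linear T0" "bij T0"
    "\<And>f :: 'm \<Rightarrow> 'b. smooth_map \<A> f \<Longrightarrow>
      (\<lambda>v. differential \<A> f p (T0 v)) = fderiv (f \<circ> inv_into U \<phi>) (\<phi> p)"
    using differential_chart[OF M c pU, where ?'b = 'b] by blast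
  have DX: "fderiv X (\<phi> p) = (\<lambda>v. differential \<A> x p (T0 v))"
    using T0(3)[OF x] by (simp add: X_def)
  have "inj (fderiv Y (\<phi> p))"
  proof -
    have Y': "fderiv Y (\<phi> p) = (\<lambda>v. J (differential \<A> x p (T0 v)))"
      using frechet_derivative_at[OF dY[OF u0]] DX by simp
    have "differential \<A> x p (T0 v) = \<iota> (J (differential \<A> x p (T0 v)))" for v
      using I(7)[of "differential \<A> x p (T0 v)"] \<nu>(2) by simp
    then show ?thesis
      unfolding Y' by (intro injI) (metis inj T0(2) bij_is_inj injD)
  qed
  from smooth_local_inverse[OF op u0 Y this]
  obtain U1 V1 g where g: "open U1" "U1 \<subseteq> \<Omega>" "\<phi> p \<in> U1" "open V1" "Y (\<phi> p) \<in> V1"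
    "homeomorphism U1 V1 Y g" "smooth_on V1 g"
    "\<And>y. y \<in> V1 \<Longrightarrow> (g has_derivative inv (fderiv Y (g y))) (at y)"
    "\<And>y. y \<in> V1 \<Longrightarrow> bij (fderiv Y (g y))" by metis
  have Y0: "Y (\<phi> p) = 0" using I(2) by (simp add: Y_def X_def invp linear_0)
  obtain e where e: "e > 0" "ball 0 e \<subseteq> V1"
    using g(4,5) Y0 openE by metis
  have "g ` V1 = U1" "\<And>y. y \<in> V1 \<Longrightarrow> Y (g y) = y" using g(6) by (auto simp: homeomorphism_def)
  then have gV: "g y \<in> U1" "g y \<in> \<Omega>" "Y (g y) = y" if "y \<in> ball 0 e" for y
    using that e(2) g(2) by blast+
  have g0: "g 0 = \<phi> p" using g(3,6) Y0 by (metis homeomorphism_apply1)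
  define \<psi> where "\<psi> = inv_into U \<phi> \<circ> g"
  have g_sm: "smooth_on (ball 0 e) g"
    using g(7) e(2) by (auto simp: smooth_on_def intro: C_k_on_subset)
  have cont_inv: "continuous_on \<Omega> (inv_into U \<phi>)" and inv_im: "inv_into U \<phi> ` \<Omega> = U"
    using ch(4) by (auto simp: homeomorphism_def \<Omega>_def)
  have cont_g: "continuous_on (ball 0 e) g"
    using smooth_on_C[OF g_sm, of 0] by simp
  have gim: "g ` ball 0 e \<subseteq> \<Omega>" using gV by auto
  show thesis
  proof (rule that[OF I])
    show "e > 0" by (rule e(1))
    show "\<psi> 0 = p" by (simp add: \<psi>_def g0 invp)
    show "\<psi> ` ball 0 e \<subseteq> M" using gV(2) inv_im ch(1) by (auto simp: \<psi>_def)
    show "continuous_on (ball 0 e) \<psi>"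
      unfolding \<psi>_def by (intro continuous_on_compose cont_g continuous_on_subset[OF cont_inv gim])
    show "openin (top_of_set M) (\<psi> ` W)" if W: "open W" "W \<subseteq> ball 0 e" for W
    proof -
      have "openin (top_of_set V1) W" using W e(2) by (metis open_subset subset_trans)
      then have "openin (top_of_set U1) (g ` W)"
        using homeomorphism_imp_open_map[OF homeomorphism_sym[THEN iffD1, OF g(6)]] by blast
      then have "open (g ` W)" using g(1) openin_open_trans by blast
      then have "openin (top_of_set (\<phi> ` U)) (g ` W)"
        using gV(2) W(2) by (intro open_subset) (auto simp: \<Omega>_def)
      then have "openin (top_of_set U) (inv_into U \<phi> ` g ` W)"
        using homeomorphism_imp_open_map[OF homeomorphism_sym[THEN iffD1, OF ch(4)]] by blast
      then show ?thesis using ch(2) openin_trans by (auto simp: \<psi>_def image_comp)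
    qed
    show "J (x (\<psi> y) - x p) = y" if "y \<in> ball 0 e" for y
      using gV(3)[OF that] by (simp add: Y_def X_def \<psi>_def)
    show "smooth_on (ball 0 e) (f \<circ> \<psi>)" if f: "smooth_map \<A> f" for f :: "'m \<Rightarrow> 'b"
      unfolding smooth_on_def \<psi>_def comp_assoc[symmetric]
      by (intro allI C_k_on_compose[OF open_ball op gim] smooth_on_C g_sm smooth f)
    show "\<exists>T. linear T \<and> bij T \<and> (\<forall>f :: 'm \<Rightarrow> 'b. smooth_map \<A> f \<longrightarrow>
      (\<lambda>v. differential \<A> f (\<psi> y) (T v)) = fderiv (f \<circ> \<psi>) y)"
      if y: "y \<in> ball 0 e" for y
    proof -
      have q: "\<psi> y \<in> U" using inv_im gV(2)[OF y] by (auto simp: \<psi>_def)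
      have \<phi>q: "\<phi> (\<psi> y) = g y"
        using ch(4) gV(2)[OF y] by (auto simp: \<psi>_def \<Omega>_def homeomorphism_def)
      obtain T1 where T1: "linear T1" "bij T1"
        "\<And>f :: 'm \<Rightarrow> 'b. smooth_map \<A> f \<Longrightarrow>
          (\<lambda>v. differential \<A> f (\<psi> y) (T1 v)) = fderiv (f \<circ> inv_into U \<phi>) (\<phi> (\<psi> y))"
        using differential_chart[OF M c q, where ?'b = 'b] by blast
      define G where "G = fderiv g y"
      have yV1: "y \<in> V1" using y e(2) by blast
      have "G = inv (fderiv Y (g y))"
        unfolding G_def using frechet_derivative_at[OF g(8)[OF yV1]] by simp
      then have "bij G" using g(9)[OF yV1] by (simp add: bij_imp_bij_inv)
      moreover have "linear G"
        using smooth_on_has_derivative[OF g_sm y] has_derivative_linear by (auto simp: G_def)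
      moreover have "(\<lambda>v. differential \<A> f (\<psi> y) ((T1 \<circ> G) v)) = fderiv (f \<circ> \<psi>) y"
        if f: "smooth_map \<A> f" for f :: "'m \<Rightarrow> 'b"
      proof -
        have "(f \<circ> inv_into U \<phi> \<circ> g has_derivative
            fderiv (f \<circ> inv_into U \<phi>) (g y) \<circ> G) (at y)"
          unfolding G_def by (rule frechet_derivative_compose[OF g_sm y smooth[OF f] gV(2)[OF y]])
        from frechet_derivative_at[OF this] T1(3)[OF f]
        show ?thesis by (simp add: \<psi>_def[symmetric] comp_assoc \<phi>q fun_eq_iff)
      qed
      ultimately show ?thesis
        using T1(1,2) by (intro exI[of _ "T1 \<circ> G"]) (auto simp: linear_compose bij_comp)
    qed
  qed
qed

section \<open>Points at maximal distance from the origin\<close>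

text \<open>The derivative of \<open>x \<bullet> x\<close> vanishes at a maximum. If the maximum is
  0, then \<open>x\<close> is constant, which will contradict the injectivity of its
  differential.\<close>

lemma smooth_map_max_orthogonal:
  fixes M :: "'m::t2_space set" and \<A> :: "('m, 'a::euclidean_space) chart set"
    and x :: "'m \<Rightarrow> 'b::euclidean_space"
  assumes M: "smooth_atlas M \<A>" and x: "smooth_map \<A> x" and p: "p \<in> M"
    and max: "\<And>q. q \<in> M \<Longrightarrow> norm (x q) \<le> norm (x p)"
  shows "differential \<A> x p v \<bullet> x p = 0"
    and "x p = 0 \<Longrightarrow> differential \<A> x p v = 0"
proof -
  obtain U \<phi> where c: "chart_at \<A> p = (U, \<phi>)" by force
  note cA = chart_at_props[OF M p c]
  note ch = chart_props[OF M cA(1)]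
  define X where "X = x \<circ> inv_into U \<phi>"
  have X: "smooth_on (\<phi> ` U) X" using x cA(1) by (auto simp: smooth_map_def X_def)
  have u0: "\<phi> p \<in> \<phi> ` U" using cA(2) by blast
  have Xp: "X (\<phi> p) = x p" using ch(4) cA(2) by (simp add: X_def homeomorphism_def)
  have le: "norm (X u) \<le> norm (x p)" if "u \<in> \<phi> ` U" for u
  proof -
    have "inv_into U \<phi> u \<in> M" using that ch(1) inv_into_into[of u \<phi> U] by blast
    then show ?thesis using max by (simp add: X_def)
  qed
  have D: "differential \<A> x p = fderiv X (\<phi> p)"
    by (simp add: differential_def c X_def)
  have der: "(X has_derivative fderiv X (\<phi> p)) (at (\<phi> p))"
    by (rule smooth_on_has_derivative[OF X u0])
  have "((\<lambda>u. X u \<bullet> X u) has_derivative (\<lambda>v. X (\<phi> p) \<bullet> fderiv X (\<phi> p) v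
      + fderiv X (\<phi> p) v \<bullet> X (\<phi> p))) (at (\<phi> p))"
    by (rule has_derivative_inner[OF der der])
  moreover have "\<forall>u\<in>\<phi> ` U. X u \<bullet> X u \<le> X (\<phi> p) \<bullet> X (\<phi> p)"
    using le Xp by (simp add: power2_norm_eq_inner[symmetric] power_mono)
  ultimately have "(\<lambda>v. X (\<phi> p) \<bullet> fderiv X (\<phi> p) v
      + fderiv X (\<phi> p) v \<bullet> X (\<phi> p)) = (\<lambda>v. 0)"
    using differential_zero_maxmin[OF u0 ch(3)] by blast
  then have "X (\<phi> p) \<bullet> fderiv X (\<phi> p) v
      + fderiv X (\<phi> p) v \<bullet> X (\<phi> p) = 0" by meson
  then show "differential \<A> x p v \<bullet> x p = 0"
    by (simp add: D Xp inner_commute)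
  show "differential \<A> x p v = 0" if "x p = 0"
  proof -
    have "((\<lambda>u. 0) has_derivative fderiv X (\<phi> p)) (at (\<phi> p))"
      by (rule has_derivative_transform_within_open[OF der ch(3) u0]) (use le that in simp)
    then show ?thesis
      using has_derivative_unique[OF _ has_derivative_const] D by metis
  qed
qed

lemma S_curv_eq_esym:
  fixes B :: "'a::euclidean_space \<Rightarrow> 'a"
  assumes "eigenvalues (shape_operator \<A> x N q) = eigenvalues B" "linear B" "onb G"
    "\<And>g. g \<in> G \<Longrightarrow> B g = l g *\<^sub>R g"
  shows "S_curv \<A> x N k q = esym k G l"
proof -
  obtain b where b: "bij_betw b G (eigenvalues B)" "\<And>g. g \<in> G \<Longrightarrow> fst (b g) = l g"
    using eigenvalues_bij_betw[OF assms(2,3)] assms(4) by metis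
  have "(\<lambda>(\<kappa>::real, j::nat). \<kappa>) = fst" by (simp add: fun_eq_iff)
  then have "S_curv \<A> x N k q = esym k (eigenvalues B) fst"
    by (simp add: S_curv_def esym_def assms(1))
  then show ?thesis using esym_bij_betw[OF b(1), of fst l k] b(2) by simp
qed

text \<open>\<open>\<nu>\<close> points from \<open>x p\<close> towards the origin, which will make
  the Hessian of \<open>F\<close> at 0 positive. The given \<open>N\<close> may point either way,
  and \<open>\<epsilon>\<close> records this. On an immersion into a sphere every point is a maximum
  point, so the same chart also serves \<open>spherical_local_homeomorphism\<close>.\<close>

theorem graph_at_maximum:
  fixes M :: "'m::t2_space set" and \<A> :: "('m, 'a::euclidean_space) chart set"
    and x N :: "'m \<Rightarrow> 'b::euclidean_space"
  assumes dim: "DIM('b) = DIM('a) + 1" and M: "smooth_atlas M \<A>"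
    and imm: "immersion M \<A> x" and nor: "unit_normal_field M \<A> x N" and p: "p \<in> M"
    and max: "\<And>q. q \<in> M \<Longrightarrow> norm (x q) \<le> norm (x p)"
  obtains J :: "'b \<Rightarrow> 'a" and \<nu> :: 'b and \<iota> :: "'a \<Rightarrow> 'b" and e :: real and \<psi> :: "'a \<Rightarrow> 'm"
    and F :: "'a \<Rightarrow> real" and \<epsilon> :: real
  where "norm (x p) > 0" "linear J" "J \<nu> = 0"
    "\<And>y z. norm (\<iota> y + z *\<^sub>R \<nu>) ^ 2 = y \<bullet> y + z\<^sup>2" "\<And>y. J (\<iota> y) = y"
    "\<And>z. z = \<iota> (J z) + (z \<bullet> \<nu>) *\<^sub>R \<nu>"
    "e > 0" "\<psi> 0 = p" "\<psi> ` ball 0 e \<subseteq> M" "continuous_on (ball 0 e) \<psi>"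
    "\<And>W. open W \<Longrightarrow> W \<subseteq> ball 0 e \<Longrightarrow> openin (top_of_set M) (\<psi> ` W)"
    "smooth_on (ball 0 e) F" "F 0 = - norm (x p)" "\<And>v. pd v F 0 = 0"
    "\<And>y. y \<in> ball 0 e \<Longrightarrow> x (\<psi> y) = \<iota> y + F y *\<^sub>R \<nu>"
    "\<epsilon> = 1 \<or> \<epsilon> = - 1"
    "\<And>y. y \<in> ball 0 e \<Longrightarrow> area F y * (x (\<psi> y) \<bullet> N (\<psi> y)) = \<epsilon> * (F y - y \<bullet> gradient F y)"
    "\<And>y G l k. y \<in> ball 0 e \<Longrightarrow> onb G \<Longrightarrow> (\<And>g. g \<in> G \<Longrightarrow> graph_shape F y g = l g *\<^sub>R g) \<Longrightarrow>
        S_curv \<A> x N k (\<psi> y) = \<epsilon> ^ k * esym k G l"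
proof -
  have x: "smooth_map \<A> x" and inj: "\<And>q. q \<in> M \<Longrightarrow> inj (differential \<A> x q)"
    using imm by (auto simp: immersion_def)
  have N: "smooth_map \<A> N" "\<And>q. q \<in> M \<Longrightarrow> norm (N q) = 1"
    "\<And>q v. q \<in> M \<Longrightarrow> differential \<A> x q v \<bullet> N q = 0"
    using nor by (auto simp: unit_normal_field_def)
  define R where "R = norm (x p)"
  have "x p \<noteq> 0"
  proof
    assume "x p = 0"
    then have "differential \<A> x p v = 0" for v
      using smooth_map_max_orthogonal(2)[OF M x p] max by blast
    then have "v = w" for v w :: 'a using injD[OF inj[OF p], of v w] by simp
    then show False using nonempty_Basis nonzero_Basis by (metis ex_in_conv)
  qed
  then have R: "R > 0" by (simp add: R_def)
  define \<nu> where "\<nu> = (- 1 / R) *\<^sub>R x p"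
  have \<nu>: "norm \<nu> = 1" using R by (simp add: \<nu>_def R_def)
  then have \<nu>\<nu>: "\<nu> \<bullet> \<nu> = 1" by (simp add: norm_eq_1)
  have xp: "x p = (- R) *\<^sub>R \<nu>" using R by (simp add: \<nu>_def)
  have orth: "differential \<A> x p v \<bullet> \<nu> = 0" for v
    using smooth_map_max_orthogonal(1)[OF M x p max, of v] by (simp add: \<nu>_def)
  obtain \<iota> :: "'a \<Rightarrow> 'b" and J :: "'b \<Rightarrow> 'a" and e :: real and \<psi> :: "'a \<Rightarrow> 'm" where
    I: "linear \<iota>" "linear J"
    "\<And>v w. \<iota> v \<bullet> \<iota> w = v \<bullet> w" "\<And>v. \<iota> v \<bullet> \<nu> = 0" "\<And>v. J (\<iota> v) = v" "J \<nu> = 0"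
    "\<And>z. z = \<iota> (J z) + (z \<bullet> \<nu>) *\<^sub>R \<nu>" "\<And>z v. z \<bullet> \<iota> v = J z \<bullet> v"
    and e: "e > 0" and \<psi>: "\<psi> 0 = p" "\<psi> ` ball 0 e \<subseteq> M" "continuous_on (ball 0 e) \<psi>"
    "\<And>W. open W \<Longrightarrow> W \<subseteq> ball 0 e \<Longrightarrow> openin (top_of_set M) (\<psi> ` W)"
    "\<And>y. y \<in> ball 0 e \<Longrightarrow> J (x (\<psi> y) - x p) = y"
    and sm: "\<And>f :: 'm \<Rightarrow> 'b. smooth_map \<A> f \<Longrightarrow> smooth_on (ball 0 e) (f \<circ> \<psi>)"
    and T: "\<And>y. y \<in> ball 0 e \<Longrightarrow> \<exists>T. linear T \<and> bij T \<and> (\<forall>f :: 'm \<Rightarrow> 'b. smooth_map \<A> f \<longrightarrow>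
      (\<lambda>v. differential \<A> f (\<psi> y) (T v)) = fderiv (f \<circ> \<psi>) y)"
    using local_graph[OF dim M imm p \<nu> orth] by blast
  let ?V = "ball 0 e :: 'a set"
  have \<nu>\<iota>: "\<nu> \<bullet> \<iota> v = 0" for v using I(4) by (simp add: inner_commute)
  have V: "open ?V" "0 \<in> ?V" using e by auto
  define F where "F y = x (\<psi> y) \<bullet> \<nu>" for y
  have F: "smooth_on ?V F"
    unfolding smooth_on_def F_def[abs_def]
  proof
    fix k
    have "C_k_on k ?V (\<lambda>y. (x \<circ> \<psi>) y \<bullet> \<nu>)"
      by (rule C_k_on_bounded_linear[OF bounded_linear_inner_left V(1) smooth_on_C[OF sm[OF x]]])
    then show "C_k_on k ?V (\<lambda>y. x (\<psi> y) \<bullet> \<nu>)" by (simp add: comp_def)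
  qed
  have C2F: "C_k_on 2 ?V F" using smooth_on_C[OF F] .
  note grad_inner = gradient_inner[OF V(1) C2F]
  have Jxp: "J (x p) = 0"
    by (simp only: xp linear_scale[OF I(2)] I(6) scaleR_zero_right)
  have graph: "x (\<psi> y) = \<iota> y + F y *\<^sub>R \<nu>" if "y \<in> ?V" for y
  proof -
    have "J (x (\<psi> y)) = y"
      using \<psi>(5)[OF that] Jxp by (simp add: linear_diff[OF I(2)])
    then show ?thesis using I(7)[of "x (\<psi> y)"] by (simp add: F_def)
  qed
  have F0: "F 0 = - R" by (simp add: F_def \<psi>(1) xp \<nu>\<nu>)
  have dx: "fderiv (x \<circ> \<psi>) y v = \<iota> v + pd v F y *\<^sub>R \<nu>" if y: "y \<in> ?V" for y v
  proof -
    have "((\<lambda>y. \<iota> y + F y *\<^sub>R \<nu>) has_derivative (\<lambda>v. \<iota> v + pd v F y *\<^sub>R \<nu>)) (at y)"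
      unfolding pd_def
      by (intro has_derivative_add bounded_linear_imp_has_derivative linear_linear[THEN iffD2, OF I(1)]
          bounded_linear.has_derivative[OF bounded_linear_scaleR_left]
          smooth_on_has_derivative[OF F y])
    then have "(x \<circ> \<psi> has_derivative (\<lambda>v. \<iota> v + pd v F y *\<^sub>R \<nu>)) (at y)"
      by (rule has_derivative_transform_within_open[OF _ V(1) y]) (simp add: graph)
    from frechet_derivative_at[OF this] show ?thesis by metis
  qed
  have tangent: "\<exists>w. differential \<A> x (\<psi> y) w = \<iota> v + pd v F y *\<^sub>R \<nu>" if "y \<in> ?V" for y v
    using T[OF that] x dx[OF that] by metis
  have pd0: "pd v F 0 = 0" for v
  proof -
    obtain w where "differential \<A> x p w = \<iota> v + pd v F 0 *\<^sub>R \<nu>"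
      using tangent[OF V(2)] \<psi>(1) by metis
    then show ?thesis using orth[of w] by (simp add: inner_add_left I(4) \<nu>\<nu>)
  qed
  \<comment> \<open>The sign of \<open>N\<close> relative to
    \<open>\<nu> - \<iota> (gradient F y)\<close>. Being continuous with values 1 and -1, it is
    constant on the connected ball.\<close>
  define h where "h y = (N (\<psi> y) \<bullet> \<nu>) * area F y" for y
  have Npsi: "N (\<psi> y) = (h y / area F y) *\<^sub>R (\<nu> - \<iota> (gradient F y))" "h y = 1 \<or> h y = - 1"
    if y: "y \<in> ?V" for y
  proof -
    have q: "\<psi> y \<in> M" using y \<psi>(2) by blast
    have W: "area F y > 0" using area_ge_1[of F y] by simp
    define s where "s = N (\<psi> y) \<bullet> \<nu>"
    have "J (N (\<psi> y)) \<bullet> v = (- s) *\<^sub>R gradient F y \<bullet> v" for v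
    proof -
      obtain w where "differential \<A> x (\<psi> y) w = \<iota> v + pd v F y *\<^sub>R \<nu>" using tangent[OF y] by metis
      then have "(\<iota> v + pd v F y *\<^sub>R \<nu>) \<bullet> N (\<psi> y) = 0" using N(3)[OF q] by metis
      then show ?thesis
        using I(8)[of "N (\<psi> y)" v] grad_inner[OF y, of v]
        by (simp add: inner_add_left inner_commute s_def algebra_simps)
    qed
    then have JN: "J (N (\<psi> y)) = (- s) *\<^sub>R gradient F y" using vector_eq_rdot by blast
    have eq: "N (\<psi> y) = s *\<^sub>R (\<nu> - \<iota> (gradient F y))"
      using I(7)[of "N (\<psi> y)"] unfolding JN s_def[symmetric]
      by (simp add: linear_scale[OF I(1)] linear_neg[OF I(1)] scaleR_right_diff_distrib)
    then show "N (\<psi> y) = (h y / area F y) *\<^sub>R (\<nu> - \<iota> (gradient F y))"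
      using W by (simp add: h_def s_def)
    have "1 = N (\<psi> y) \<bullet> N (\<psi> y)" using N(2)[OF q] by (simp add: norm_eq_1)
    also have "\<dots> = s * s * ((\<nu> - \<iota> (gradient F y)) \<bullet> (\<nu> - \<iota> (gradient F y)))"
      by (subst (1 2) eq) simp
    also have "(\<nu> - \<iota> (gradient F y)) \<bullet> (\<nu> - \<iota> (gradient F y)) = (area F y)\<^sup>2"
      by (simp add: inner_diff_left inner_diff_right I(3,4) \<nu>\<nu> \<nu>\<iota> area_squared)
    also have "s * s * (area F y)\<^sup>2 = (h y)\<^sup>2"
      by (simp add: h_def s_def power2_eq_square)
    finally show "h y = 1 \<or> h y = - 1" by (simp add: power2_eq_1_iff)
  qed
  have "continuous_on ?V h"
  proof -
    have "continuous_on ?V (N \<circ> \<psi>)" using C_k_on_imp_continuous_on[OF smooth_on_C[OF sm[OF N(1)]]] .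
    moreover have "continuous_on ?V (gradient F)"
      using C_k_on_imp_continuous_on[OF C_k_on_gradient[OF V(1) C2F]] .
    ultimately show ?thesis
      unfolding h_def[abs_def] area_def comp_def by (intro continuous_intros)
  qed
  moreover have "finite (h ` ?V)"
    by (rule finite_subset[of _ "{1, - 1}"]) (use Npsi(2) in blast, simp)
  ultimately have "h constant_on ?V"
    using continuous_finite_range_constant[of ?V h] by simp
  then obtain \<epsilon> where \<epsilon>: "\<And>y. y \<in> ?V \<Longrightarrow> h y = \<epsilon>" by (auto simp: constant_on_def)
  have \<epsilon>1: "\<epsilon> = 1 \<or> \<epsilon> = - 1" using Npsi(2)[OF V(2)] \<epsilon>[OF V(2)] by simp
  have normal: "(N \<circ> \<psi>) y = (\<epsilon> / area F y) *\<^sub>R (\<nu> - \<iota> (gradient F y))" if "y \<in> ?V" for y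
    using Npsi(1)[OF that] \<epsilon>[OF that] by simp
  have support: "area F y * (x (\<psi> y) \<bullet> N (\<psi> y)) = \<epsilon> * (F y - y \<bullet> gradient F y)" if y: "y \<in> ?V" for y
    using normal[OF y] graph[OF y] area_ge_1[of F y]
    by (simp add: inner_add_left inner_diff_right I(3,4) \<nu>\<nu> \<nu>\<iota>)
  have curv: "S_curv \<A> x N k (\<psi> y) = \<epsilon> ^ k * esym k G l"
    if y: "y \<in> ?V" and G: "onb G" and eig: "\<And>g. g \<in> G \<Longrightarrow> graph_shape F y g = l g *\<^sub>R g" for y G l k
  proof -
    define A where "A v = (\<epsilon> / area F y) *\<^sub>R graph_frame F y (graph_frame F y (hessian F y v))" for v
    note * = graph_normal_derivative[OF V(1) C2F y I(1) normal, folded A_def]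
    obtain T where T: "linear T" "bij T" "\<And>f :: 'm \<Rightarrow> 'b. smooth_map \<A> f \<Longrightarrow>
      (\<lambda>v. differential \<A> f (\<psi> y) (T v)) = fderiv (f \<circ> \<psi>) y"
      using T[OF y] by blast
    \<comment> \<open>\<open>A\<close> acts in the coordinates \<open>y\<close>; transport by
      \<open>T\<close> moves it to the coordinates of \<open>chart_at\<close>, in which
      \<open>shape_operator\<close> is defined.\<close>
    define S where "S = T \<circ> A \<circ> inv T"
    have invT: "linear (inv T)" using T(1,2) by (simp add: bij_is_inj inj_linear_imp_inv_linear)
    have linS: "linear S" unfolding S_def by (intro linear_compose T(1) *(1) invT)
    have ST: "S (T v) = T (A v)" for v using T(2) by (simp add: S_def bij_is_inj)
    have q: "\<psi> y \<in> M" using y \<psi>(2) by blast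
    have S: "differential \<A> x (\<psi> y) (S v) = - differential \<A> N (\<psi> y) v" for v
    proof -
      obtain w where w: "v = T w" using T(2) by (metis bij_pointE)
      have "differential \<A> x (\<psi> y) (T (A w)) = \<iota> (A w) + pd (A w) F y *\<^sub>R \<nu>"
        using T(3)[OF x] dx[OF y, of "A w"] by metis
      also have "\<dots> = - fderiv (N \<circ> \<psi>) y w"
        using *(3)[of w] grad_inner[OF y] by (simp add: comp_def)
      also have "\<dots> = - differential \<A> N (\<psi> y) (T w)" using T(3)[OF N(1)] by metis
      finally show ?thesis by (simp add: w ST)
    qed
    have "shape_operator \<A> x N (\<psi> y) = S"
      unfolding shape_operator_def
    proof (rule the_equality)
      show "linear S \<and> (\<forall>v. differential \<A> x (\<psi> y) (S v) = - differential \<A> N (\<psi> y) v)"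
        using linS S by blast
      fix S' assume "linear S' \<and> (\<forall>v. differential \<A> x (\<psi> y) (S' v) = - differential \<A> N (\<psi> y) v)"
      then have "differential \<A> x (\<psi> y) (S' v) = differential \<A> x (\<psi> y) (S v)" for v using S by simp
      then show "S' = S" using inj[OF q] by (auto simp: inj_def)
    qed
    moreover have "eigenvalues S = eigenvalues (\<lambda>v. \<epsilon> *\<^sub>R graph_shape F y v)"
    proof (rule eigenvalues_conjugate)
      show "linear (T \<circ> graph_frame F y)" by (intro linear_compose linear_graph_frame T(1))
      show "bij (T \<circ> graph_frame F y)" by (intro bij_comp bij_graph_frame T(2))
      show "S ((T \<circ> graph_frame F y) v) = (T \<circ> graph_frame F y) (\<epsilon> *\<^sub>R graph_shape F y v)" for v
        using ST[of "graph_frame F y v"] *(2)[of v] by simp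
    qed
    ultimately have "eigenvalues (shape_operator \<A> x N (\<psi> y)) = eigenvalues (\<lambda>v. \<epsilon> *\<^sub>R graph_shape F y v)"
      by simp
    moreover have "linear (\<lambda>v. \<epsilon> *\<^sub>R graph_shape F y v)"
      by (rule linear_compose_scale_right[OF linear_graph_shape[OF V(1) C2F y]])
    ultimately have "S_curv \<A> x N k (\<psi> y) = esym k G (\<lambda>g. \<epsilon> * l g)"
      by (rule S_curv_eq_esym[OF _ _ G]) (simp add: eig)
    then show ?thesis by (simp add: esym_scale)
  qed
  have norm: "norm (\<iota> y + z *\<^sub>R \<nu>) ^ 2 = y \<bullet> y + z\<^sup>2" for y z
    unfolding power2_norm_eq_inner
    by (simp add: inner_add_left inner_add_right I(3,4) \<nu>\<nu> \<nu>\<iota> power2_eq_square)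
  show thesis
    using R F0 by (intro that[of J \<nu> \<iota> e \<psi> F \<epsilon>, OF _ I(2,6) norm I(5,7) e \<psi>(1-4) F _ pd0 graph \<epsilon>1 support curv])
      (auto simp: R_def)
qed

text \<open>A continuity argument on the second derivatives. It keeps the principal curvatures near
  \<open>p\<close> in the positive cone, where Garding's inequality is available.\<close>

lemma hessian_positive_near:
  fixes F :: "'a::euclidean_space \<Rightarrow> real"
  assumes V: "open V" "0 \<in> V" and F: "C_k_on 2 V F" and E: "onb E" and c: "c > 0"
    and pos: "\<And>e. e \<in> E \<Longrightarrow> c \<le> d e"
    and F2: "\<And>e f. e \<in> E \<Longrightarrow> f \<in> E \<Longrightarrow> pd f (pd e F) 0 = (if e = f then d e else 0)"
  obtains W where "open W" "0 \<in> W" "W \<subseteq> V" "\<And>y v. y \<in> W \<Longrightarrow> v \<noteq> 0 \<Longrightarrow> hessian F y v \<bullet> v > 0"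
proof -
  have C: "C_k_on (Suc (Suc 0)) V F" using F by (simp add: numeral_2_eq_2)
  have fin: "finite E" by (rule onb_finite[OF E])
  define n where "n = real (card E)"
  have n: "n > 0" using onb_card[OF E] by (simp add: n_def)
  \<comment> \<open>There are \<open>n * n\<close> second derivatives, each of which may change the
    form by \<open>\<delta>\<close> times the squared length; together they use up half of
    \<open>c\<close>.\<close>
  define \<delta> where "\<delta> = c / (2 * n * n)"
  have \<delta>: "\<delta> > 0" using c n by (simp add: \<delta>_def)
  have "\<forall>\<^sub>F y in nhds 0. \<forall>e\<in>E. \<forall>f\<in>E. dist (pd f (pd e F) y) (pd f (pd e F) 0) < \<delta>"
  proof (intro eventually_ball_finite fin ballI)
    fix e f
    have "isCont (pd f (pd e F)) 0"
      using C_k_on_imp_continuous_on[OF C_k_on_pd[OF C_k_on_pd[OF C]]] V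
      by (simp add: continuous_on_eq_continuous_at)
    then have "filterlim (pd f (pd e F)) (nhds (pd f (pd e F) 0)) (nhds 0)"
      by (simp add: isCont_def tendsto_at_iff_tendsto_nhds)
    then show "\<forall>\<^sub>F y in nhds 0. dist (pd f (pd e F) y) (pd f (pd e F) 0) < \<delta>"
      using \<delta> by (rule tendstoD)
  qed
  then obtain W0 where W0: "open W0" "0 \<in> W0"
    "\<And>y e f. y \<in> W0 \<Longrightarrow> e \<in> E \<Longrightarrow> f \<in> E \<Longrightarrow> \<bar>pd f (pd e F) y - pd f (pd e F) 0\<bar> < \<delta>"
    unfolding eventually_nhds dist_real_def by blast
  show thesis
  proof (rule that[of "W0 \<inter> V"])
    fix y v :: 'a assume "y \<in> W0 \<inter> V" and v: "v \<noteq> 0"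
    then have y: "y \<in> W0" "y \<in> V" by auto
    have H: "hessian F y v \<bullet> v = (\<Sum>e\<in>E. \<Sum>f\<in>E. (v \<bullet> e) * (v \<bullet> f) * pd f (pd e F) y)"
    proof -
      have "hessian F y v \<bullet> v = (\<Sum>e\<in>E. (v \<bullet> e) * (v \<bullet> hessian F y e))"
        unfolding onb_inner_sum[OF E, of "hessian F y v" v]
        by (simp add: hessian_symmetric[OF V(1) F y(2), of v] mult.commute)
      also have "\<dots> = (\<Sum>e\<in>E. \<Sum>f\<in>E. (v \<bullet> e) * (v \<bullet> f) * pd f (pd e F) y)"
      proof (rule sum.cong)
        fix e assume "e \<in> E"
        have "hessian F y e \<bullet> f = pd f (pd e F) y" for f
          using hessian_inner[OF V(1) F y(2), of e f] pd_commute[OF V(1) y(2) F, of f e] by simp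
        then show "(v \<bullet> e) * (v \<bullet> hessian F y e) = (\<Sum>f\<in>E. (v \<bullet> e) * (v \<bullet> f) * pd f (pd e F) y)"
          unfolding onb_inner_sum[OF E, of v "hessian F y e"] by (simp add: sum_distrib_left mult.assoc)
      qed simp
      finally show ?thesis .
    qed
    have le: "\<bar>v \<bullet> e\<bar> \<le> norm v" if "e \<in> E" for e
      using that E Cauchy_Schwarz_ineq2[of v e] by (auto simp: onb_def)
    have "c * (v \<bullet> v) = (\<Sum>e\<in>E. c * ((v \<bullet> e) * (v \<bullet> e)))"
      by (subst onb_inner_sum[OF E]) (simp add: sum_distrib_left)
    also have "\<dots> \<le> (\<Sum>e\<in>E. d e * ((v \<bullet> e) * (v \<bullet> e)))"
      by (intro sum_mono mult_right_mono pos) auto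
    also have "\<dots> = (\<Sum>e\<in>E. \<Sum>f\<in>E. (v \<bullet> e) * (v \<bullet> f) * (if e = f then d e else 0))"
      using fin by (intro sum.cong) (simp_all add: if_distrib[of "\<lambda>x. _ * x"] mult_ac cong: if_cong)
    also have "\<dots> = (\<Sum>e\<in>E. \<Sum>f\<in>E. (v \<bullet> e) * (v \<bullet> f) * pd f (pd e F) 0)"
      using F2 by (intro sum.cong) auto
    also have "\<dots> \<le> (\<Sum>e\<in>E. \<Sum>f\<in>E. (v \<bullet> e) * (v \<bullet> f) * pd f (pd e F) y + norm v * norm v * \<delta>)"
    proof (intro sum_mono)
      fix e f assume ef: "e \<in> E" "f \<in> E"
      have "(v \<bullet> e) * (v \<bullet> f) * (pd f (pd e F) 0 - pd f (pd e F) y)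
          \<le> \<bar>(v \<bullet> e) * (v \<bullet> f) * (pd f (pd e F) 0 - pd f (pd e F) y)\<bar>" by (rule abs_ge_self)
      also have "\<dots> = \<bar>v \<bullet> e\<bar> * \<bar>v \<bullet> f\<bar> * \<bar>pd f (pd e F) y - pd f (pd e F) 0\<bar>"
        by (simp add: abs_mult abs_minus_commute)
      also have "\<dots> \<le> norm v * norm v * \<delta>"
        using ef W0(3)[OF y(1) ef] by (intro mult_mono le) auto
      finally show "(v \<bullet> e) * (v \<bullet> f) * pd f (pd e F) 0
          \<le> (v \<bullet> e) * (v \<bullet> f) * pd f (pd e F) y + norm v * norm v * \<delta>"
        by (simp add: algebra_simps)
    qed
    also have "\<dots> = hessian F y v \<bullet> v + n * n * (norm v * norm v * \<delta>)"
      by (simp add: H sum.distrib n_def)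
    also have "n * n * (norm v * norm v * \<delta>) = c / 2 * (v \<bullet> v)"
      using n by (simp add: \<delta>_def dot_square_norm power2_eq_square field_simps)
    finally have "c / 2 * (v \<bullet> v) \<le> hessian F y v \<bullet> v" by simp
    moreover have "c / 2 * (v \<bullet> v) > 0" using c v by simp
    ultimately show "hessian F y v \<bullet> v > 0" by linarith
  qed (use W0 V in auto)
qed

lemma esym_const_card:
  assumes "finite A" "finite B" "card A = card B"
  shows "esym k A (\<lambda>_. c) = esym k B (\<lambda>_. c)"
proof -
  obtain b where b: "bij_betw b A B" using finite_same_card_bij[OF assms] by blast
  show ?thesis by (rule esym_bij_betw[OF b]) (rule refl)
qed

text \<open>The point \<open>p\<close> is an arbitrary maximum point, so that the conclusion can be
  drawn at every point of the level set of the maximal distance; this makes the level set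
  open.\<close>

theorem local_rigidity:
  fixes M :: "'m::t2_space set" and \<A> :: "('m, 'a::euclidean_space) chart set"
    and x N :: "'m \<Rightarrow> 'b::euclidean_space"
  assumes dim: "DIM('b) = DIM('a) + 1" and M: "smooth_atlas M \<A>"
    and imm: "immersion M \<A> x" and nor: "unit_normal_field M \<A> x N"
    and shrinker: "self_shrinker M \<A> x N" and k: "1 \<le> k" "k \<le> DIM('a)"
    and const: "\<And>q. q \<in> M \<Longrightarrow> S_curv \<A> x N k q = c"
    and p: "p \<in> M" and max: "\<And>q. q \<in> M \<Longrightarrow> norm (x q) \<le> norm (x p)"
  shows "norm (x p) = sqrt (2 * real DIM('a))
    \<and> (\<exists>W. openin (top_of_set M) W \<and> p \<in> W \<and> (\<forall>q\<in>W. norm (x q) = norm (x p)))"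
proof (rule graph_at_maximum[OF dim M imm nor p max])
  fix J :: "'b \<Rightarrow> 'a" and \<nu> :: 'b and \<iota> :: "'a \<Rightarrow> 'b" and e :: real and \<psi> :: "'a \<Rightarrow> 'm"
    and F :: "'a \<Rightarrow> real" and \<epsilon> :: real
  assume R0: "norm (x p) > 0" and "linear J" "J \<nu> = 0"
    and norm: "\<And>y z. norm (\<iota> y + z *\<^sub>R \<nu>) ^ 2 = y \<bullet> y + z\<^sup>2" and "\<And>y. J (\<iota> y) = y"
    "\<And>z. z = \<iota> (J z) + (z \<bullet> \<nu>) *\<^sub>R \<nu>"
    and e: "e > 0" and \<psi>: "\<psi> 0 = p" "\<psi> ` ball 0 e \<subseteq> M" "continuous_on (ball 0 e) \<psi>"
    "\<And>W. open W \<Longrightarrow> W \<subseteq> ball 0 e \<Longrightarrow> openin (top_of_set M) (\<psi> ` W)"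
    and F: "smooth_on (ball 0 e) F" "F 0 = - norm (x p)" "\<And>v. pd v F 0 = 0"
    and graph: "\<And>y. y \<in> ball 0 e \<Longrightarrow> x (\<psi> y) = \<iota> y + F y *\<^sub>R \<nu>"
    and \<epsilon>: "\<epsilon> = 1 \<or> \<epsilon> = - 1"
    and support: "\<And>y. y \<in> ball 0 e \<Longrightarrow> area F y * (x (\<psi> y) \<bullet> N (\<psi> y)) = \<epsilon> * (F y - y \<bullet> gradient F y)"
    and curv: "\<And>y G l k. y \<in> ball 0 e \<Longrightarrow> onb G \<Longrightarrow> (\<And>g. g \<in> G \<Longrightarrow> graph_shape F y g = l g *\<^sub>R g) \<Longrightarrow>
        S_curv \<A> x N k (\<psi> y) = \<epsilon> ^ k * esym k G l"
  define R where "R = norm (x p)"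
  have R: "R > 0" using R0 by (simp add: R_def)
  let ?V = "ball 0 e :: 'a set"
  have V: "open ?V" "0 \<in> ?V" using e by auto
  have C2: "C_k_on 2 ?V F" and C4: "C_k_on 4 ?V F" using smooth_on_C[OF F(1)] by auto
  have C2S: "C_k_on (Suc (Suc 0)) ?V F" using C2 by (simp add: numeral_2_eq_2)
  have \<epsilon>\<epsilon>: "\<epsilon> * \<epsilon> = 1" "\<epsilon> \<noteq> 0" using \<epsilon> by auto
  have grad0: "gradient F 0 = 0" by (simp add: gradient_def F(3))
  have area0: "area F 0 = 1" by (simp add: area_def grad0)
  obtain E d where E: "onb E" and d: "\<And>e. e \<in> E \<Longrightarrow> hessian F 0 e = d e *\<^sub>R e"
    using symmetric_eigenbasis[OF linear_hessian[OF V(1) C2 V(2)] hessian_symmetric[OF V(1) C2 V(2)]]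
    by metis
  have fin: "finite E" by (rule onb_finite[OF E])
  have shape0: "graph_shape F 0 v = hessian F 0 v" for v
    by (simp add: graph_shape_def graph_frame_def grad0 area0)
  have F2: "pd g (pd h F) 0 = (if h = g then d h else 0)" if "h \<in> E" "g \<in> E" for h g
    using hessian_inner[OF V(1) C2 V(2), of g h] d[OF that(2)] onb_inner[OF E that(2,1)] by auto
  \<comment> \<open>\<open>trace\<close> and \<open>eq1\<close> are the shrinker equation for the
    graph. The sign \<open>\<epsilon>\<close> enters through the curvature and through the support
    function, so it cancels in \<open>eq1\<close>.\<close>
  have trace: "(\<Sum>h\<in>E. graph_shape F y h \<bullet> h) = - \<epsilon> * (x (\<psi> y) \<bullet> N (\<psi> y)) / 2" if y: "y \<in> ?V" for y
  proof -
    obtain G l where G: "onb G" "\<And>g. g \<in> G \<Longrightarrow> graph_shape F y g = l g *\<^sub>R g"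
      using symmetric_eigenbasis[OF linear_graph_shape[OF V(1) C2 y] graph_shape_symmetric[OF V(1) C2 y]]
      by metis
    have "\<psi> y \<in> M" using y \<psi>(2) by blast
    then have "\<epsilon> * esym 1 G l = - (x (\<psi> y) \<bullet> N (\<psi> y)) / 2"
      using shrinker curv[OF y G, of 1] by (simp add: self_shrinker_def support_function_def)
    moreover have "esym 1 G l = (\<Sum>h\<in>E. graph_shape F y h \<bullet> h)"
      using onb_trace(2)[OF linear_graph_shape[OF V(1) C2 y] E G] esym_1[OF onb_finite[OF G(1)], of l]
      by simp
    ultimately have "\<epsilon> * (\<Sum>h\<in>E. graph_shape F y h \<bullet> h) = - (x (\<psi> y) \<bullet> N (\<psi> y)) / 2" by simp
    then have "\<epsilon> * (\<epsilon> * (\<Sum>h\<in>E. graph_shape F y h \<bullet> h)) = \<epsilon> * (- (x (\<psi> y) \<bullet> N (\<psi> y)) / 2)" by simp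
    then show ?thesis unfolding mult.assoc[symmetric] \<epsilon>\<epsilon> by simp
  qed
  have eq1: "area F y * (\<Sum>h\<in>E. graph_shape F y h \<bullet> h) = (y \<bullet> gradient F y - F y) / 2" if y: "y \<in> ?V" for y
  proof -
    have "area F y * (\<Sum>h\<in>E. graph_shape F y h \<bullet> h) = - \<epsilon> * (area F y * (x (\<psi> y) \<bullet> N (\<psi> y))) / 2"
      unfolding trace[OF y] by simp
    also have "\<dots> = - (\<epsilon> * \<epsilon>) * (F y - y \<bullet> gradient F y) / 2" unfolding support[OF y] by simp
    finally show ?thesis unfolding \<epsilon>\<epsilon> by simp
  qed
  have sumd: "(\<Sum>h\<in>E. d h) = R / 2"
  proof -
    have "(\<Sum>h\<in>E. graph_shape F 0 h \<bullet> h) = (\<Sum>h\<in>E. d h)"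
      by (intro sum.cong) (simp_all add: shape0 d onb_inner[OF E])
    then show ?thesis using eq1[OF V(2)] by (simp add: area0 F(2) R_def)
  qed
  have dge: "1 / R \<le> d h" if h: "h \<in> E" for h
  proof -
    let ?f = "\<lambda>y. F y + R"
    have Cf: "C_k_on (Suc (Suc 0)) ?V ?f" by (intro C_k_on_add C_k_on_const V(1) C2S)
    have pdf: "pd v ?f y = pd v F y" if "y \<in> ?V" for v y
    proof -
      have "(?f has_derivative (\<lambda>v. fderiv F y v + 0)) (at y)"
        by (intro has_derivative_add has_derivative_const C_k_on_SucD(1)[OF C2S that])
      then show ?thesis using frechet_derivative_at unfolding pd_def by (metis add_0_right)
    qed
    have "slope0 h ?f 0"
      using slope0_C1[OF V(2) Cf, of h] F(2,3) pdf[OF V(2), of h] by (simp add: R_def)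
    note f2 = diff2_product[OF this this continuous_const, of 1]
    have "pd h (pd h ?f) 0 = pd h (pd h F) 0"
      by (rule pd_cong[OF V pdf]) (use C_k_on_pd[OF Cf] in simp_all)
    then have f1: "diff2 h ?f (d h)"
      using diff2_C2[OF V, of ?f h] Cf F2[OF h h] by (simp add: numeral_2_eq_2)
    note y2 = diff2_product[OF slope0_inner[of h h] slope0_inner[of h h] continuous_const, of 1]
    \<comment> \<open>\<open>?g y\<close> is
      \<open>(y \<bullet> h)\<^sup>2 + (F y)\<^sup>2 - R\<^sup>2\<close>, at most 0 by maximality.
      Written in \<open>F + R\<close>, which vanishes at 0 together with its slope, it has second
      difference \<open>2 - 2 * R * d h\<close>.\<close>
    let ?g = "\<lambda>y. (y \<bullet> h) * (y \<bullet> h) * 1 + (?f y * ?f y * 1 - (2 * R) * ?f y)"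
    have "diff2 h ?g (2 * (h \<bullet> h) * (h \<bullet> h) * 1 + (2 * 0 * 0 * 1 - (2 * R) * d h))"
      by (intro diff2_add diff2_diff diff2_cmult f1 f2 y2)
    then have g: "diff2 h ?g (2 - 2 * R * d h)" using onb_inner[OF E h h] by simp
    have "2 - 2 * R * d h \<le> 0"
    proof (rule diff2_le[OF V _ _ g diff2_const])
      fix y assume y: "y \<in> ?V"
      have "\<psi> y \<in> M" using y \<psi>(2) by blast
      then have "norm (x (\<psi> y)) ^ 2 \<le> R ^ 2" using max unfolding R_def by (intro power_mono) auto
      then have "y \<bullet> y + (F y)\<^sup>2 \<le> R ^ 2" using graph[OF y] norm by simp
      moreover have "(y \<bullet> h) * (y \<bullet> h) \<le> y \<bullet> y"
        using Cauchy_Schwarz_ineq[of y h] onb_inner[OF E h h] by (simp add: power2_eq_square)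
      ultimately show "?g y \<le> 0" by (simp add: algebra_simps power2_eq_square)
    qed (simp add: F(2) R_def)
    then show ?thesis using R by (simp add: field_simps)
  qed
  have dpos: "d h > 0" if "h \<in> E" for h
    using dge[OF that] R by (meson divide_pos_pos less_le_trans zero_less_one)
  obtain W where W: "open W" "0 \<in> W" "W \<subseteq> ?V"
    and Hpos: "\<And>y v. y \<in> W \<Longrightarrow> v \<noteq> 0 \<Longrightarrow> hessian F y v \<bullet> v > 0"
    using hessian_positive_near[OF V C2 E _ dge F2] R by (metis divide_pos_pos zero_less_one)
  have cond: "esym_deriv k E d d \<le> esym_deriv k E d (\<lambda>h. graph_shape F y h \<bullet> h)" if yW: "y \<in> W" for y
  proof -
    have y: "y \<in> ?V" using yW W(3) by blast
    obtain G l where G: "onb G" "\<And>g. g \<in> G \<Longrightarrow> graph_shape F y g = l g *\<^sub>R g"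
      using symmetric_eigenbasis[OF linear_graph_shape[OF V(1) C2 y] graph_shape_symmetric[OF V(1) C2 y]]
      by metis
    have lpos: "l g > 0" if g: "g \<in> G" for g
    proof -
      have "g \<noteq> 0" using onb_inner[OF G(1) g g] by auto
      then have "graph_frame F y g \<noteq> 0"
        using bij_graph_frame[of F y] linear_0[OF linear_graph_frame] by (metis bij_is_inj injD)
      then have "graph_shape F y g \<bullet> g > 0"
        unfolding graph_shape_inner[OF V(1) C2 y]
        using Hpos[OF yW] area_ge_1[of F y] by (simp add: zero_less_divide_iff)
      then show ?thesis using G(2)[OF g] onb_inner[OF G(1) g g] by simp
    qed
    \<comment> \<open>The factor \<open>\<epsilon> ^ k\<close> is the same at 0 and at
      \<open>y\<close>, so constancy of the curvature equates the symmetric functions of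
      \<open>l\<close> and \<open>d\<close>, as Garding's inequality demands.\<close>
    have "\<psi> y \<in> M" using y \<psi>(2) by blast
    then have "\<epsilon> ^ k * esym k G l = \<epsilon> ^ k * esym k E d"
      using const[of "\<psi> y"] const[OF p] curv[OF y G, of k] curv[OF V(2) E, of d k] \<psi>(1) d shape0 by simp
    then have eq: "esym k G l = esym k E d" using \<epsilon>\<epsilon>(2) by simp
    show ?thesis
      by (rule esym_garding_symmetric[OF linear_graph_shape[OF V(1) C2 y] E G(1) G(2) lpos dpos k eq])
  qed
  define P where "P h = esym (k - 1) (E - {h}) d" for h
  have Ppos: "P h > 0" if "h \<in> E" for h
    unfolding P_def using that fin onb_card[OF E] k dpos by (intro esym_pos) auto
  define A where "A y = sqrt (1 + (\<Sum>h\<in>E. (pd h F y)\<^sup>2))" for y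
  have area: "area F y = A y" if "y \<in> ?V" for y
    unfolding area_def A_def onb_inner_sum[OF E, of "gradient F y" "gradient F y"]
    by (simp add: gradient_inner[OF V(1) C2 that] power2_eq_square)
  have sumd2: "(\<Sum>h\<in>E. (d h)\<^sup>2) \<le> 1 / 2"
  proof (rule graph_second_variation[OF E W(1,2) C_k_on_subset[OF C4 W(3)] F(3) F2 A_def])
    show "(\<Sum>h\<in>E. pd h (pd h F) y)
        - (\<Sum>h\<in>E. \<Sum>f\<in>E. pd h F y * pd f F y * pd f (pd h F) y) / (A y)\<^sup>2
        = ((\<Sum>h\<in>E. (y \<bullet> h) * pd h F y) - F y) / 2" if "y \<in> W" for y
    proof -
      have y: "y \<in> ?V" using that W(3) by blast
      have "(\<Sum>h\<in>E. (y \<bullet> h) * pd h F y) = y \<bullet> gradient F y"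
        unfolding onb_inner_sum[OF E, of y "gradient F y"] by (simp add: gradient_inner[OF V(1) C2 y])
      then show ?thesis
        using eq1[OF y] graph_shape_trace[OF V(1) C2 y E] by (simp add: area[OF y])
    qed
    show "(\<Sum>h\<in>E. P h * d h) * A y \<le> (\<Sum>h\<in>E. P h * (pd h (pd h F) y
        - 2 * (1 / (A y * (A y + 1))) * pd h F y * (\<Sum>j\<in>E. pd j F y * pd h (pd j F) y)
        + (1 / (A y * (A y + 1)))\<^sup>2 * (pd h F y)\<^sup>2
          * (\<Sum>i\<in>E. \<Sum>j\<in>E. pd i F y * pd j F y * pd j (pd i F) y)))" if "y \<in> W" for y
    proof -
      have y: "y \<in> ?V" using that W(3) by blast
      have "(\<Sum>h\<in>E. P h * d h) * area F y \<le> (\<Sum>h\<in>E. P h * (graph_shape F y h \<bullet> h)) * area F y"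
        using cond[OF that] area_ge_1[of F y]
        by (intro mult_right_mono) (auto simp: esym_deriv_def P_def)
      also have "\<dots> = (\<Sum>h\<in>E. P h * (area F y * (graph_shape F y h \<bullet> h)))"
        by (simp add: sum_distrib_left mult_ac)
      finally show ?thesis
        unfolding graph_shape_diagonal[OF V(1) C2 y]
        unfolding hessian_gradient_inner(2)[OF V(1) C2 y E]
        unfolding hessian_gradient_inner(1)[OF V(1) C2 y E]
        unfolding hessian_inner[OF V(1) C2 y] gradient_inner[OF V(1) C2 y] area[OF y] .
    qed
    show "(\<Sum>h\<in>E. P h * d h) > 0"
      using fin onb_card[OF E] Ppos dpos by (intro sum_pos) auto
  qed simp_all

  \<comment> \<open>Radius and umbilicity at the maximum point\<close>
  define n where "n = real DIM('a)"
  have cardE: "real (card E) = n" using onb_card[OF E] by (simp add: n_def)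
  have "n / R \<le> R / 2"
    using sum_mono[of E "\<lambda>_. 1 / R" d, OF dge] by (simp add: sumd cardE)
  then have "2 * n \<le> R\<^sup>2" using R by (simp add: field_simps power2_eq_square)
  moreover have "R\<^sup>2 \<le> 2 * n"
  proof -
    have "0 \<le> (\<Sum>h\<in>E. (d h - 1 / R)\<^sup>2)" by (intro sum_nonneg) simp
    also have "\<dots> = (\<Sum>h\<in>E. (d h)\<^sup>2 - 2 / R * d h + 1 / R\<^sup>2)"
      by (intro sum.cong) (simp_all add: power2_diff power_divide)
    also have "\<dots> = (\<Sum>h\<in>E. (d h)\<^sup>2) - 2 / R * (\<Sum>h\<in>E. d h) + n / R\<^sup>2"
      by (simp add: sum.distrib sum_subtractf sum_distrib_left cardE)
    also have "\<dots> \<le> 1 / 2 - 1 + n / R\<^sup>2" using sumd2 R by (simp add: sumd)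
    finally show ?thesis using R by (simp add: field_simps)
  qed
  ultimately have R2: "R\<^sup>2 = 2 * n" by simp
  then have radius: "norm (x p) = sqrt (2 * real DIM('a))"
    using R by (metis R_def n_def less_imp_le real_sqrt_unique)
  have nR: "n / R = R / 2" using R2 R by (simp add: field_simps power2_eq_square)
  have dR: "d h = 1 / R" if h: "h \<in> E" for h
  proof -
    have "(\<Sum>h\<in>E. d h - 1 / R) = 0" by (simp add: sum_subtractf sumd cardE nR)
    then show ?thesis
      using sum_nonneg_eq_0_iff[OF fin, of "\<lambda>h. d h - 1 / R"] dge h by auto
  qed
  have "norm (x (\<psi> y)) = R" if yW: "y \<in> W" for y
  proof -
    have y: "y \<in> ?V" using yW W(3) by blast
    then have q: "\<psi> y \<in> M" using \<psi>(2) by blast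
    obtain h0 where h0: "h0 \<in> E" using onb_card[OF E] by fastforce
    \<comment> \<open>All \<open>d h\<close> agree, hence so do the weights \<open>P h\<close>, and
      the linearized inequality \<open>cond\<close> becomes a lower bound for the trace, that is,
      for the mean curvature.\<close>
    have "P h = P h0" if "h \<in> E" for h
    proof -
      have "P h' = esym (k - 1) (E - {h'}) (\<lambda>_. 1 / R)" for h'
        unfolding P_def by (intro esym_cong) (use dR in auto)
      then show ?thesis
        using esym_const_card[of "E - {h}" "E - {h0}"] fin h0 that by simp
    qed
    moreover have "(\<Sum>h\<in>E. P h * d h) \<le> (\<Sum>h\<in>E. P h * (graph_shape F y h \<bullet> h))"
      using cond[OF yW] unfolding esym_deriv_def P_def .
    ultimately have "P h0 * (\<Sum>h\<in>E. d h) \<le> P h0 * (\<Sum>h\<in>E. graph_shape F y h \<bullet> h)"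
      by (simp add: sum_distrib_left)
    then have "R / 2 \<le> (\<Sum>h\<in>E. graph_shape F y h \<bullet> h)"
      using Ppos[OF h0] by (simp add: sumd)
    also have "\<dots> \<le> norm (x (\<psi> y)) / 2"
    proof -
      have "- \<epsilon> * (x (\<psi> y) \<bullet> N (\<psi> y)) \<le> \<bar>x (\<psi> y) \<bullet> N (\<psi> y)\<bar>" using \<epsilon> by auto
      also have "\<dots> \<le> norm (x (\<psi> y)) * norm (N (\<psi> y))" by (rule Cauchy_Schwarz_ineq2)
      also have "norm (N (\<psi> y)) = 1" using nor q by (simp add: unit_normal_field_def)
      finally show ?thesis unfolding trace[OF y] by simp
    qed
    finally show ?thesis using max[OF q] by (simp add: R_def)
  qed
  then have "\<exists>W. openin (top_of_set M) W \<and> p \<in> W \<and> (\<forall>q\<in>W. norm (x q) = norm (x p))"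
    using \<psi>(1) \<psi>(4)[OF W(1,3)] W(2) unfolding R_def by (intro exI[of _ "\<psi> ` W"]) auto
  with radius show "norm (x p) = sqrt (2 * real DIM('a))
      \<and> (\<exists>W. openin (top_of_set M) W \<and> p \<in> W \<and> (\<forall>q\<in>W. norm (x q) = norm (x p)))" ..
qed

section \<open>Local homeomorphisms onto simply connected spaces\<close>

text \<open>The fibre \<open>K\<close> over \<open>y\<close> is compact and discrete, hence finite.
  Disjoint neighbourhoods of its points contain the preimage of a neighbourhood of \<open>y\<close>,
  because the image of the compact remainder \<open>C\<close> is closed and avoids
  \<open>y\<close>.\<close>

lemma compact_local_homeomorphism_imp_covering_space:
  fixes f :: "'m::t2_space \<Rightarrow> 'b::t2_space"
  assumes M: "compact M" and f: "continuous_on M f" "f ` M = S"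
    and loc: "\<And>p. p \<in> M \<Longrightarrow> \<exists>U T g. p \<in> U \<and> openin (top_of_set M) U \<and> openin (top_of_set S) T
      \<and> homeomorphism U T f g"
  shows "covering_space M f S"
proof (rule covering_spaceI[OF f])
  fix y assume y: "y \<in> S"
  obtain U T g where U: "\<And>p. p \<in> M \<Longrightarrow> p \<in> U p" "\<And>p. p \<in> M \<Longrightarrow> openin (top_of_set M) (U p)"
    "\<And>p. p \<in> M \<Longrightarrow> openin (top_of_set S) (T p)" "\<And>p. p \<in> M \<Longrightarrow> homeomorphism (U p) (T p) f (g p)"
    using loc by metis
  define K where "K = M \<inter> f -` {y}"
  have inj: "inj_on f (U p)" if "p \<in> M" for p
    using U(4)[OF that] by (metis homeomorphism_apply1 inj_on_inverseI)
  have "finite K"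
  proof -
    have "closedin (top_of_set M) K"
      unfolding K_def by (rule continuous_closedin_preimage[OF f(1)]) simp
    then have "compact K" using M closedin_compact by blast
    moreover have "\<forall>c\<in>(\<lambda>p. K \<inter> U p) ` K. openin (top_of_set K) c"
    proof safe
      fix p assume "p \<in> K"
      then show "openin (top_of_set K) (K \<inter> U p)"
        using U(2)[of p] by (metis IntD1 K_def inf_le1 openin_Int_open openin_open inf.assoc inf.absorb_iff1)
    qed
    moreover have "K \<subseteq> \<Union> ((\<lambda>p. K \<inter> U p) ` K)" using U(1) by (auto simp: K_def)
    ultimately obtain D where D: "D \<subseteq> (\<lambda>p. K \<inter> U p) ` K" "finite D" "K \<subseteq> \<Union>D"
      unfolding compact_eq_openin_cover by meson
    have "finite c" if c: "c \<in> D" for c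
    proof -
      obtain p where "p \<in> K" "c = K \<inter> U p" using D(1) c by blast
      then have "c \<subseteq> {p}" using inj[of p] U(1)[of p] by (auto simp: K_def inj_on_def)
      then show ?thesis using finite_subset by blast
    qed
    then show ?thesis using D(2,3) by (meson finite_Union finite_subset)
  qed
  have "\<exists>A B. open A \<and> open B \<and> p \<in> A \<and> q \<in> B \<and> A \<inter> B = {}" if "p \<noteq> q" for p q :: 'm
    using separation_t2 that by metis
  then obtain A B where AB: "\<And>p q::'m. p \<noteq> q \<Longrightarrow> open (A p q) \<and> open (B p q) \<and> p \<in> A p q \<and> q \<in> B p q
      \<and> A p q \<inter> B p q = {}" by metis
  \<comment> \<open>Both \<open>A p q\<close> and \<open>B q p\<close> are intersected, as the
    separation chosen for \<open>(q, p)\<close> need not be the reverse of the one for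
    \<open>(p, q)\<close>.\<close>
  define D where "D p = (\<Inter>q\<in>K - {p}. A p q \<inter> B q p)" for p
  have D: "open (D p)" "p \<in> D p" for p
  proof -
    show "open (D p)"
      unfolding D_def
    proof (rule open_INT)
      show "\<forall>q\<in>K - {p}. open (A p q \<inter> B q p)"
        using AB[of p] AB[of _ p] by (metis Diff_iff insertI1 open_Int)
    qed (use \<open>finite K\<close> in simp)
    have "p \<in> A p q \<inter> B q p" if "q \<in> K - {p}" for q
      using AB[of p q] AB[of q p] that by auto
    then show "p \<in> D p" unfolding D_def by (rule INT_I)
  qed
  have disj: "D p \<inter> D q = {}" if "p \<in> K" "q \<in> K" "p \<noteq> q" for p q
  proof -
    have "D p \<subseteq> A p q \<inter> B q p" "D q \<subseteq> A q p \<inter> B p q"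
      unfolding D_def using that by (intro INT_lower; simp)+
    then have "D p \<subseteq> A p q" "D q \<subseteq> B p q" by simp_all
    then have "D p \<inter> D q \<subseteq> A p q \<inter> B p q" by (rule Int_mono)
    then show ?thesis using AB[OF that(3)] by simp
  qed
  define V where "V p = U p \<inter> D p" for p
  have KM: "K \<subseteq> M" by (auto simp: K_def)
  have V: "openin (top_of_set M) (V p)" "p \<in> V p" "V p \<subseteq> U p" if "p \<in> K" for p
    using that KM U(1,2) D by (auto simp: V_def openin_Int_open)
  have fV: "openin (top_of_set S) (f ` V p)" if p: "p \<in> K" for p
  proof -
    have pM: "p \<in> M" using p KM by blast
    have "openin (top_of_set (U p)) (V p)"
      using D(1) by (auto simp: V_def openin_open)
    then have "openin (top_of_set (T p)) (f ` V p)"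
      using homeomorphism_imp_open_map[OF U(4)[OF pM]] by blast
    then show ?thesis using U(3)[OF pM] openin_trans by blast
  qed
  define C where "C = M - (\<Union>p\<in>K. V p)"
  have "closedin (top_of_set M) C"
    unfolding C_def using V(1) by (intro closedin_diff openin_Union closedin_subtopology_refl[THEN iffD2]) auto
  then have "compact C" using M closedin_compact by blast
  then have "compact (f ` C)"
    by (rule compact_continuous_image[rotated]) (rule continuous_on_subset[OF f(1)], auto simp: C_def)
  then have fC: "closed (f ` C)" by (rule compact_imp_closed)
  have yC: "y \<notin> f ` C"
  proof
    assume "y \<in> f ` C"
    then obtain q where "q \<in> C" "f q = y" by blast
    then have "q \<in> K" by (auto simp: C_def K_def)
    then show False using V(2) \<open>q \<in> C\<close> by (auto simp: C_def)
  qed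
  have Kne: "K \<noteq> {}" using y f(2) by (auto simp: K_def)
  \<comment> \<open>Points of \<open>W\<close> have a preimage in every \<open>V p\<close> and none
    outside their union.\<close>
  define W where "W = (\<Inter>p\<in>K. f ` V p) \<inter> - f ` C"
  have "openin (top_of_set S) (\<Inter>p\<in>K. f ` V p)"
    using \<open>finite K\<close> Kne fV by (intro openin_INT2) auto
  then have Wop: "openin (top_of_set S) W"
    unfolding W_def using fC by (intro openin_Int_open) auto
  have yW: "y \<in> W"
    using yC V(2) by (auto simp: W_def K_def intro!: image_eqI)
  define vs where "vs = (\<lambda>p. V p \<inter> f -` W) ` K"
  show "\<exists>T. y \<in> T \<and> openin (top_of_set S) T \<and> (\<exists>v. \<Union>v = M \<inter> f -` T \<and>
      (\<forall>u\<in>v. openin (top_of_set M) u) \<and> pairwise disjnt v \<and> (\<forall>u\<in>v. \<exists>q. homeomorphism u T f q))"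
  proof (intro exI conjI)
    show "y \<in> W" "openin (top_of_set S) W" by (fact yW Wop)+
    show "\<Union>vs = M \<inter> f -` W"
    proof (intro equalityI subsetI)
      fix q assume "q \<in> \<Union>vs"
      then obtain p where "p \<in> K" "q \<in> V p" "f q \<in> W" by (auto simp: vs_def)
      then show "q \<in> M \<inter> f -` W" using openin_imp_subset[OF V(1)] by blast
    next
      fix q assume q: "q \<in> M \<inter> f -` W"
      then have "q \<notin> C" by (auto simp: W_def)
      then show "q \<in> \<Union>vs" using q by (auto simp: C_def vs_def)
    qed
    show "\<forall>u\<in>vs. openin (top_of_set M) u"
    proof
      fix u assume "u \<in> vs"
      then obtain p where p: "p \<in> K" "u = V p \<inter> f -` W" by (auto simp: vs_def)
      have "openin (top_of_set M) (M \<inter> f -` W)"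
        by (rule continuous_openin_preimage[OF f(1) _ Wop]) (use f(2) in auto)
      then have "openin (top_of_set M) (V p \<inter> (M \<inter> f -` W))" using V(1)[OF p(1)] by (rule openin_Int[rotated])
      moreover have "V p \<inter> (M \<inter> f -` W) = u" using p openin_imp_subset[OF V(1)[OF p(1)]] by blast
      ultimately show "openin (top_of_set M) u" by simp
    qed
    show "pairwise disjnt vs"
      unfolding pairwise_def vs_def
    proof (intro ballI impI)
      fix u w assume "u \<in> (\<lambda>p. V p \<inter> f -` W) ` K" "w \<in> (\<lambda>p. V p \<inter> f -` W) ` K" "u \<noteq> w"
      then obtain p q where "p \<in> K" "q \<in> K" "p \<noteq> q" "u \<subseteq> D p" "w \<subseteq> D q" by (auto simp: V_def)
      then show "disjnt u w" using disj[of p q] by (auto simp: disjnt_def)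
    qed
    show "\<forall>u\<in>vs. \<exists>q. homeomorphism u W f q"
    proof
      fix u assume "u \<in> vs"
      then obtain p where p: "p \<in> K" "u = V p \<inter> f -` W" by (auto simp: vs_def)
      have "W \<subseteq> f ` V p" using p(1) by (auto simp: W_def)
      then have "f ` u = W" unfolding p(2) by blast
      then show "\<exists>q. homeomorphism u W f q"
        using homeomorphism_of_subsets[OF U(4)[of p], of u] p V(3)[OF p(1)] KM by blast
    qed
  qed
qed

text \<open>The lifting theorems for covering spaces are available for subsets of normed spaces only. Finitely
  many bump functions embed \<open>M\<close> into such a space, over the base.\<close>

lemma local_homeomorphism_simply_connected_bij:
  fixes f :: "'m::t2_space \<Rightarrow> 'b::euclidean_space"
  assumes M: "compact M" "connected M" "M \<noteq> {}" and f: "continuous_on M f" "f ` M \<subseteq> S"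
    and S: "connected S" "simply_connected S" "locally path_connected S"
    and loc: "\<And>p. p \<in> M \<Longrightarrow> \<exists>U T g. p \<in> U \<and> openin (top_of_set M) U \<and> openin (top_of_set S) T
      \<and> homeomorphism U T f g"
  shows "bij_betw f M S"
proof -
  obtain U T g where U: "\<And>p. p \<in> M \<Longrightarrow> p \<in> U p" "\<And>p. p \<in> M \<Longrightarrow> openin (top_of_set M) (U p)"
    "\<And>p. p \<in> M \<Longrightarrow> openin (top_of_set S) (T p)" "\<And>p. p \<in> M \<Longrightarrow> homeomorphism (U p) (T p) f (g p)"
    using loc by metis
  have UM: "U p \<subseteq> M" if "p \<in> M" for p using openin_imp_subset[OF U(2)[OF that]] .
  have fU: "f ` U p = T p" if "p \<in> M" for p using U(4)[OF that] by (simp add: homeomorphism_def)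
  have gU: "g p (f q) = q" if "p \<in> M" "q \<in> U p" for p q
    using U(4)[OF that(1)] that(2) by (simp add: homeomorphism_def)
  have cfM: "compact (f ` M)" by (rule compact_continuous_image[OF f(1) M(1)])
  have fM: "f ` M = S"
  proof -
    have "f ` M = (\<Union>p\<in>M. T p)" using fU U(1) UM by blast
    then have "openin (top_of_set S) (f ` M)" using U(3) by (metis (no_types, lifting) image_iff openin_Union)
    moreover have "closedin (top_of_set S) (f ` M)"
      using compact_imp_closed[OF cfM] f(2) by (rule closed_subset[rotated])
    ultimately show ?thesis using S(1) M(3) by (metis connected_clopen image_is_empty)
  qed
  have cS: "compact S" using cfM fM by simp
  \<comment> \<open>On the sheet \<open>U p\<close> the bump is a function of the distance of
    \<open>f q\<close> from \<open>f p\<close>. The points where it is nonzero lie in the compact,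
    hence closed, set \<open>L\<close> inside \<open>U p\<close>, so extension by 0 is
    continuous.\<close>
  have "\<exists>\<beta>::'m \<Rightarrow> real. continuous_on M \<beta> \<and> \<beta> p > 0 \<and> (\<forall>q\<in>M. \<beta> q \<noteq> 0 \<longrightarrow> q \<in> U p)" if p: "p \<in> M" for p
  proof -
    have "f p \<in> T p" using fU[OF p] U(1)[OF p] by blast
    then obtain r where r: "r > 0" "cball (f p) r \<inter> S \<subseteq> T p"
      using U(3)[OF p] unfolding openin_contains_cball by blast
    define L where "L = g p ` (cball (f p) r \<inter> S)"
    have "continuous_on (T p) (g p)" using U(4)[OF p] by (simp add: homeomorphism_def)
    then have "compact L"
      unfolding L_def using r(2) cS
      by (intro compact_continuous_image) (auto intro: continuous_on_subset compact_Int)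
    moreover have LU: "L \<subseteq> U p"
      using image_mono[OF r(2), of "g p"] U(4)[OF p] by (simp add: L_def homeomorphism_def)
    ultimately have opL: "openin (top_of_set M) (M - L)"
      using UM[OF p] by (meson closed_subset compact_imp_closed openin_diff openin_subtopology_self subset_trans openin_topspace)
    define \<beta> where "\<beta> q = (if q \<in> U p then max 0 (r - dist (f q) (f p)) else 0)" for q
    have MU: "U p \<union> (M - L) = M" using UM[OF p] LU by blast
    have "continuous_on (U p \<union> (M - L)) \<beta>"
      unfolding \<beta>_def
    proof (rule continuous_on_cases_local_open)
      show "openin (top_of_set (U p \<union> (M - L))) (U p)" "openin (top_of_set (U p \<union> (M - L))) (M - L)"
        unfolding MU by (fact U(2)[OF p] opL)+
      show "continuous_on (U p) (\<lambda>q. max 0 (r - dist (f q) (f p)))"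
        by (intro continuous_intros continuous_on_subset[OF f(1) UM[OF p]])
      fix q assume "q \<in> U p \<and> q \<notin> U p \<or> q \<in> M - L \<and> q \<in> U p"
      then have q: "q \<in> U p" "q \<notin> L" by auto
      have "r < dist (f q) (f p)"
      proof (rule ccontr)
        assume "\<not> r < dist (f q) (f p)"
        then have "f q \<in> cball (f p) r \<inter> S" using q UM[OF p] f(2) by (auto simp: dist_commute)
        then have "g p (f q) \<in> L" by (auto simp: L_def)
        then show False using q gU[OF p] by simp
      qed
      then show "max 0 (r - dist (f q) (f p)) = 0" by simp
    qed (rule continuous_on_const)
    then have "continuous_on M \<beta>" by (simp add: MU)
    moreover have "\<beta> p > 0" using U(1)[OF p] r(1) by (simp add: \<beta>_def)
    moreover have "\<forall>q\<in>M. \<beta> q \<noteq> 0 \<longrightarrow> q \<in> U p" by (simp add: \<beta>_def)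
    ultimately show ?thesis by blast
  qed
  then obtain \<beta> :: "'m \<Rightarrow> 'm \<Rightarrow> real" where \<beta>: "\<And>p. p \<in> M \<Longrightarrow> continuous_on M (\<beta> p)"
    "\<And>p. p \<in> M \<Longrightarrow> \<beta> p p > 0" "\<And>p q. p \<in> M \<Longrightarrow> q \<in> M \<Longrightarrow> \<beta> p q \<noteq> 0 \<Longrightarrow> q \<in> U p"
    by metis
  define O' where "O' p = M \<inter> \<beta> p -` {0<..}" for p
  have "\<forall>c\<in>O' ` M. openin (top_of_set M) c"
    using \<beta>(1) by (auto simp: O'_def intro: continuous_openin_preimage_gen)
  moreover have "M \<subseteq> \<Union> (O' ` M)" using \<beta>(2) by (auto simp: O'_def)
  ultimately obtain D where D: "D \<subseteq> O' ` M" "finite D" "M \<subseteq> \<Union>D"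
    using M(1) unfolding compact_eq_openin_cover by meson
  then obtain P where P: "P \<subseteq> M" "finite P" "M \<subseteq> \<Union> (O' ` P)"
    by (metis finite_subset_image)
  obtain i :: "'m \<Rightarrow> nat" where i: "inj_on i P"
    using finite_imp_inj_to_nat_seg[OF P(2)] by blast
  \<comment> \<open>The number of bumps is not known to the type, so their values are stored as a
    bounded function on the naturals, the bump of \<open>p\<close> at position
    \<open>i p\<close>.\<close>
  define \<delta> :: "nat \<Rightarrow> nat \<Rightarrow>\<^sub>C real" where "\<delta> j = Bcontfun (\<lambda>k. if k = j then 1 else 0)" for j
  have \<delta>: "apply_bcontfun (\<delta> j) k = (if k = j then 1 else 0)" for j k
    unfolding \<delta>_def
    by (subst Bcontfun_inverse) (auto intro!: bcontfun_normI[where b = 1])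
  define h where "h q = (\<Sum>p\<in>P. \<beta> p q *\<^sub>R \<delta> (i p))" for q
  have hi: "apply_bcontfun (h q) (i p) = \<beta> p q" if p: "p \<in> P" for p q
  proof -
    have "apply_bcontfun (h q) k = (\<Sum>p'\<in>P. \<beta> p' q * apply_bcontfun (\<delta> (i p')) k)" for k
      unfolding h_def by (induction P rule: infinite_finite_induct) auto
    also have "(\<Sum>p'\<in>P. \<beta> p' q * apply_bcontfun (\<delta> (i p')) (i p)) = (\<Sum>p'\<in>P. if p' = p then \<beta> p' q else 0)"
      using p i by (intro sum.cong) (auto simp: \<delta> inj_on_def)
    finally show ?thesis using p P(2) by simp
  qed
  define E where "E q = (f q, h q)" for q
  have contE: "continuous_on M E"
    unfolding E_def[abs_def] h_def using P(1)
    by (intro continuous_on_Pair f(1) continuous_on_sum continuous_on_scaleR continuous_on_const \<beta>(1)) auto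
  \<comment> \<open>If \<open>E q = E q'\<close>, a bump positive at \<open>q\<close> is positive at
    \<open>q'\<close> too, so both lie in one sheet \<open>U p\<close>, where \<open>f\<close> is
    injective.\<close>
  have injE: "inj_on E M"
  proof (rule inj_onI)
    fix q q' assume q: "q \<in> M" "q' \<in> M" "E q = E q'"
    then obtain p where p: "p \<in> P" "\<beta> p q > 0" using P(3) by (auto simp: O'_def)
    then have "\<beta> p q' > 0" using hi[OF p(1)] q(3) by (metis E_def prod.inject)
    then have "q \<in> U p" "q' \<in> U p" using \<beta>(3)[of p] p P(1) q by auto
    then show "q = q'" using gU[of p] q(3) p(1) P(1) by (metis E_def prod.inject subsetD)
  qed
  define M' where "M' = E ` M"
  obtain E' where E': "homeomorphism M M' E E'"
    using homeomorphism_compact[OF M(1) contE _ injE] by (auto simp: M'_def)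
  have fstE: "fst (E q) = f q" for q by (simp add: E_def)
  have cov: "covering_space M' fst S"
  proof (rule compact_local_homeomorphism_imp_covering_space)
    show "compact M'" unfolding M'_def by (rule compact_continuous_image[OF contE M(1)])
    show "continuous_on M' fst" by (intro continuous_intros)
    show "fst ` M' = S" by (simp add: M'_def image_image fstE fM)
    fix z assume "z \<in> M'"
    then obtain p where p: "p \<in> M" "z = E p" by (auto simp: M'_def)
    have opE: "openin (top_of_set M') (E ` U p)"
      by (rule homeomorphism_imp_open_map[OF E' U(2)[OF p(1)]])
    have "homeomorphism (U p) (E ` U p) E E'"
      by (rule homeomorphism_of_subsets[OF E' UM[OF p(1)]]) auto
    then have "homeomorphism (E ` U p) (U p) E' E" by (rule homeomorphism_symD)
    from homeomorphism_compose[OF this U(4)[OF p(1)]]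
    have hom: "homeomorphism (E ` U p) (T p) (f \<circ> E') (E \<circ> g p)" .
    have "fst w = (f \<circ> E') w" if "w \<in> E ` U p" for w
      using that E' UM[OF p(1)] fstE by (auto simp: homeomorphism_def subset_iff)
    then have "homeomorphism (E ` U p) (T p) fst (E \<circ> g p)"
      by (rule homeomorphism_cong[OF hom refl refl]) auto
    then show "\<exists>U' T g. z \<in> U' \<and> openin (top_of_set M') U' \<and> openin (top_of_set S) T \<and> homeomorphism U' T fst g"
      using opE U(1,3)[OF p(1)] p by blast
  qed
  obtain a where a: "a \<in> M'" using M(3) unfolding M'_def by blast
  have fa: "fst a \<in> S" using a fM by (auto simp: M'_def fstE)
  have idS: "(\<lambda>y. y) \<in> S \<rightarrow> S" by simp
  \<comment> \<open>\<open>s\<close> lifts the identity of \<open>S\<close> to a section of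
    \<open>fst\<close> through \<open>a\<close>. Both \<open>s \<circ> fst\<close> and
    \<open>id\<close> lift \<open>fst\<close> on the connected \<open>M'\<close> and agree at
    \<open>a\<close>; hence they coincide, and \<open>fst\<close> is injective.\<close>
  obtain s where s: "continuous_on S s" "s \<in> S \<rightarrow> M'" "s (fst a) = a" "\<And>y. y \<in> S \<Longrightarrow> fst (s y) = y"
    using covering_space_lift_strong[OF cov a fa S(2,3) continuous_on_id idS refl] by blast
  have fstS: "fst z \<in> S" if "z \<in> M'" for z using that fM by (auto simp: M'_def fstE)
  have "s (fst z) = z" if z: "z \<in> M'" for z
  proof -
    have "(s \<circ> fst) z = id z"
    proof (rule covering_space_lift_unique[OF cov, where T = M' and a = a and x = z and f = fst
          and ?g1.0 = "s \<circ> fst" and ?g2.0 = id])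
      show "continuous_on M' (s \<circ> fst)"
        by (intro continuous_on_compose continuous_intros continuous_on_subset[OF s(1)]) (use fstS in auto)
      show "connected M'" unfolding M'_def by (rule connected_continuous_image[OF contE M(2)])
    qed (use s fstS a z in \<open>auto intro: continuous_intros\<close>)
    then show ?thesis by simp
  qed
  then have "inj_on fst M'" by (metis inj_on_inverseI)
  then have "inj_on f M"
    using injE unfolding M'_def inj_on_def by (metis fstE imageI)
  then show ?thesis using fM by (simp add: bij_betw_def)
qed

section \<open>The rigidity theorem\<close>

lemma smooth_map_continuous_on:
  fixes M :: "'m::t2_space set" and \<A> :: "('m, 'a::euclidean_space) chart set"
    and f :: "'m \<Rightarrow> 'b::euclidean_space"
  assumes M: "smooth_atlas M \<A>" and f: "smooth_map \<A> f"
  shows "continuous_on M f"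
  unfolding continuous_on_eq_continuous_within
proof
  fix p assume p: "p \<in> M"
  obtain U \<phi> where c: "chart_at \<A> p = (U, \<phi>)" by force
  note cA = chart_at_props[OF M p c]
  note ch = chart_props[OF M cA(1)]
  have "continuous_on (\<phi> ` U) (f \<circ> inv_into U \<phi>)"
  proof -
    have "smooth_on (\<phi> ` U) (f \<circ> inv_into U \<phi>)" using f cA(1) by (auto simp: smooth_map_def)
    then show ?thesis by (rule C_k_on_imp_continuous_on[OF smooth_on_C])
  qed
  moreover have "continuous_on U \<phi>" using ch(4) by (simp add: homeomorphism_def)
  ultimately have "continuous_on U ((f \<circ> inv_into U \<phi>) \<circ> \<phi>)" by (rule continuous_on_compose[rotated])
  moreover have "((f \<circ> inv_into U \<phi>) \<circ> \<phi>) q = f q" if "q \<in> U" for q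
    using ch(4) that by (simp add: homeomorphism_def)
  ultimately have "continuous_on U f" using continuous_on_cong by (metis (no_types, lifting))
  then have "continuous (at p within U) f"
    using cA(2) by (simp add: continuous_on_eq_continuous_within)
  moreover obtain S where S: "open S" "U = M \<inter> S" using ch(2) by (auto simp: openin_open)
  have "at p within M = at p within U"
    by (rule at_within_nhd[of p S]) (use S cA(2) in auto)
  ultimately show "continuous (at p within M) f" by simp
qed

text \<open>A point of the sphere is determined by its projection under \<open>J\<close> and the
  sign of its \<open>\<nu>\<close>-component. Near \<open>p\<close> the inverse of \<open>x\<close>
  is therefore the projection followed by \<open>\<psi>\<close>.\<close>

lemma spherical_local_homeomorphism:
  fixes M :: "'m::t2_space set" and \<A> :: "('m, 'a::euclidean_space) chart set"
    and x N :: "'m \<Rightarrow> 'b::euclidean_space"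
  assumes dim: "DIM('b) = DIM('a) + 1" and M: "smooth_atlas M \<A>"
    and imm: "immersion M \<A> x" and nor: "unit_normal_field M \<A> x N"
    and R: "\<And>q. q \<in> M \<Longrightarrow> norm (x q) = R" and p: "p \<in> M"
  shows "\<exists>U T g. p \<in> U \<and> openin (top_of_set M) U \<and> openin (top_of_set (sphere 0 R)) T
    \<and> homeomorphism U T x g"
proof (rule graph_at_maximum[OF dim M imm nor p])
  show "norm (x q) \<le> norm (x p)" if "q \<in> M" for q using R[OF that] R[OF p] by simp
  fix J :: "'b \<Rightarrow> 'a" and \<nu> :: 'b and \<iota> :: "'a \<Rightarrow> 'b" and e :: real and \<psi> :: "'a \<Rightarrow> 'm"
    and F :: "'a \<Rightarrow> real"
  assume R0: "norm (x p) > 0" and J: "linear J" "J \<nu> = 0"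
    and norm: "\<And>y z. norm (\<iota> y + z *\<^sub>R \<nu>) ^ 2 = y \<bullet> y + z\<^sup>2" and J\<iota>: "\<And>y. J (\<iota> y) = y"
    and decomp: "\<And>z. z = \<iota> (J z) + (z \<bullet> \<nu>) *\<^sub>R \<nu>"
    and e: "e > 0" and \<psi>: "\<psi> 0 = p" "\<psi> ` ball 0 e \<subseteq> M" "continuous_on (ball 0 e) \<psi>"
    "\<And>W. open W \<Longrightarrow> W \<subseteq> ball 0 e \<Longrightarrow> openin (top_of_set M) (\<psi> ` W)"
    and F: "smooth_on (ball 0 e) F" "F 0 = - norm (x p)"
    and graph: "\<And>y. y \<in> ball 0 e \<Longrightarrow> x (\<psi> y) = \<iota> y + F y *\<^sub>R \<nu>"
  have x: "continuous_on M x"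
    using smooth_map_continuous_on[OF M] imm by (auto simp: immersion_def)
  have \<nu>: "\<nu> \<noteq> 0" using norm[of 0 1] norm[of 0 0] by auto
  have Jg: "J (\<iota> y + z *\<^sub>R \<nu>) = y" for y z
    by (simp add: linear_add[OF J(1)] linear_scale[OF J(1)] J(2) J\<iota>)
  have \<nu>g: "(\<iota> y + z *\<^sub>R \<nu>) \<bullet> \<nu> = z" for y z
    using decomp[of "\<iota> y + z *\<^sub>R \<nu>"] \<nu> unfolding Jg by simp
  \<comment> \<open>The condition \<open>F y < 0\<close> keeps the graph in the hemisphere around
    \<open>x p\<close>, on which \<open>J\<close> is injective.\<close>
  define V where "V = ball 0 e \<inter> F -` {..<0}"
  have "continuous_on (ball 0 e) F" using C_k_on_imp_continuous_on[OF smooth_on_C[OF F(1)]] .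
  then have V: "open V" "V \<subseteq> ball 0 e"
    unfolding V_def by (auto intro: continuous_open_preimage)
  define T where "T = sphere 0 R \<inter> (J -` V \<inter> {s. s \<bullet> \<nu> < 0})"
  have contJ: "continuous_on S J" for S
    using J(1) linear_continuous_on linear_linear by blast
  have "open (J -` V)" by (rule open_vimage[OF V(1) contJ])
  moreover have "open {s. s \<bullet> \<nu> < 0}" by (intro open_Collect_less continuous_intros)
  ultimately have T: "openin (top_of_set (sphere 0 R)) T"
    unfolding T_def by (intro openin_open_Int open_Int)
  have "0 \<in> V" using e F(2) R0 by (simp add: V_def)
  then have pV: "p \<in> \<psi> ` V" using \<psi>(1) by blast
  have "homeomorphism (\<psi> ` V) T x (\<psi> \<circ> J)"
  proof (rule homeomorphismI)
    have "\<psi> ` V \<subseteq> M" using V(2) \<psi>(2) by blast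
    then show "continuous_on (\<psi> ` V) x" by (rule continuous_on_subset[OF x])
    have "J ` T \<subseteq> ball 0 e" using V(2) by (auto simp: T_def)
    then show "continuous_on T (\<psi> \<circ> J)"
      by (intro continuous_on_compose contJ continuous_on_subset[OF \<psi>(3)])
    show "x ` \<psi> ` V \<subseteq> T"
    proof safe
      fix y assume y: "y \<in> V"
      then have yb: "y \<in> ball 0 e" using V(2) by blast
      then have "norm (x (\<psi> y)) = R" using R \<psi>(2) by blast
      then show "x (\<psi> y) \<in> T"
        using y unfolding T_def graph[OF yb] by (simp add: Jg \<nu>g) (simp add: V_def)
    qed
    show "(\<psi> \<circ> J) ` T \<subseteq> \<psi> ` V" by (auto simp: T_def)
    show "(\<psi> \<circ> J) (x q) = q" if q: "q \<in> \<psi> ` V" for q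
      using q V(2) graph Jg by force
    show "x ((\<psi> \<circ> J) s) = s" if s: "s \<in> T" for s
    proof -
      have JV: "J s \<in> V" and neg: "s \<bullet> \<nu> < 0" and nR: "norm s = R" using s by (auto simp: T_def)
      have yb: "J s \<in> ball 0 e" using JV V(2) by blast
      have "norm (x (\<psi> (J s))) = R" using R \<psi>(2) yb by blast
      then have "J s \<bullet> J s + (F (J s))\<^sup>2 = R\<^sup>2" using norm graph[OF yb] by metis
      moreover have "J s \<bullet> J s + (s \<bullet> \<nu>)\<^sup>2 = R\<^sup>2" using norm[of "J s" "s \<bullet> \<nu>"] decomp[of s] nR by simp
      ultimately have "(F (J s))\<^sup>2 = (s \<bullet> \<nu>)\<^sup>2" by simp
      moreover have "F (J s) < 0" using JV by (simp add: V_def)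
      ultimately have "F (J s) = s \<bullet> \<nu>" using neg by (auto simp: power2_eq_iff)
      then show ?thesis using graph[OF yb] decomp[of s] by simp
    qed
  qed
  then show ?thesis using pV \<psi>(4)[OF V] T by blast
qed

theorem theorem1p3:
  fixes M :: "'m::t2_space set"
    and \<A> :: "('m, 'a::euclidean_space) chart set"
    and x N :: "'m \<Rightarrow> 'b::euclidean_space"
    and r :: nat
  assumes "DIM('b) = DIM('a) + 1"
    and "closed_manifold M \<A>" and "connected M"
    and "immersion M \<A> x" and "unit_normal_field M \<A> x N"
    and "self_shrinker M \<A> x N"
    and "1 \<le> r" and "r \<le> DIM('a) - 1"
    and "\<exists>c. \<forall>p\<in>M. mean_curv \<A> x N (r + 1) p = c"
  shows "bij_betw x M (sphere 0 (sqrt (2 * real DIM('a))))"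
proof -
  have M: "smooth_atlas M \<A>" "compact M" "M \<noteq> {}"
    using assms(2) by (auto simp: closed_manifold_def)
  \<comment> \<open>The range of \<open>r\<close> forces \<open>DIM('a) \<ge> 2\<close>, so the
    target sphere has dimension at least 2 and is simply connected.\<close>
  have k: "1 \<le> r + 1" "r + 1 \<le> DIM('a)" and dim3: "3 \<le> DIM('b)"
    using assms(1,7,8) by linarith+
  obtain c where c: "\<And>p. p \<in> M \<Longrightarrow> mean_curv \<A> x N (r + 1) p = c" using assms(9) by blast
  have const: "S_curv \<A> x N (r + 1) q = c * real (DIM('a) choose (r + 1))" if "q \<in> M" for q
  proof -
    have "real (DIM('a) choose (r + 1)) > 0" using k(2) by (simp only: of_nat_0_less_iff zero_less_binomial)
    then show ?thesis using c[OF that] by (simp only: mean_curv_def field_simps)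
  qed
  have x: "continuous_on M x"
    using smooth_map_continuous_on[OF M(1)] assms(4) by (auto simp: immersion_def)
  then have nx: "continuous_on M (\<lambda>q. norm (x q))" by (intro continuous_intros)
  obtain p where p: "p \<in> M" "\<And>q. q \<in> M \<Longrightarrow> norm (x q) \<le> norm (x p)"
    using continuous_attains_sup[OF M(2,3) nx] by blast
  define R where "R = norm (x p)"
  note rigid = local_rigidity[OF assms(1) M(1) assms(4-6) k const]
  have R: "R = sqrt (2 * real DIM('a))" unfolding R_def using rigid[OF _ p] by blast
  define A where "A = M \<inter> (\<lambda>q. norm (x q)) -` {R}"
  have "closedin (top_of_set M) A"
    unfolding A_def by (rule continuous_closedin_preimage[OF nx]) simp
  moreover have "openin (top_of_set M) A"
  proof (subst openin_subopen, intro ballI)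
    fix q assume "q \<in> A"
    then have q: "q \<in> M" "norm (x q) = R" by (auto simp: A_def)
    have "norm (x q') \<le> norm (x q)" if "q' \<in> M" for q' using p(2)[OF that] q(2) by (simp add: R_def)
    then obtain W where W: "openin (top_of_set M) W" "q \<in> W" "\<forall>q'\<in>W. norm (x q') = norm (x q)"
      using rigid[OF _ q(1)] by blast
    then show "\<exists>T. openin (top_of_set M) T \<and> q \<in> T \<and> T \<subseteq> A"
      using openin_imp_subset[OF W(1)] q(2) by (intro exI[of _ W]) (auto simp: A_def)
  qed
  moreover have "p \<in> A" using p(1) by (simp add: A_def R_def)
  ultimately have "A = M" using assms(3) unfolding connected_clopen by blast
  then have xR: "norm (x q) = R" if "q \<in> M" for q using that by (auto simp: A_def)
  have "bij_betw x M (sphere 0 R)"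
  proof (rule local_homeomorphism_simply_connected_bij[OF M(2) assms(3) M(3) x])
    show "x ` M \<subseteq> sphere 0 R" using xR by auto
    show "connected (sphere (0::'b) R)" using dim3 by (intro connected_sphere) simp
    show "simply_connected (sphere (0::'b) R)" by (rule simply_connected_sphere[OF dim3])
    show "locally path_connected (sphere (0::'b) R)" by (rule locally_path_connected_sphere)
  qed (rule spherical_local_homeomorphism[OF assms(1) M(1) assms(4,5) xR])
  then show ?thesis by (simp add: R)
qed

end
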